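(* Let $F\subset\mathbb{R}^2_{\geq}$ be a compact convex polygon, not equal to a segment, such that the associated convex polygonal semigroup $\mathcal{P}=\bigcup_{i=0}^{\infty}(iF)\cap\mathbb{N}^2$ is affine (finitely generated); it is then simplicial. Let $\mathcal{C}$, $\tau_1,\tau_2$, $\overline{\mathcal{P}}$, $\Upsilon$ and $\Upsilon'$ be the objects attached to $F$ as defined in the context. Then: (1) if $\mathrm{int}(\mathcal{C})=\mathrm{int}(\overline{\mathcal{P}})$, the semigroup $\mathcal{P}$ is Buchsbaum if and only if $\overline{\mathcal{P}}\cap\tau_j$ is generated by only one element for $j=1,2$; (2) if $\mathrm{int}(\mathcal{C})\neq\mathrm{int}(\overline{\mathcal{P}})$, the semigroup $\mathcal{P}$ is Buchsbaum if and only if $\Upsilon'=\emptyset$ and $\Upsilon\subset\overline{\mathcal{P}}$.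
   Context: Conventions: $\mathbb{N}$ contains $0$; $O$ is the origin; $\overline{AB}$ denotes the segment with endpoints $A,B$, and $h\overline{AB}$ its dilation by $h$. For $G\subset\mathbb{R}^2_{\geq}$ (points with nonnegative coordinates), $L_{\mathbb{Q}_{\geq}}(G)=\{\sum_{i=1}^p q_if_i \mid p\in\mathbb{N},\ q_i\in\mathbb{Q}_{\geq},\ f_i\in G\}$. An affine semigroup $S\subset\mathbb{N}^2$ is a finitely generated submonoid; it is simplicial if $L_{\mathbb{Q}_{\geq}}(S)=L_{\mathbb{Q}_{\geq}}(\{s_1,s_2\})$ for two (linearly independent) elements of its generating set. Let $\Bbbk$ be a field; $\Bbbk[S]$ is the subring of $\Bbbk[t_1,t_2]$ generated by the monomials $t_1^{s_1}t_2^{s_2}$, $(s_1,s_2)\in S$, and $S$ is called Buchsbaum if $\Bbbk[S]$ is a Buchsbaum ring. Objects attached to $F$. Let $\mathcal{C}=L_{\mathbb{Q}_{\geq}}(F)\cap\mathbb{N}^2$, and let $\tau_1,\tau_2$ be the two extremal rays (half-lines from $O$) of the cone, $\tau_1$ having the greater slope. For $X\subset\mathcal{C}$, $\mathrm{int}(X)=X\setminus(\tau_1\cup\tau_2)$. Let $\{n_1,\ldots,n_m\}$ be the minimal system of generators of $\mathcal{P}$ and $\overline{\mathcal{P}}=\{a\in\mathbb{N}^2\mid a+n_i\in\mathcal{P}\ \text{for all } i=1,\ldots,m\}$, which is a semigroup contained in $\mathcal{C}$. For $j=1,2$ let $n_j'$ be a (fixed) minimal generator of $\overline{\mathcal{P}}\cap\tau_j$.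 For each $i\in\{1,2\}$ define a line (or ray) $\nu_i$ and a finite set $\Upsilon_i$ as follows. - Case $i=1$ and $F\cap\tau_1$ is a single point. This point is a vertex of $F$; label the vertices of $F$ in counterclockwise order $P_1,P_2,\ldots,P_t$ with $F\cap\tau_1=\{P_1\}$. Let $j$ be the least positive integer such that $j\overline{P_1P_t}\cap(j+1)\overline{P_1P_2}\neq\emptyset$; this intersection is a single point $V_1$. For all integers $h\ge j$ the points $h\overline{P_1P_t}\cap(h+1)\overline{P_1P_2}$ lie on one straight line (parallel to $\tau_1$), denoted $\nu_1$. Put $\Upsilon_1=\mathrm{ConvexHull}(\{O,\,jP_1,\,V_1,\,\nu_1\cap\tau_2\})\cap\mathbb{N}^2$. - Case $i=2$ and $F\cap\tau_2$ is a single point. Relabel the vertices in counterclockwise order $P_1,\ldots,P_t$ so that $F\cap\tau_2=\{P_1\}$. Let $j$ be the least positive integer such that $j\overline{P_1P_2}\cap(j+1)\overline{P_1P_t}\neq\emptyset$; this intersection is a single point $V_2$. Let $\nu_2$ be the line (parallel to $\tau_2$) containing the points $h\overline{P_1P_2}\cap(h+1)\overline{P_1P_t}$ for all integers $h\ge j$. Put $\Upsilon_2=\mathrm{ConvexHull}(\{O,\,jP_1,\,V_2,\,\nu_2\cap\tau_1\})\cap\mathbb{N}^2$. - Case $F\cap\tau_i$ is a segment: put $\nu_i=\tau_i$ and $\Upsilon_i=\{O\}$. Let $Q$ be the point with $\{Q\}=\nu_1\cap\nu_2$ (it lies in $L_{\mathbb{Q}_{\geq}}(F)$), and define $$\Upsilon=(Q+L_{\mathbb{Q}_{\geq}}(F))\cap\mathbb{N}^2,\qquad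 \Upsilon'=\{a\in(\Upsilon_1\cup\Upsilon_2)\setminus\overline{\mathcal{P}}\ \mid\ a+n_1'\in\overline{\mathcal{P}}\ \text{and}\ a+n_2'\in\overline{\mathcal{P}}\}.$$ *)

theory Defs
  imports
    "HOL-Analysis.Analysis"
    "HOL-Algebra.Algebra"
    "HOL-Algebra.Algebraic_Closure_Type"
    "HOL-Library.Poly_Mapping"
    "HOL-Library.Extended_Nat"
begin

section \<open>Buchsbaum rings\<close>

text \<open>The localization of a commutative ring \<open>R\<close> at a multiplicative subset \<open>S\<close>; its elements are
  the equivalence classes of pairs (numerator, denominator).\<close>

definition frac_class :: "('a, 'b) ring_scheme \<Rightarrow> 'a set \<Rightarrow> 'a \<Rightarrow> 'a \<Rightarrow> ('a \<times> 'a) set" where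
  "frac_class R S r s =
     {(r', s'). r' \<in> carrier R \<and> s' \<in> S \<and>
        (\<exists>u\<in>S. u \<otimes>\<^bsub>R\<^esub> (s' \<otimes>\<^bsub>R\<^esub> r \<ominus>\<^bsub>R\<^esub> s \<otimes>\<^bsub>R\<^esub> r') = \<zero>\<^bsub>R\<^esub>)}"

text \<open>The unions below are unions of equal classes.\<close>

definition localization :: "('a, 'b) ring_scheme \<Rightarrow> 'a set \<Rightarrow> ('a \<times> 'a) set ring" where
  "localization R S =
     \<lparr>carrier = {frac_class R S r s | r s. r \<in> carrier R \<and> s \<in> S},
      monoid.mult = (\<lambda>U W. \<Union>x\<in>U. \<Union>y\<in>W. frac_class R S (fst x \<otimes>\<^bsub>R\<^esub> fst y) (snd x \<otimes>\<^bsub>R\<^esub> snd y)),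
      one = frac_class R S \<one>\<^bsub>R\<^esub> \<one>\<^bsub>R\<^esub>,
      ring.zero = frac_class R S \<zero>\<^bsub>R\<^esub> \<one>\<^bsub>R\<^esub>,
      add = (\<lambda>U W. \<Union>x\<in>U. \<Union>y\<in>W.
               frac_class R S (fst x \<otimes>\<^bsub>R\<^esub> snd y \<oplus>\<^bsub>R\<^esub> fst y \<otimes>\<^bsub>R\<^esub> snd x) (snd x \<otimes>\<^bsub>R\<^esub> snd y))\<rparr>"

definition krull_dim :: "('a, 'b) ring_scheme \<Rightarrow> enat" where
  "krull_dim R = Sup {enat n | n. \<exists>p :: nat \<Rightarrow> 'a set.
     (\<forall>i\<le>n. primeideal (p i) R) \<and> (\<forall>i<n. p i \<subset> p (Suc i))}"

text \<open>For a local ring \<open>A\<close> with maximal ideal \<open>m\<close>: \<open>dim A\<close> elements of \<open>m\<close> generating an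
  \<open>m\<close>-primary ideal. An ideal contained in \<open>m\<close> is \<open>m\<close>-primary iff its radical is \<open>m\<close>.\<close>

definition system_of_parameters :: "('a, 'b) ring_scheme \<Rightarrow> 'a set \<Rightarrow> 'a list \<Rightarrow> bool" where
  "system_of_parameters A m xs \<longleftrightarrow>
     enat (length xs) = krull_dim A \<and> set xs \<subseteq> m \<and>
     (\<forall>y\<in>m. \<exists>n::nat. y [^]\<^bsub>A\<^esub> n \<in> Idl\<^bsub>A\<^esub> (set xs))"

text \<open>\<open>m \<cdot> ((x\<^sub>1, \<dots>, x\<^sub>i\<^sub>-\<^sub>1) : x\<^sub>i) \<subseteq> (x\<^sub>1, \<dots>, x\<^sub>i\<^sub>-\<^sub>1)\<close> for all \<open>i\<close>.\<close>

definition weak_sequence :: "('a, 'b) ring_scheme \<Rightarrow> 'a set \<Rightarrow> 'a list \<Rightarrow> bool" where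
  "weak_sequence A m xs \<longleftrightarrow>
     (\<forall>i<length xs. \<forall>a\<in>carrier A.
        a \<otimes>\<^bsub>A\<^esub> (xs ! i) \<in> Idl\<^bsub>A\<^esub> (set (take i xs)) \<longrightarrow>
        (\<forall>y\<in>m. y \<otimes>\<^bsub>A\<^esub> a \<in> Idl\<^bsub>A\<^esub> (set (take i xs))))"

definition buchsbaum_local_ring :: "('a, 'b) ring_scheme \<Rightarrow> bool" where
  "buchsbaum_local_ring A \<longleftrightarrow> cring A \<and> noetherian_ring A \<and>
     (\<exists>m. maximalideal m A \<and> (\<forall>m'. maximalideal m' A \<longrightarrow> m' = m) \<and>
        (\<forall>xs. system_of_parameters A m xs \<longrightarrow> weak_sequence A m xs))"

definition buchsbaum_ring :: "('a, 'b) ring_scheme \<Rightarrow> bool" where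
  "buchsbaum_ring R \<longleftrightarrow> cring R \<and> noetherian_ring R \<and>
     (\<forall>M. maximalideal M R \<longrightarrow> buchsbaum_local_ring (localization R (carrier R - M)))"


section \<open>Submonoids of the lattice and their semigroup rings\<close>

definition is_submonoid :: "'a::monoid_add set \<Rightarrow> bool" where
  "is_submonoid S \<longleftrightarrow> 0 \<in> S \<and> (\<forall>a\<in>S. \<forall>b\<in>S. a + b \<in> S)"

definition affine_semigroup :: "(nat \<times> nat) set \<Rightarrow> bool" where
  "affine_semigroup S \<longleftrightarrow> (\<exists>A. finite A \<and> S = is_submonoid hull A)"

definition minimal_generating_set :: "(nat \<times> nat) set \<Rightarrow> (nat \<times> nat) set \<Rightarrow> bool" where
  "minimal_generating_set A S \<longleftrightarrow>
     is_submonoid hull A = S \<and> (\<forall>B. B \<subset> A \<longrightarrow> is_submonoid hull B \<noteq> S)"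

definition minimal_generator :: "nat \<times> nat \<Rightarrow> (nat \<times> nat) set \<Rightarrow> bool" where
  "minimal_generator n S \<longleftrightarrow> (\<exists>A. minimal_generating_set A S \<and> n \<in> A)"

definition singly_generated :: "(nat \<times> nat) set \<Rightarrow> bool" where
  "singly_generated S \<longleftrightarrow> (\<exists>g. S = is_submonoid hull {g})"

text \<open>\<open>k[t\<^sub>1, t\<^sub>2]\<close> is the type \<open>(nat \<times> nat) \<Rightarrow>\<^sub>0 'k\<close>, whose multiplication is convolution over the
  additive monoid of exponents; \<open>t\<^sub>1\<^sup>a t\<^sub>2\<^sup>b\<close> is \<open>single (a, b) 1\<close> and the constant \<open>c\<close> is
  \<open>single 0 c\<close>. The semigroup ring is a \<open>k\<close>-subalgebra, so the constants are among the
  generators.\<close>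

definition semigroup_ring :: "'k::field itself \<Rightarrow> (nat \<times> nat) set \<Rightarrow> ((nat \<times> nat) \<Rightarrow>\<^sub>0 'k) ring" where
  "semigroup_ring _ S = ring_of_type_algebra
     \<lparr>carrier := generate_ring ring_of_type_algebra
        (range (\<lambda>c. Poly_Mapping.single 0 c) \<union> (\<lambda>s. Poly_Mapping.single s 1) ` S)\<rparr>"

definition buchsbaum_semigroup :: "'k::field itself \<Rightarrow> (nat \<times> nat) set \<Rightarrow> bool" where
  "buchsbaum_semigroup k S \<longleftrightarrow> buchsbaum_ring (semigroup_ring k S)"


section \<open>Cones and convex polygonal semigroups\<close>

definition pt :: "nat \<times> nat \<Rightarrow> real \<times> real" where
  "pt a = (real (fst a), real (snd a))"

definition rat_cone :: "(real \<times> real) set \<Rightarrow> (real \<times> real) set" where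
  "rat_cone G = {(\<Sum>i<p. q i *\<^sub>R f i) | (p::nat) (q::nat \<Rightarrow> real) (f::nat \<Rightarrow> real \<times> real).
     \<forall>i<p. q i \<in> \<rat> \<and> 0 \<le> q i \<and> f i \<in> G}"

definition simplicial_semigroup :: "(nat \<times> nat) set \<Rightarrow> bool" where
  "simplicial_semigroup S \<longleftrightarrow>
     (\<exists>A. finite A \<and> minimal_generating_set A S \<and>
        (\<exists>s1\<in>A. \<exists>s2\<in>A. s1 \<noteq> s2 \<and> independent {pt s1, pt s2} \<and>
           rat_cone (pt ` S) = rat_cone {pt s1, pt s2}))"

abbreviation dilate :: "nat \<Rightarrow> (real \<times> real) set \<Rightarrow> (real \<times> real) set" where
  "dilate h G \<equiv> (\<lambda>x. real h *\<^sub>R x) ` G"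

definition polygonal_semigroup :: "(real \<times> real) set \<Rightarrow> (nat \<times> nat) set" where
  "polygonal_semigroup F = {a. \<exists>i. pt a \<in> dilate i F}"

definition lattice_cone :: "(real \<times> real) set \<Rightarrow> (nat \<times> nat) set" where
  "lattice_cone F = {a. pt a \<in> rat_cone F}"

definition on_ray :: "(nat \<times> nat) set \<Rightarrow> (real \<times> real) set \<Rightarrow> (nat \<times> nat) set" where
  "on_ray G \<tau> = {a \<in> G. pt a \<in> \<tau>}"

definition int_part ::
    "(real \<times> real) set \<Rightarrow> (real \<times> real) set \<Rightarrow> (nat \<times> nat) set \<Rightarrow> (nat \<times> nat) set" where
  "int_part \<tau>1 \<tau>2 G = {a \<in> G. pt a \<notin> \<tau>1 \<union> \<tau>2}"

text \<open>The semigroup written as a barred letter in the literature; \<open>N\<close> is the minimal generating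
  set of \<open>S\<close>.\<close>

definition semigroup_bar :: "(nat \<times> nat) set \<Rightarrow> (nat \<times> nat) set \<Rightarrow> (nat \<times> nat) set" where
  "semigroup_bar N S = {a. \<forall>n\<in>N. a + n \<in> S}"

text \<open>Extremal rays are the one-dimensional faces with apex \<open>O\<close> of the real cone over \<open>F\<close>. The
  slopes are compared after clearing denominators, so that a vertical ray has infinite slope.\<close>

definition extremal_rays ::
    "(real \<times> real) set \<Rightarrow> (real \<times> real) set \<Rightarrow> (real \<times> real) set \<Rightarrow> bool" where
  "extremal_rays F \<tau>1 \<tau>2 \<longleftrightarrow>
     (\<exists>v1 v2. \<tau>1 = {c *\<^sub>R v1 | c. 0 \<le> c} \<and> \<tau>2 = {c *\<^sub>R v2 | c. 0 \<le> c} \<and>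
        \<tau>1 face_of (convex_cone hull F) \<and> \<tau>2 face_of (convex_cone hull F) \<and>
        snd v2 * fst v1 < snd v1 * fst v2)"


section \<open>The lines \<open>\<nu>\<^sub>i\<close> and the sets \<open>\<Upsilon>\<^sub>i\<close>\<close>

text \<open>The list enumerates the vertices, and any three of them taken in list order are positively
  oriented.\<close>

definition ccw_vertices :: "(real \<times> real) set \<Rightarrow> (real \<times> real) list \<Rightarrow> bool" where
  "ccw_vertices F vs \<longleftrightarrow> distinct vs \<and> set vs = {v. v extreme_point_of F} \<and>
     (\<forall>i j k. i < j \<and> j < k \<and> k < length vs \<longrightarrow>
        0 < fst (vs ! j - vs ! i) * snd (vs ! k - vs ! i)
          - snd (vs ! j - vs ! i) * fst (vs ! k - vs ! i))"

definition crossing ::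
    "real \<times> real \<Rightarrow> real \<times> real \<Rightarrow> real \<times> real \<Rightarrow> nat \<Rightarrow> (real \<times> real) set" where
  "crossing P A B h = dilate h (closed_segment P A) \<inter> dilate (Suc h) (closed_segment P B)"

text \<open>The common part of the two single-point cases, where \<open>P\<close> is the vertex on the ray in question
  and \<open>\<tau>\<close> is the opposite ray. The crossings are nonempty for all \<open>h \<ge> j\<close> and pairwise distinct,
  so they determine the line \<open>\<nu>\<close>.\<close>

definition strip ::
    "real \<times> real \<Rightarrow> real \<times> real \<Rightarrow> real \<times> real \<Rightarrow> (real \<times> real) set \<Rightarrow>
     (real \<times> real) set \<Rightarrow> (nat \<times> nat) set \<Rightarrow> bool" where
  "strip P A B \<tau> \<nu> \<Upsilon> \<longleftrightarrow>
     (\<exists>j V. 0 < j \<and> (\<forall>i. 0 < i \<and> i < j \<longrightarrow> crossing P A B i = {}) \<and>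
        crossing P A B j = {V} \<and>
        affine \<nu> \<and> aff_dim \<nu> = 1 \<and> (\<forall>h\<ge>j. crossing P A B h \<subseteq> \<nu>) \<and>
        \<Upsilon> = {a. pt a \<in> convex hull ({0, real j *\<^sub>R P, V} \<union> (\<nu> \<inter> \<tau>))})"

definition segment_case ::
    "(real \<times> real) set \<Rightarrow> (real \<times> real) set \<Rightarrow> (real \<times> real) set \<Rightarrow> (nat \<times> nat) set \<Rightarrow> bool" where
  "segment_case F \<tau> \<nu> \<Upsilon> \<longleftrightarrow>
     (\<exists>a b. a \<noteq> b \<and> F \<inter> \<tau> = closed_segment a b) \<and> \<nu> = \<tau> \<and> \<Upsilon> = {0}"

text \<open>In the next two definitions \<open>vs ! 0\<close>, \<open>vs ! 1\<close> and \<open>last vs\<close> are \<open>P\<^sub>1\<close>, \<open>P\<^sub>2\<close> and \<open>P\<^sub>t\<close>; the last two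
  change roles between the two rays.\<close>

definition nu_upsilon_1 ::
    "(real \<times> real) set \<Rightarrow> (real \<times> real) set \<Rightarrow> (real \<times> real) set \<Rightarrow>
     (real \<times> real) set \<Rightarrow> (nat \<times> nat) set \<Rightarrow> bool" where
  "nu_upsilon_1 F \<tau>1 \<tau>2 \<nu>1 \<Upsilon>1 \<longleftrightarrow>
     (\<exists>vs. ccw_vertices F vs \<and> F \<inter> \<tau>1 = {vs ! 0} \<and>
        strip (vs ! 0) (last vs) (vs ! 1) \<tau>2 \<nu>1 \<Upsilon>1) \<or>
     segment_case F \<tau>1 \<nu>1 \<Upsilon>1"

definition nu_upsilon_2 ::
    "(real \<times> real) set \<Rightarrow> (real \<times> real) set \<Rightarrow> (real \<times> real) set \<Rightarrow>
     (real \<times> real) set \<Rightarrow> (nat \<times> nat) set \<Rightarrow> bool" where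
  "nu_upsilon_2 F \<tau>1 \<tau>2 \<nu>2 \<Upsilon>2 \<longleftrightarrow>
     (\<exists>vs. ccw_vertices F vs \<and> F \<inter> \<tau>2 = {vs ! 0} \<and>
        strip (vs ! 0) (vs ! 1) (last vs) \<tau>1 \<nu>2 \<Upsilon>2) \<or>
     segment_case F \<tau>2 \<nu>2 \<Upsilon>2"

definition Upsilon :: "(real \<times> real) set \<Rightarrow> real \<times> real \<Rightarrow> (nat \<times> nat) set" where
  "Upsilon F Q = {a. pt a \<in> (\<lambda>x. Q + x) ` rat_cone F}"

definition Upsilon' ::
    "(nat \<times> nat) set \<Rightarrow> (nat \<times> nat) set \<Rightarrow> (nat \<times> nat) set \<Rightarrow> nat \<times> nat \<Rightarrow> nat \<times> nat \<Rightarrow>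
     (nat \<times> nat) set" where
  "Upsilon' \<Upsilon>1 \<Upsilon>2 Pbar n1 n2 = {a \<in> (\<Upsilon>1 \<union> \<Upsilon>2) - Pbar. a + n1 \<in> Pbar \<and> a + n2 \<in> Pbar}"

end

theory Submission
  imports Defs
begin

text \<open>
  Write \<open>Pb\<close> for the bar semigroup and let \<open>n\<^sub>1\<close>, \<open>n\<^sub>2\<close> be nonzero elements of \<open>Pb\<close> on the two
  extremal rays. Then \<open>P\<close> is Buchsbaum iff \<open>a + n\<^sub>1 \<in> Pb\<close> and \<open>a + n\<^sub>2 \<in> Pb\<close> always imply \<open>a \<in> Pb\<close>: this
  condition makes \<open>k[Pb]\<close> Cohen--Macaulay, and the irrelevant maximal ideal multiplies \<open>k[Pb]\<close> into
  \<open>k[P]\<close>. The Krull dimension is at most 2 because any three elements are algebraically dependent,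
  and it is 2 at the irrelevant maximal ideal because a face of the cone gives an intermediate prime.

  Along a ray that meets \<open>F\<close> in one vertex \<open>P\<^sub>1\<close>, the gaps between consecutive dilates \<open>hF\<close> and
  \<open>(h+1)F\<close> are translates of each other by \<open>P\<^sub>1\<close>, and they all lie between \<open>\<tau>\<^sub>i\<close> and \<open>\<nu>\<^sub>i\<close>. Hence a point
  on or beyond \<open>\<nu>\<^sub>i\<close> enters \<open>P\<close> when moved far enough along the ray, whereas a point before \<open>\<nu>\<^sub>i\<close> that
  can be moved into \<open>P\<close> lies in \<open>P\<close> or in \<open>\<Upsilon>\<^sub>i\<close>. So a point violating the criterion lies in \<open>\<Upsilon>'\<close> or
  beyond both lines, that is, in \<open>\<Upsilon>\<close>.\<close>

text \<open>The Buchsbaum condition ranges over all maximal ideals M of k[P] and all systems of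
  parameters, whereas regularity on k[Pb] is directly accessible only for polynomials in one ray
  monomial. Dimension is the bridge: a chain of primes of length two inside M forces nonzero
  polynomials in each of the two ray monomials into M, powers of these are combinations of the
  parameters up to denominators, and their regularity on k[Pb] carries over to the parameters. At a
  maximal ideal other than the irrelevant one, k[P] and k[Pb] have the same localization.

  For the converse one system of parameters suffices, the squares of the ray monomials at the
  irrelevant ideal. Squares occur because a + n1 in Pb does not put a + n1 into P, but does put a +
  2 n1 there.

  On the geometric side, F may have irrational vertices while its cone only allows rational
  coefficients. Inside the cone a small perturbation repairs this; on the boundary rays it has to be
  argued separately, which explains the extra alternative in \<open>side\<close>.\<close>

section \<open>Subrings of a commutative ring type that are integral domains\<close>

locale type_domain =
  fixes U :: "'a::comm_ring_1 set"
  assumes zero_closed [simp]: "0 \<in> U"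
    and one_closed [simp]: "1 \<in> U"
    and add_closed [simp]: "x \<in> U \<Longrightarrow> y \<in> U \<Longrightarrow> x + y \<in> U"
    and mult_closed [simp]: "x \<in> U \<Longrightarrow> y \<in> U \<Longrightarrow> x * y \<in> U"
    and uminus_closed [simp]: "x \<in> U \<Longrightarrow> - x \<in> U"
    and integral: "x \<in> U \<Longrightarrow> y \<in> U \<Longrightarrow> x * y = 0 \<Longrightarrow> x = 0 \<or> y = 0"
begin

text \<open>Ideals and localizations need a ring record, while identities are easier in the type
  class; the simp rules below translate the former into the latter.\<close>

definition R :: "'a ring" where "R = ring_of_type_algebra\<lparr>carrier := U\<rparr>"

lemma R_simps [simp]:
  "carrier R = U" "x \<otimes>\<^bsub>R\<^esub> y = x * y" "x \<oplus>\<^bsub>R\<^esub> y = x + y" "\<one>\<^bsub>R\<^esub> = 1" "\<zero>\<^bsub>R\<^esub> = 0"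
  by (simp_all add: R_def ring_of_type_algebra_def)

lemma minus_closed [simp]: "x \<in> U \<Longrightarrow> y \<in> U \<Longrightarrow> x - y \<in> U"
  using add_closed[of x "- y"] by simp

lemma power_closed [simp]: "x \<in> U \<Longrightarrow> x ^ n \<in> U"
  by (induction n) auto

lemma cancel: "x \<in> U \<Longrightarrow> y \<in> U \<Longrightarrow> z \<in> U \<Longrightarrow> z \<noteq> 0 \<Longrightarrow> z * x = z * y \<Longrightarrow> x = y"
  using integral[of z "x - y"] by (auto simp: algebra_simps)

lemma cring_R: "cring R"
proof (rule cringI)
  show "abelian_group R"
  proof (rule abelian_groupI)
    fix x assume "x \<in> carrier R"
    then show "\<exists>y\<in>carrier R. y \<oplus>\<^bsub>R\<^esub> x = \<zero>\<^bsub>R\<^esub>" by (intro bexI[of _ "- x"]) auto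
  qed (auto simp: algebra_simps)
  show "comm_monoid R" by (rule comm_monoidI) (auto simp: algebra_simps)
qed (auto simp: algebra_simps)

lemma domain_R: "domain R"
  using cring_R integral by (intro domain.intro domain_axioms.intro) auto

sublocale R: domain R by (rule domain_R)

lemma R_a_inv [simp]: "x \<in> U \<Longrightarrow> \<ominus>\<^bsub>R\<^esub> x = - x"
  using R.minus_equality[of "- x" x] by simp

lemma R_minus [simp]: "x \<in> U \<Longrightarrow> y \<in> U \<Longrightarrow> x \<ominus>\<^bsub>R\<^esub> y = x - y"
  by (simp add: a_minus_def)

lemma ideal_R_iff: "ideal I R \<longleftrightarrow> I \<subseteq> U \<and> 0 \<in> I \<and> (\<forall>x\<in>I. \<forall>y\<in>I. x + y \<in> I) \<and> (\<forall>x\<in>I. \<forall>r\<in>U. r * x \<in> I)"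
  (is "_ \<longleftrightarrow> ?r")
proof
  assume "ideal I R"
  then interpret ideal I R .
  show ?r using a_subset a_closed zero_closed I_l_closed by auto
next
  assume r: ?r
  show "ideal I R"
  proof (rule idealI)
    show "ring R" by (rule R.ring_axioms)
    show "subgroup I (add_monoid R)"
    proof (rule R.add.subgroupI)
      fix a assume a: "a \<in> I"
      then have "(- 1) * a \<in> I" using r by (meson one_closed uminus_closed)
      then show "\<ominus>\<^bsub>R\<^esub> a \<in> I" using a r by (auto simp: subset_iff)
    qed (use r in auto)
  qed (use r in \<open>auto simp: mult.commute\<close>)
qed

end

section \<open>Localization of a domain at a multiplicative set\<close>

locale type_domain_loc = type_domain +
  fixes S
  assumes S_sub: "S \<subseteq> U" and S_one [simp]: "1 \<in> S" and S_zero: "0 \<notin> S"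
    and S_mult [simp]: "s \<in> S \<Longrightarrow> t \<in> S \<Longrightarrow> s * t \<in> S"
begin

lemma S_U [simp]: "s \<in> S \<Longrightarrow> s \<in> U" using S_sub by auto
lemma S_nz [simp]: "s \<in> S \<Longrightarrow> s \<noteq> 0" using S_zero by auto
lemma S_pow [simp]: "s \<in> S \<Longrightarrow> s ^ n \<in> S" by (induction n) auto

definition fr :: "'a \<Rightarrow> 'a \<Rightarrow> ('a \<times> 'a) set" where "fr = frac_class R S"

definition L where "L = localization R S"

text \<open>The witness u of \<open>frac_class\<close> is a nonzero element of a domain and cancels,
  so equality of fractions is plain cross-multiplication.\<close>

lemma fr_eq: "r \<in> U \<Longrightarrow> s \<in> S \<Longrightarrow> fr r s = {(r', s'). r' \<in> U \<and> s' \<in> S \<and> s' * r = s * r'}"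
  unfolding fr_def frac_class_def
proof (rule Collect_cong, clarsimp, rule conj_cong[OF refl], rule conj_cong[OF refl], goal_cases)
  case (1 r' s')
  have "(\<exists>u\<in>S. u * (s' * r - s * r') = 0) \<longleftrightarrow> s' * r - s * r' = 0" if "r' \<in> U" "s' \<in> S"
    using integral[of _ "s' * r - s * r'"] S_nz that 1 by (metis S_U S_one minus_closed mult_closed mult_zero_right)
  then show ?case using 1 by simp
qed

lemma fr_self: "r \<in> U \<Longrightarrow> s \<in> S \<Longrightarrow> (r, s) \<in> fr r s"
  by (simp add: fr_eq)

lemma fr_eq_iff:
  assumes "r \<in> U" "s \<in> S" "r' \<in> U" "s' \<in> S"
  shows "fr r s = fr r' s' \<longleftrightarrow> s' * r = s * r'"
proof
  assume "fr r s = fr r' s'"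
  then have "(r', s') \<in> fr r s" using fr_self[of r' s'] assms by simp
  then show "s' * r = s * r'" using assms by (simp add: fr_eq)
next
  assume e: "s' * r = s * r'"
  have "t * r = s * x \<longleftrightarrow> t * r' = s' * x" if "x \<in> U" "t \<in> S" for x t
  proof -
    have "t * r = s * x \<longleftrightarrow> s' * (t * r) = s' * (s * x)"
      using cancel[of "t * r" "s * x" s'] assms that by auto
    also have "\<dots> \<longleftrightarrow> s * (t * r') = s * (s' * x)"
      using e by (metis mult.left_commute)
    also have "\<dots> \<longleftrightarrow> t * r' = s' * x"
      using cancel[of "t * r'" "s' * x" s] assms that by auto
    finally show ?thesis .
  qed
  then show "fr r s = fr r' s'" using assms by (auto simp: fr_eq)
qed

text \<open>The operations of \<open>localization\<close> are unions over all representatives. If f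
  does not depend on the representatives, this is a union of equal sets over nonempty index
  sets.\<close>

lemma fr_UN:
  assumes "r \<in> U" "s \<in> S" "r' \<in> U" "s' \<in> S"
    and "\<And>x t x' t'. (x, t) \<in> fr r s \<Longrightarrow> (x', t') \<in> fr r' s' \<Longrightarrow> f x t x' t' = f r s r' s'"
  shows "(\<Union>x\<in>fr r s. \<Union>y\<in>fr r' s'. f (fst x) (snd x) (fst y) (snd y)) = f r s r' s'"
proof -
  have ne: "fr r s \<noteq> {}" "fr r' s' \<noteq> {}" using fr_self[OF assms(1,2)] fr_self[OF assms(3,4)] by blast+
  have "f (fst x) (snd x) (fst y) (snd y) = f r s r' s'" if "x \<in> fr r s" "y \<in> fr r' s'" for x y
    using assms(5)[of "fst x" "snd x" "fst y" "snd y"] that by simp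
  then show ?thesis using ne by simp
qed

lemma L_carrier: "carrier L = {fr r s | r s. r \<in> U \<and> s \<in> S}"
  by (simp add: L_def localization_def fr_def)

lemma fr_in_L [simp]: "r \<in> U \<Longrightarrow> s \<in> S \<Longrightarrow> fr r s \<in> carrier L"
  by (auto simp: L_carrier)

lemma L_cases:
  assumes "x \<in> carrier L" obtains r s where "r \<in> U" "s \<in> S" "x = fr r s"
  using assms by (auto simp: L_carrier)

lemma L_one: "\<one>\<^bsub>L\<^esub> = fr 1 1" and L_zero: "\<zero>\<^bsub>L\<^esub> = fr 0 1"
  by (simp_all add: L_def localization_def fr_def)

lemma L_mult [simp]:
  assumes "r \<in> U" "s \<in> S" "r' \<in> U" "s' \<in> S"
  shows "fr r s \<otimes>\<^bsub>L\<^esub> fr r' s' = fr (r * r') (s * s')"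
proof -
  have "fr r s \<otimes>\<^bsub>L\<^esub> fr r' s' = (\<Union>x\<in>fr r s. \<Union>y\<in>fr r' s'. fr (fst x * fst y) (snd x * snd y))"
    by (simp add: L_def localization_def fr_def)
  also have "\<dots> = fr (r * r') (s * s')"
  proof (rule fr_UN[OF assms, of "\<lambda>x t x' t'. fr (x * x') (t * t')"])
    fix x t x' t' assume "(x, t) \<in> fr r s" "(x', t') \<in> fr r' s'"
    then have *: "x \<in> U" "t \<in> S" "t * r = s * x" "x' \<in> U" "t' \<in> S" "t' * r' = s' * x'"
      using assms by (auto simp: fr_eq)
    then have "(t * r) * (t' * r') = (s * x) * (s' * x')" by simp
    then show "fr (x * x') (t * t') = fr (r * r') (s * s')"
      using assms * by (simp add: fr_eq_iff ac_simps)
  qed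
  finally show ?thesis .
qed

lemma L_add [simp]:
  assumes "r \<in> U" "s \<in> S" "r' \<in> U" "s' \<in> S"
  shows "fr r s \<oplus>\<^bsub>L\<^esub> fr r' s' = fr (r * s' + r' * s) (s * s')"
proof -
  have "fr r s \<oplus>\<^bsub>L\<^esub> fr r' s' = (\<Union>x\<in>fr r s. \<Union>y\<in>fr r' s'. fr (fst x * snd y + fst y * snd x) (snd x * snd y))"
    by (simp add: L_def localization_def fr_def)
  also have "\<dots> = fr (r * s' + r' * s) (s * s')"
  proof (rule fr_UN[OF assms, of "\<lambda>x t x' t'. fr (x * t' + x' * t) (t * t')"])
    fix x t x' t' assume "(x, t) \<in> fr r s" "(x', t') \<in> fr r' s'"
    then have *: "x \<in> U" "t \<in> S" "t * r = s * x" "x' \<in> U" "t' \<in> S" "t' * r' = s' * x'"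
      using assms by (auto simp: fr_eq)
    have "(s * s') * (x * t' + x' * t) = (s * x) * (s' * t') + (s' * x') * (s * t)" by (simp add: algebra_simps)
    also have "\<dots> = (t * t') * (r * s' + r' * s)" unfolding *(3)[symmetric] *(6)[symmetric] by (simp add: algebra_simps)
    finally show "fr (x * t' + x' * t) (t * t') = fr (r * s' + r' * s) (s * s')"
      using assms * by (simp add: fr_eq_iff)
  qed
  finally show ?thesis .
qed

lemma cring_L: "cring L"
proof (rule cringI)
  show "abelian_group L"
  proof (rule abelian_groupI)
    fix x assume "x \<in> carrier L"
    then obtain r s where "r \<in> U" "s \<in> S" "x = fr r s" by (rule L_cases)
    then show "\<exists>y\<in>carrier L. y \<oplus>\<^bsub>L\<^esub> x = \<zero>\<^bsub>L\<^esub>"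
      by (intro bexI[of _ "fr (- r) s"]) (auto simp: L_zero fr_eq_iff)
  qed (auto elim!: L_cases simp: L_zero fr_eq_iff algebra_simps)
  show "comm_monoid L"
    by (rule comm_monoidI) (auto elim!: L_cases simp: L_one fr_eq_iff algebra_simps)
  fix x y z assume "x \<in> carrier L" "y \<in> carrier L" "z \<in> carrier L"
  then obtain a s b t c u where "a \<in> U" "s \<in> S" "x = fr a s" "b \<in> U" "t \<in> S" "y = fr b t"
    "c \<in> U" "u \<in> S" "z = fr c u" by (metis L_cases)
  then show "(x \<oplus>\<^bsub>L\<^esub> y) \<otimes>\<^bsub>L\<^esub> z = x \<otimes>\<^bsub>L\<^esub> z \<oplus>\<^bsub>L\<^esub> y \<otimes>\<^bsub>L\<^esub> z"
    by (simp add: fr_eq_iff) (simp add: algebra_simps)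
qed

sublocale L: cring L by (rule cring_L)

lemma fr_cancel: "r \<in> U \<Longrightarrow> s \<in> S \<Longrightarrow> t \<in> S \<Longrightarrow> fr (t * r) (t * s) = fr r s"
  by (simp add: fr_eq_iff algebra_simps)

lemma fr_eq_zero: "r \<in> U \<Longrightarrow> s \<in> S \<Longrightarrow> fr r s = \<zero>\<^bsub>L\<^esub> \<longleftrightarrow> r = 0"
  by (simp add: L_zero fr_eq_iff)

lemma L_pow [simp]: "r \<in> U \<Longrightarrow> s \<in> S \<Longrightarrow> fr r s [^]\<^bsub>L\<^esub> (n::nat) = fr (r ^ n) (s ^ n)"
  by (induction n) (auto simp: L_one mult.commute)

definition contr :: "('a \<times> 'a) set set \<Rightarrow> 'a set" where "contr J = {r \<in> U. fr r 1 \<in> J}"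

definition extn :: "'a set \<Rightarrow> ('a \<times> 'a) set set" where "extn I = {fr r s | r s. r \<in> I \<and> s \<in> S}"

text \<open>Denominators are units of \<open>L\<close>, so only the numerator decides membership in
  an ideal.\<close>

lemma fr_in_ideal_iff:
  assumes "ideal J L" "r \<in> U" "s \<in> S" shows "fr r s \<in> J \<longleftrightarrow> r \<in> contr J"
proof -
  interpret J: ideal J L by fact
  have 1: "fr r s = fr 1 s \<otimes>\<^bsub>L\<^esub> fr r 1" using assms by simp
  have 2: "fr r 1 = fr s 1 \<otimes>\<^bsub>L\<^esub> fr r s" using assms fr_cancel[of r 1 s] by simp
  have "fr r s \<in> J \<longleftrightarrow> fr r 1 \<in> J" using 1 2 J.I_l_closed assms by (metis fr_in_L one_closed S_one S_U)
  then show ?thesis using assms by (simp add: contr_def)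
qed

lemma ideal_contr:
  assumes "ideal J L" shows "ideal (contr J) R"
proof -
  interpret J: ideal J L by fact
  show ?thesis unfolding ideal_R_iff
  proof (intro conjI ballI)
    show "0 \<in> contr J" using J.zero_closed by (simp add: contr_def L_zero)
    fix x y assume "x \<in> contr J" "y \<in> contr J"
    then show "x + y \<in> contr J" using J.a_closed[of "fr x 1" "fr y 1"] by (simp add: contr_def)
  next
    fix x r assume "x \<in> contr J" "r \<in> U"
    then show "r * x \<in> contr J" using J.I_l_closed[of "fr x 1" "fr r 1"] by (simp add: contr_def)
  qed (auto simp: contr_def)
qed

lemma ideal_eq_extn: "ideal J L \<Longrightarrow> J = extn (contr J)"
proof -
  assume J: "ideal J L"
  then interpret J: ideal J L .
  show ?thesis
  proof (intro equalityI subsetI)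
    fix x assume x: "x \<in> J"
    then obtain r s where "r \<in> U" "s \<in> S" "x = fr r s" using J.Icarr by (blast elim: L_cases)
    moreover then have "r \<in> contr J" using fr_in_ideal_iff[OF J, of r s] x by blast
    ultimately show "x \<in> extn (contr J)" unfolding extn_def by blast
  next
    fix x assume "x \<in> extn (contr J)"
    then obtain r s where "r \<in> contr J" "s \<in> S" "x = fr r s" unfolding extn_def by blast
    then show "x \<in> J" using fr_in_ideal_iff[OF J, of r s] by (simp add: contr_def)
  qed
qed

lemma prime_contr:
  assumes "primeideal J L" shows "primeideal (contr J) R"
proof -
  interpret J: primeideal J L by fact
  have id: "ideal J L" by (rule J.ideal_axioms)
  show ?thesis
  proof (rule primeidealI[OF ideal_contr[OF id] cring_R])
    show "carrier R \<noteq> contr J"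
    proof
      assume "carrier R = contr J"
      then have "1 \<in> contr J" using one_closed R_simps(1) by metis
      then have "fr 1 1 \<in> J" unfolding contr_def by blast
      then show False using J.I_notcarr J.one_imp_carrier by (simp add: L_one)
    qed
    fix a b assume "a \<in> carrier R" "b \<in> carrier R" "a \<otimes>\<^bsub>R\<^esub> b \<in> contr J"
    then show "a \<in> contr J \<or> b \<in> contr J"
      using J.I_prime[of "fr a 1" "fr b 1"] by (auto simp: contr_def)
  qed
qed

lemma ideal_extn:
  assumes "ideal I R" shows "ideal (extn I) L"
proof (rule idealI)
  have I: "I \<subseteq> U" "0 \<in> I" "\<And>x y. x \<in> I \<Longrightarrow> y \<in> I \<Longrightarrow> x + y \<in> I" "\<And>x r. x \<in> I \<Longrightarrow> r \<in> U \<Longrightarrow> r * x \<in> I"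
    "\<And>x r. x \<in> I \<Longrightarrow> r \<in> U \<Longrightarrow> x * r \<in> I"
    using assms by (auto simp: ideal_R_iff mult.commute)
  have abs: "r \<otimes>\<^bsub>L\<^esub> x \<in> extn I" if xI: "x \<in> extn I" and rL: "r \<in> carrier L" for x r
  proof -
    obtain a s where "a \<in> I" "s \<in> S" "x = fr a s" using xI unfolding extn_def by blast
    moreover obtain b t where "b \<in> U" "t \<in> S" "r = fr b t" using rL by (rule L_cases)
    moreover have "a \<in> U" using I \<open>a \<in> I\<close> by auto
    ultimately have "r \<otimes>\<^bsub>L\<^esub> x = fr (b * a) (t * s)" "b * a \<in> I" "t * s \<in> S" using I by auto
    then show ?thesis unfolding extn_def by blast
  qed
  show "subgroup (extn I) (add_monoid L)"
  proof (rule L.add.subgroupI)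
    show "extn I \<subseteq> carrier L" using I(1) by (auto simp: extn_def)
    show "extn I \<noteq> {}" using I(2) S_one unfolding extn_def by blast
    fix x assume x: "x \<in> extn I"
    then have xc: "x \<in> carrier L" using I(1) by (auto simp: extn_def)
    have "\<ominus>\<^bsub>L\<^esub> x = (\<ominus>\<^bsub>L\<^esub> \<one>\<^bsub>L\<^esub>) \<otimes>\<^bsub>L\<^esub> x" using xc by (simp add: L.l_minus)
    then show "\<ominus>\<^bsub>L\<^esub> x \<in> extn I" using abs[OF x, of "\<ominus>\<^bsub>L\<^esub> \<one>\<^bsub>L\<^esub>"] by simp
    fix y assume y: "y \<in> extn I"
    obtain a s where a: "a \<in> I" "s \<in> S" "x = fr a s" using x by (auto simp: extn_def)
    obtain b t where b: "b \<in> I" "t \<in> S" "y = fr b t" using y by (auto simp: extn_def)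
    have "x \<oplus>\<^bsub>L\<^esub> y = fr (a * t + b * s) (s * t)" using a b I(1) by (simp add: subset_iff)
    moreover have "a * t + b * s \<in> I" using I a b by auto
    moreover have "s * t \<in> S" using a b by simp
    ultimately show "x \<oplus>\<^bsub>L\<^esub> y \<in> extn I" unfolding extn_def by blast
  qed
  show "\<And>a x. a \<in> extn I \<Longrightarrow> x \<in> carrier L \<Longrightarrow> a \<otimes>\<^bsub>L\<^esub> x \<in> extn I"
  proof -
    fix a x assume a: "a \<in> extn I" "x \<in> carrier L"
    then have "a \<in> carrier L" using I(1) by (auto simp: extn_def)
    then show "a \<otimes>\<^bsub>L\<^esub> x \<in> extn I" using abs[OF a] a by (simp add: L.m_comm)
  qed
  show "ring L" using cring_L by (rule cring.axioms(1))
  show "\<And>a x. a \<in> extn I \<Longrightarrow> x \<in> carrier L \<Longrightarrow> x \<otimes>\<^bsub>L\<^esub> a \<in> extn I" by (rule abs)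
qed

text \<open>Every ideal of \<open>L\<close> is the extension of its contraction, so generators of
  the contraction generate it.\<close>

lemma noetherian_L:
  assumes "noetherian_ring R" shows "noetherian_ring L"
proof -
  interpret N: noetherian_ring R by fact
  show ?thesis
  proof (rule L.noetherian_ringI)
    fix J assume J: "ideal J L"
    obtain A where A: "A \<subseteq> carrier R" "finite A" "contr J = Idl\<^bsub>R\<^esub> A"
      using N.finetely_gen[OF ideal_contr[OF J]] by blast
    let ?A = "(\<lambda>a. fr a 1) ` A"
    have Ac: "?A \<subseteq> carrier L" using A by auto
    have K: "ideal (Idl\<^bsub>L\<^esub> ?A) L" using L.genideal_ideal[OF Ac] .
    have "A \<subseteq> contr (Idl\<^bsub>L\<^esub> ?A)" using L.genideal_self[OF Ac] A by (auto simp: contr_def)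
    then have "contr J \<subseteq> contr (Idl\<^bsub>L\<^esub> ?A)" using A(3) R.genideal_minimal[OF ideal_contr[OF K]] by simp
    then have "extn (contr J) \<subseteq> extn (contr (Idl\<^bsub>L\<^esub> ?A))" unfolding extn_def by blast
    then have "J \<subseteq> Idl\<^bsub>L\<^esub> ?A" using ideal_eq_extn[OF J] ideal_eq_extn[OF K] by metis
    moreover have "A \<subseteq> contr J" using A(3) R.genideal_self[OF A(1)] by simp
    then have "?A \<subseteq> J" unfolding contr_def by blast
    then have "Idl\<^bsub>L\<^esub> ?A \<subseteq> J" by (rule L.genideal_minimal[OF J])
    ultimately show "\<exists>A\<subseteq>carrier L. finite A \<and> J = Idl\<^bsub>L\<^esub> A" using Ac A by blast
  qed
qed

text \<open>The denominators s and t are units and disappear; u clears the denominator of the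
  remaining coefficient. This form moves conditions on \<open>L\<close> to equations between
  numerators.\<close>

lemma Idl_single:
  assumes "a \<in> U" "s \<in> S" "r \<in> U" "t \<in> S"
  shows "fr r t \<in> Idl\<^bsub>L\<^esub> {fr a s} \<longleftrightarrow> (\<exists>u\<in>S. \<exists>b\<in>U. u * r = b * a)"
proof -
  have eq: "Idl\<^bsub>L\<^esub> {fr a s} = {x \<otimes>\<^bsub>L\<^esub> fr a s | x. x \<in> carrier L}"
    using L.cgenideal_eq_genideal[of "fr a s"] assms by (simp add: cgenideal_def)
  show ?thesis unfolding eq
  proof safe
    fix x assume "fr r t = x \<otimes>\<^bsub>L\<^esub> fr a s" "x \<in> carrier L"
    then obtain b v where "b \<in> U" "v \<in> S" "fr r t = fr (b * a) (v * s)" using assms by (auto elim!: L_cases)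
    then have "(v * s) * r = (t * b) * a" using assms by (simp add: fr_eq_iff ac_simps)
    then show "\<exists>u\<in>S. \<exists>b\<in>U. u * r = b * a" using assms \<open>b \<in> U\<close> \<open>v \<in> S\<close> by (metis S_mult S_U mult_closed)
  next
    fix u b assume u: "u \<in> S" "b \<in> U" "u * r = b * a"
    have "fr r t = fr (s * b) (u * t) \<otimes>\<^bsub>L\<^esub> fr a s"
    proof -
      have "(u * t * s) * r = t * (s * b * a)" using u(3) by (metis mult.assoc mult.commute)
      then show ?thesis using assms u by (simp add: fr_eq_iff)
    qed
    then show "\<exists>x. fr r t = x \<otimes>\<^bsub>L\<^esub> fr a s \<and> x \<in> carrier L" using assms u by (metis S_mult S_U fr_in_L mult_closed)
  qed
qed

lemma ideal_two: 
  assumes "a \<in> U" "b \<in> U" shows "ideal {x * a + y * b | x y. x \<in> U \<and> y \<in> U} R"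
  unfolding ideal_R_iff
proof (intro conjI ballI subsetI, goal_cases)
  case (1 x) then show ?case using assms by auto
next
  case 2 show ?case by (simp, rule exI[of _ 0], rule exI[of _ 0], simp)
next
  case (3 x y) 
  then obtain p q p' q' where "x = p * a + q * b" "y = p' * a + q' * b" "p \<in> U" "q \<in> U" "p' \<in> U" "q' \<in> U" by auto
  then show ?case by (intro CollectI exI[of _ "p + p'"] exI[of _ "q + q'"]) (auto simp: algebra_simps)
next
  case (4 x r)
  then obtain p q where "x = p * a + q * b" "p \<in> U" "q \<in> U" by auto
  then show ?case using 4 by (intro CollectI exI[of _ "r * p"] exI[of _ "r * q"]) (auto simp: algebra_simps)
qed

text \<open>Two generators are enough for the application, where systems of parameters have at most
  two members.\<close>

lemma Idl_pair:
  assumes "a \<in> U" "s \<in> S" "a' \<in> U" "s' \<in> S" "r \<in> U" "t \<in> S"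
  shows "fr r t \<in> Idl\<^bsub>L\<^esub> {fr a s, fr a' s'} \<longleftrightarrow> (\<exists>u\<in>S. \<exists>b\<in>U. \<exists>b'\<in>U. u * r = b * a + b' * a')"
proof -
  let ?X = "{fr a s, fr a' s'}"
  have X: "?X \<subseteq> carrier L" using assms by auto
  have K: "ideal (Idl\<^bsub>L\<^esub> ?X) L" using L.genideal_ideal[OF X] .
  let ?I = "{x * a + y * a' | x y. x \<in> U \<and> y \<in> U}"
  have I: "ideal ?I R" using ideal_two assms by blast
  have mem: "a \<in> contr (Idl\<^bsub>L\<^esub> ?X)" "a' \<in> contr (Idl\<^bsub>L\<^esub> ?X)"
    using fr_in_ideal_iff[OF K] L.genideal_self[OF X] assms by auto
  show ?thesis
  proof
    have "a \<in> ?I" using assms by (intro CollectI exI[of _ 1] exI[of _ 0]) auto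
    moreover have "a' \<in> ?I" using assms by (intro CollectI exI[of _ 0] exI[of _ 1]) auto
    ultimately have "?X \<subseteq> extn ?I" using assms unfolding extn_def by blast
    then have sub: "Idl\<^bsub>L\<^esub> ?X \<subseteq> extn ?I" using L.genideal_minimal[OF ideal_extn[OF I]] by blast
    assume "fr r t \<in> Idl\<^bsub>L\<^esub> ?X"
    then obtain x y v where v: "v \<in> S" "x \<in> U" "y \<in> U" "fr r t = fr (x * a + y * a') v"
      using sub by (auto simp: extn_def)
    then have "v * r = (t * x) * a + (t * y) * a'" using assms by (simp add: fr_eq_iff algebra_simps)
    moreover have "t * x \<in> U" "t * y \<in> U" using v assms by auto
    ultimately show "\<exists>u\<in>S. \<exists>b\<in>U. \<exists>b'\<in>U. u * r = b * a + b' * a'" using v(1) by blast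
  next
    assume "\<exists>u\<in>S. \<exists>b\<in>U. \<exists>b'\<in>U. u * r = b * a + b' * a'"
    then obtain u b b' where u: "u \<in> S" "b \<in> U" "b' \<in> U" "u * r = b * a + b' * a'" by auto
    have "u * r \<in> contr (Idl\<^bsub>L\<^esub> ?X)" using ideal_contr[OF K] mem u by (simp add: ideal_R_iff)
    then have "fr (u * r) (u * t) \<in> Idl\<^bsub>L\<^esub> ?X" using fr_in_ideal_iff[OF K] u assms by simp
    then show "fr r t \<in> Idl\<^bsub>L\<^esub> ?X" using fr_cancel[of r t u] u(1) assms by metis
  qed
qed

lemma Idl_empty: "Idl\<^bsub>L\<^esub> {} = {\<zero>\<^bsub>L\<^esub>}"
proof -
  have "Idl\<^bsub>L\<^esub> {} \<subseteq> {\<zero>\<^bsub>L\<^esub>}" using L.genideal_minimal[OF L.zeroideal] by blast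
  moreover have "ideal (Idl\<^bsub>L\<^esub> {}) L" using L.genideal_ideal by blast
  then have "\<zero>\<^bsub>L\<^esub> \<in> Idl\<^bsub>L\<^esub> {}" by (simp add: additive_subgroup.zero_closed ideal.axioms(1))
  ultimately show ?thesis by blast
qed

end

section \<open>Exponent vectors and their multiples\<close>

definition smul :: "nat \<Rightarrow> nat \<times> nat \<Rightarrow> nat \<times> nat" where
  "smul k a = (k * fst a, k * snd a)"

lemma smul_simps [simp]:
  "smul 0 a = 0" "smul 1 a = a" "smul (Suc 0) a = a" "smul k 0 = 0"
  "fst (smul k a) = k * fst a" "snd (smul k a) = k * snd a"
  by (simp_all add: smul_def prod_eq_iff)

lemma smul_add: "smul (k + l) a = smul k a + smul l a"
  and smul_add_right: "smul k (a + b) = smul k a + smul k b"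
  and smul_smul: "smul k (smul l a) = smul (k * l) a"
  and smul_Suc: "smul (Suc k) a = a + smul k a"
  by (simp_all add: smul_def prod_eq_iff algebra_simps)

text \<open>Total degree. It is additive and positive off 0, hence the measure for inductions over
  exponents.\<close>

definition size1 :: "nat \<times> nat \<Rightarrow> nat" where "size1 a = fst a + snd a"

lemma size1_simps [simp]: "size1 (a + b) = size1 a + size1 b" "size1 (smul k a) = k * size1 a" "size1 0 = 0"
  by (simp_all add: size1_def algebra_simps)

lemma size1_pos: "a \<noteq> 0 \<Longrightarrow> size1 a > 0"
  by (auto simp: size1_def prod_eq_iff)

section \<open>Polynomials in two variables and their leading exponents\<close>

type_synonym 'k sgr = "(nat \<times> nat) \<Rightarrow>\<^sub>0 'k"

abbreviation keys :: "'k::zero sgr \<Rightarrow> (nat \<times> nat) set" where "keys \<equiv> Poly_Mapping.keys"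
abbreviation lk :: "'k::zero sgr \<Rightarrow> nat \<times> nat \<Rightarrow> 'k" where "lk \<equiv> Poly_Mapping.lookup"
abbreviation mon :: "nat \<times> nat \<Rightarrow> 'k::field sgr" where "mon a \<equiv> Poly_Mapping.single a 1"
abbreviation cst :: "'k::field \<Rightarrow> 'k sgr" where "cst c \<equiv> Poly_Mapping.single 0 c"

lemma sum_monomials: "f = (\<Sum>a\<in>keys f. Poly_Mapping.single a (lk f a))"
proof (rule poly_mapping_eqI)
  fix k
  have "lk (\<Sum>a\<in>keys f. Poly_Mapping.single a (lk f a)) k = (\<Sum>a\<in>keys f. if a = k then lk f a else 0)"
    by (simp add: lookup_sum lookup_single when_def)
  also have "\<dots> = lk f k" by (subst sum.delta) (auto simp: in_keys_iff)
  finally show "lk f k = lk (\<Sum>a\<in>keys f. Poly_Mapping.single a (lk f a)) k" by simp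
qed

lemma lookup_times:
  fixes f g :: "'k::field sgr"
  shows "lk (f * g) k = (\<Sum>a\<in>keys f. \<Sum>b\<in>keys g. if a + b = k then lk f a * lk g b else 0)"
proof -
  have "f * g = (\<Sum>a\<in>keys f. \<Sum>b\<in>keys g. Poly_Mapping.single (a + b) (lk f a * lk g b))"
    using sum_product[of "\<lambda>a. Poly_Mapping.single a (lk f a)" "keys f" "\<lambda>b. Poly_Mapping.single b (lk g b)" "keys g"]
      sum_monomials[of f] sum_monomials[of g] by (simp add: mult_single)
  then show ?thesis by (simp add: lookup_sum lookup_single when_def)
qed

text \<open>Nothing cancels at an exponent with a single decomposition over the two supports. All
  leading-term arguments below, with respect to the lexicographic order, inside a face, or by degree
  along a ray, are instances.\<close>

lemma lookup_times_unique:
  fixes f g :: "'k::field sgr"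
  assumes "\<And>a' b'. a' \<in> keys f \<Longrightarrow> b' \<in> keys g \<Longrightarrow> a' + b' = a + b \<Longrightarrow> a' = a \<and> b' = b"
  shows "lk (f * g) (a + b) = lk f a * lk g b"
proof -
  have "lk (f * g) (a + b) = (\<Sum>a'\<in>keys f. \<Sum>b'\<in>keys g. if a' = a \<and> b' = b then lk f a * lk g b else 0)"
    unfolding lookup_times using assms by (intro sum.cong refl) auto
  also have "\<dots> = (\<Sum>a'\<in>keys f. if a' = a then lk f a * lk g b else 0)"
  proof (rule sum.cong[OF refl])
    fix a' assume "a' \<in> keys f"
    show "(\<Sum>b'\<in>keys g. if a' = a \<and> b' = b then lk f a * lk g b else 0) = (if a' = a then lk f a * lk g b else 0)"
      by (cases "a' = a") (auto simp: in_keys_iff sum.delta)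
  qed
  also have "\<dots> = lk f a * lk g b" by (subst sum.delta) (auto simp: in_keys_iff)
  finally show ?thesis .
qed

lemma lookup_mon_times: "lk (Poly_Mapping.single a c * (f :: 'k::field sgr)) (a + b) = c * lk f b"
  by (subst lookup_times_unique) (auto split: if_splits)

lemma keys_timesD:
  fixes f g :: "'k::field sgr"
  assumes "k \<in> keys (f * g)" obtains a b where "a \<in> keys f" "b \<in> keys g" "k = a + b"
  using keys_mult[of f g] assms by blast

lemma keys_minus: "keys (f - g) \<subseteq> keys f \<union> keys (g :: 'k::field sgr)"
  by (auto simp: in_keys_iff lookup_minus)

lemma nz_keys: "f \<noteq> 0 \<longleftrightarrow> keys f \<noteq> {}"
  by (metis keys_eq_empty)

text \<open>The lexicographically largest exponent; meaningful only for nonzero f.\<close>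

definition lead :: "'k::zero sgr \<Rightarrow> nat \<times> nat" where
  "lead f = (let m = Max (fst ` keys f) in (m, Max {b. (m, b) \<in> keys f}))"

definition lexle :: "nat \<times> nat \<Rightarrow> nat \<times> nat \<Rightarrow> bool" where
  "lexle a b \<longleftrightarrow> fst a < fst b \<or> fst a = fst b \<and> snd a \<le> snd b"

lemma lead_in:
  assumes "f \<noteq> (0 :: 'k::field sgr)" shows "lead f \<in> keys f"
    and lead_max: "a \<in> keys f \<Longrightarrow> lexle a (lead f)"
proof -
  define m where "m = Max (fst ` keys f)"
  have fin: "finite (fst ` keys f)" "fst ` keys f \<noteq> {}" using assms by auto
  then have "m \<in> fst ` keys f" unfolding m_def by (rule Max_in)
  then obtain b0 where b0: "(m, b0) \<in> keys f" by auto
  have "{b. (m, b) \<in> keys f} \<subseteq> snd ` keys f" by force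
  then have fB: "finite {b. (m, b) \<in> keys f}" by (rule finite_subset) simp
  have "Max {b. (m, b) \<in> keys f} \<in> {b. (m, b) \<in> keys f}" using fB b0 by (intro Max_in) auto
  then show "lead f \<in> keys f" by (simp add: lead_def Let_def m_def)
  assume a: "a \<in> keys f"
  then have "fst a \<le> m" using fin unfolding m_def by (intro Max_ge) auto
  moreover have "snd a \<le> Max {b. (m, b) \<in> keys f}" if "fst a = m"
    using fB a that by (intro Max_ge) auto
  ultimately show "lexle a (lead f)" by (auto simp: lexle_def lead_def Let_def m_def[symmetric])
qed

lemma lookup_lead_times:
  assumes "f \<noteq> 0" "g \<noteq> (0 :: 'k::field sgr)"
  shows "lk (f * g) (lead f + lead g) = lk f (lead f) * lk g (lead g)"
proof (rule lookup_times_unique)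
  fix a b assume "a \<in> keys f" "b \<in> keys g" and e: "a + b = lead f + lead g"
  then have "lexle a (lead f)" "lexle b (lead g)" using lead_max assms by blast+
  then show "a = lead f \<and> b = lead g" using e by (auto simp: lexle_def prod_eq_iff)
qed

lemma sgr_no_zero_divisors:
  assumes "f \<noteq> 0" "g \<noteq> (0 :: 'k::field sgr)" shows "f * g \<noteq> 0"
proof
  assume "f * g = 0"
  then have "lk f (lead f) * lk g (lead g) = 0" using lookup_lead_times[OF assms] by simp
  then show False using lead_in assms by (metis in_keys_iff mult_eq_0_iff)
qed

section \<open>The semigroup ring as the polynomials with exponents in P\<close>

definition sgring :: "(nat \<times> nat) set \<Rightarrow> 'k::field sgr set" where
  "sgring P = {f. keys f \<subseteq> P}"

lemma sgring_closed:
  assumes "is_submonoid P"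
  shows "cst c \<in> sgring P" "0 \<in> sgring P" "1 \<in> sgring P" "f \<in> sgring P \<Longrightarrow> g \<in> sgring P \<Longrightarrow> f + g \<in> sgring P"
    "f \<in> sgring P \<Longrightarrow> g \<in> sgring P \<Longrightarrow> f * g \<in> sgring P" "f \<in> sgring P \<Longrightarrow> - f \<in> sgring P"
proof -
  show "cst c \<in> sgring P" "0 \<in> sgring P" "1 \<in> sgring P" "f \<in> sgring P \<Longrightarrow> - f \<in> sgring P"
    using assms by (auto simp: sgring_def is_submonoid_def)
  show "f + g \<in> sgring P" if "f \<in> sgring P" "g \<in> sgring P"
    using keys_add[of f g] that by (auto simp: sgring_def)
  show "f * g \<in> sgring P" if "f \<in> sgring P" "g \<in> sgring P"
    using keys_mult[of f g] that assms unfolding sgring_def is_submonoid_def by blast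
qed

lemma type_domain_sgring: "is_submonoid P \<Longrightarrow> type_domain (sgring P :: 'k::field sgr set)"
  by unfold_locales (auto simp: sgring_closed dest: sgr_no_zero_divisors)

lemma single_in_sgring: "a \<in> P \<Longrightarrow> Poly_Mapping.single a c \<in> sgring P"
  by (simp add: sgring_def)

lemma sgring_sum:
  assumes "is_submonoid P" "\<And>i. i \<in> I \<Longrightarrow> f i \<in> sgring P" shows "sum f I \<in> sgring P"
  using assms by (induction I rule: infinite_finite_induct) (auto simp: sgring_closed)

text \<open>Replaces the generated subring by a condition on exponents: f is the sum of its terms,
  and each term is a generating constant times a generating monomial.\<close>

lemma semigroup_ring_carrier:
  assumes "is_submonoid P"
  shows "semigroup_ring TYPE('k::field) P = ring_of_type_algebra\<lparr>carrier := sgring P\<rparr>"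
proof -
  interpret T: type_domain "UNIV :: 'k sgr set"
    by unfold_locales (auto dest: sgr_no_zero_divisors)
  have TR: "T.R = ring_of_type_algebra" by (simp add: T.R_def ring_of_type_algebra_def)
  let ?G = "range cst \<union> mon ` P :: 'k sgr set"
  let ?H = "generate_ring (ring_of_type_algebra :: 'k sgr ring) ?G"
  have "?H \<subseteq> sgring P"
  proof
    fix x assume "x \<in> ?H"
    then show "x \<in> sgring P"
    proof (induction rule: generate_ring.induct)
      case one show ?case using sgring_closed[OF assms] by (simp add: TR[symmetric])
    next
      case (incl h) then show ?case using sgring_closed[OF assms] by (auto simp: single_in_sgring)
    next
      case (a_inv h) then show ?case using sgring_closed[OF assms] by (simp add: TR[symmetric])
    next
      case (eng_add h1 h2) then show ?case using sgring_closed[OF assms] by (simp add: TR[symmetric])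
    next
      case (eng_mult h1 h2) then show ?case using sgring_closed[OF assms] by (simp add: TR[symmetric])
    qed
  qed
  moreover have "sgring P \<subseteq> ?H"
  proof
    fix f :: "'k sgr" assume f: "f \<in> sgring P"
    have single: "Poly_Mapping.single a c \<in> ?H" if "a \<in> P" for a c
    proof -
      have "cst c \<in> ?H" "mon a \<in> ?H" using that by (auto intro: generate_ring.incl)
      then have "cst c \<otimes>\<^bsub>ring_of_type_algebra\<^esub> mon a \<in> ?H" by (rule generate_ring.eng_mult)
      then show ?thesis by (simp add: TR[symmetric] mult_single)
    qed
    have "sum (\<lambda>a. Poly_Mapping.single a (lk f a)) A \<in> ?H" if "finite A" "A \<subseteq> P" for A
      using that
    proof (induction A)
      case empty
      have "cst 0 \<in> ?H" by (rule generate_ring.incl) blast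
      then show ?case by simp
    next
      case (insert a A)
      have "Poly_Mapping.single a (lk f a) \<oplus>\<^bsub>ring_of_type_algebra\<^esub> (\<Sum>a\<in>A. Poly_Mapping.single a (lk f a)) \<in> ?H"
        by (rule generate_ring.eng_add) (use insert single in auto)
      then show ?case using insert by (simp add: TR[symmetric])
    qed
    then have "(\<Sum>a\<in>keys f. Poly_Mapping.single a (lk f a)) \<in> ?H" using f by (simp add: sgring_def)
    then show "f \<in> ?H" using sum_monomials[of f] by simp
  qed
  ultimately show ?thesis unfolding semigroup_ring_def by auto
qed

section \<open>Algebraic dependence by counting monomials\<close>

text \<open>Gaussian elimination by induction on the equations: a pivot \<open>i0\<close> removes
  the equation b together with one unknown.\<close>

lemma linear_dependence:
  fixes v :: "'i \<Rightarrow> 'b \<Rightarrow> 'k::field"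
  assumes "finite K" "finite I" "card K < card I"
  shows "\<exists>c. (\<exists>i\<in>I. c i \<noteq> 0) \<and> (\<forall>b\<in>K. (\<Sum>i\<in>I. c i * v i b) = 0)"
  using assms
proof (induction K arbitrary: I v rule: finite_induct)
  case empty
  then obtain i where "i \<in> I" by fastforce
  then show ?case by (intro exI[of _ "\<lambda>_. 1"]) auto
next
  case (insert b K)
  show ?case
  proof (cases "\<forall>i\<in>I. v i b = 0")
    case True
    have "card K < card I" using insert by simp
    from insert.IH[OF insert.prems(1) this, of v] obtain c where "\<exists>i\<in>I. c i \<noteq> 0" "\<forall>b\<in>K. (\<Sum>i\<in>I. c i * v i b) = 0" by blast
    then show ?thesis using True by (intro exI[of _ c]) auto
  next
    case False
    then obtain i0 where i0: "i0 \<in> I" "v i0 b \<noteq> 0" by blast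
    let ?I = "I - {i0}"
    \<comment> \<open>Subtracting a multiple of the pivot vector makes coordinate b vanish, so only
      the equations in K remain.\<close>
    let ?w = "\<lambda>i d. v i d - v i b / v i0 b * v i0 d"
    have fI: "finite ?I" using insert.prems by auto
    have "card K < card ?I" using insert i0 by auto
    from insert.IH[OF fI this, of ?w] obtain c where c: "\<exists>i\<in>?I. c i \<noteq> 0" "\<forall>d\<in>K. (\<Sum>i\<in>?I. c i * ?w i d) = 0" by blast
    define c' where "c' i = (if i = i0 then - (\<Sum>i\<in>?I. c i * (v i b / v i0 b)) else c i)" for i
    have S: "(\<Sum>i\<in>I. c' i * v i d) = (\<Sum>i\<in>?I. c i * ?w i d)" for d
    proof -
      have "(\<Sum>i\<in>I. c' i * v i d) = c' i0 * v i0 d + (\<Sum>i\<in>?I. c' i * v i d)"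
        using i0 insert.prems by (simp add: sum.remove)
      also have "(\<Sum>i\<in>?I. c' i * v i d) = (\<Sum>i\<in>?I. c i * v i d)" by (rule sum.cong) (auto simp: c'_def)
      also have "c' i0 * v i0 d = - (\<Sum>i\<in>?I. c i * (v i b / v i0 b * v i0 d))"
        by (simp add: c'_def sum_distrib_right mult.assoc)
      finally show ?thesis by (simp add: right_diff_distrib sum_subtractf)
    qed
    have "\<exists>i\<in>I. c' i \<noteq> 0" using c(1) by (auto simp: c'_def)
    moreover have "(\<Sum>i\<in>I. c' i * v i d) = 0" if "d \<in> insert b K" for d
      using that c(2) i0 by (auto simp: S)
    ultimately show ?thesis by blast
  qed
qed

lemma keys_power_bound:
  fixes x :: "'k::field sgr"
  assumes "\<And>a. a \<in> keys x \<Longrightarrow> fst a \<le> D \<and> snd a \<le> D" "a \<in> keys (x ^ n)"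
  shows "fst a \<le> n * D \<and> snd a \<le> n * D"
  using assms(2)
proof (induction n arbitrary: a)
  case (Suc n)
  then obtain b c where "b \<in> keys x" "c \<in> keys (x ^ n)" "a = b + c" by (auto elim: keys_timesD)
  then show ?case using Suc.IH[of c] assms(1)[of b] by auto
qed auto

text \<open>The n^3 products x^i y^j z^l have exponents in a square of side 3 n D, so they span a
  space whose dimension grows only like n^2.\<close>

lemma algebraic_dependence:
  fixes x y z :: "'k::field sgr"
  obtains n c where "\<exists>i<n. \<exists>j<n. \<exists>l<n. c i j l \<noteq> 0"
    "(\<Sum>i<n. \<Sum>j<n. \<Sum>l<n. cst (c i j l) * (x ^ i * y ^ j * z ^ l)) = 0"
proof -
  define B where "B = fst ` (keys x \<union> keys y \<union> keys z) \<union> snd ` (keys x \<union> keys y \<union> keys z)"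
  define D where "D = Max (insert 0 B)"
  have "finite (insert 0 B)" unfolding B_def by auto
  then have D: "b \<le> D" if "b \<in> B" for b using that unfolding D_def by auto
  have Dx: "fst a \<le> D \<and> snd a \<le> D" if "a \<in> keys x \<union> keys y \<union> keys z" for a
    using that D by (auto simp: B_def)
  \<comment> \<open>Large enough for (3 n D + 1)^2 \<le> ((3 D + 1) n)^2 < n^3.\<close>
  define n where "n = (3 * D + 1)^2 + 1"
  define E where "E = n * D + n * D + n * D"
  define I where "I = {..<n} \<times> {..<n} \<times> {..<n}"
  define K where "K = {..E} \<times> {..E}"
  define m where "m = (\<lambda>(i, j, l). x ^ i * y ^ j * z ^ l)"
  have mk: "keys (m t) \<subseteq> K" if "t \<in> I" for t
  proof
    fix a assume "a \<in> keys (m t)"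
    obtain i j l where t: "t = (i, j, l)" by (cases t)
    then have "a \<in> keys (x ^ i * y ^ j * z ^ l)" using \<open>a \<in> keys (m t)\<close> by (simp add: m_def)
    then obtain p q r where "p \<in> keys (x ^ i)" "q \<in> keys (y ^ j)" "r \<in> keys (z ^ l)" "a = p + q + r"
      by (metis keys_timesD)
    moreover have "i * D \<le> n * D" "j * D \<le> n * D" "l * D \<le> n * D" using that t by (auto simp: I_def)
    moreover have "fst p \<le> i * D \<and> snd p \<le> i * D" "fst q \<le> j * D \<and> snd q \<le> j * D" "fst r \<le> l * D \<and> snd r \<le> l * D"
      using calculation Dx by (blast intro!: keys_power_bound)+
    ultimately have "fst a \<le> E" "snd a \<le> E" unfolding E_def by (simp; linarith)+
    then show "a \<in> K" by (simp add: K_def mem_Times_iff)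
  qed
  have "card K = (E + 1)^2" by (simp add: K_def power2_eq_square)
  also have "\<dots> \<le> ((3 * D + 1) * n)^2" by (rule power_mono) (auto simp: E_def n_def algebra_simps)
  also have "\<dots> = (3 * D + 1)^2 * n^2" by (rule power_mult_distrib)
  also have "\<dots> < n * n^2" by (intro mult_strict_right_mono) (auto simp: n_def)
  also have "\<dots> = card I" by (simp add: I_def power2_eq_square)
  finally have "card K < card I" .
  then obtain c where c: "\<exists>t\<in>I. c t \<noteq> 0" "\<forall>b\<in>K. (\<Sum>t\<in>I. c t * lk (m t) b) = 0"
    using linear_dependence[of K I "\<lambda>t. lk (m t)"] by (auto simp: I_def K_def)
  have "(\<Sum>t\<in>I. cst (c t) * m t) = 0"
  proof (rule poly_mapping_eqI)
    fix b
    have l: "lk (cst (c t) * m t) b = c t * lk (m t) b" for t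
      using lookup_mon_times[of 0 "c t" "m t" b] by simp
    show "lk (\<Sum>t\<in>I. cst (c t) * m t) b = lk 0 b"
    proof (cases "b \<in> K")
      case True then show ?thesis using c(2) by (simp add: lookup_sum l)
    next
      case False
      then have "lk (m t) b = 0" if "t \<in> I" for t using mk[OF that] by (auto simp: in_keys_iff)
      then show ?thesis by (simp add: lookup_sum l)
    qed
  qed
  moreover have "(\<Sum>t\<in>I. cst (c t) * m t)
      = (\<Sum>i<n. \<Sum>j<n. \<Sum>l<n. cst (c (i, j, l)) * (x ^ i * y ^ j * z ^ l))"
    unfolding I_def m_def by (simp add: sum.cartesian_product case_prod_beta)
  moreover have "\<exists>i<n. \<exists>j<n. \<exists>l<n. c (i, j, l) \<noteq> 0" using c(1) by (auto simp: I_def)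
  ultimately show thesis using that[of n "\<lambda>i j l. c (i, j, l)"] by simp
qed

text \<open>Below m nothing contributes, and each power above m contains x^m and a further factor x,
  so the tail is a multiple of x.\<close>

lemma lowest_power:
  fixes x :: "'k::field sgr"
  assumes "is_submonoid P" "x \<in> sgring P" "\<And>i. A i \<in> sgring P" "\<And>i. i < m \<Longrightarrow> A i = 0" "m < n"
  shows "\<exists>a\<in>sgring P. (\<Sum>i<n. x ^ i * A i) = x ^ m * (A m + a * x)"
proof -
  interpret type_domain "sgring P :: 'k sgr set" using assms(1) by (rule type_domain_sgring)
  have "{..<n} = {..<m} \<union> {m} \<union> {m<..<n}" using assms(5) by auto
  then have "(\<Sum>i<n. x ^ i * A i) = (\<Sum>i\<in>{..<m} \<union> {m} \<union> {m<..<n}. x ^ i * A i)" by simp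
  also have "\<dots> = (\<Sum>i<m. x ^ i * A i) + x ^ m * A m + (\<Sum>i\<in>{m<..<n}. x ^ i * A i)"
    by (subst sum.union_disjoint; (subst sum.union_disjoint)?; auto)
  also have "(\<Sum>i<m. x ^ i * A i) = 0" using assms(4) by (intro sum.neutral) auto
  also have "(\<Sum>i\<in>{m<..<n}. x ^ i * A i) = (\<Sum>i\<in>{m<..<n}. x ^ m * (x ^ (i - Suc m) * A i * x))"
  proof (rule sum.cong[OF refl])
    fix i assume "i \<in> {m<..<n}"
    then have "x ^ i = x ^ m * (x ^ (i - Suc m) * x)"
      by (metis Suc_diff_Suc greaterThanLessThan_iff less_imp_le_nat le_add_diff_inverse power_Suc2 power_add)
    then show "x ^ i * A i = x ^ m * (x ^ (i - Suc m) * A i * x)" by (simp add: ac_simps)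
  qed
  also have "\<dots> = x ^ m * ((\<Sum>i\<in>{m<..<n}. x ^ (i - Suc m) * A i) * x)"
    by (simp add: sum_distrib_left sum_distrib_right)
  finally have "(\<Sum>i<n. x ^ i * A i) = x ^ m * (A m + (\<Sum>i\<in>{m<..<n}. x ^ (i - Suc m) * A i) * x)"
    by (simp add: algebra_simps)
  moreover have "(\<Sum>i\<in>{m<..<n}. x ^ (i - Suc m) * A i) \<in> sgring P"
    using assms by (intro sgring_sum) auto
  ultimately show ?thesis by blast
qed

text \<open>The lexicographically lowest terms of an algebraic relation, in the shape used by the
  Coquand--Lombardi characterization of Krull dimension.\<close>

lemma collapse_relation:
  fixes x y z :: "'k::field sgr"
  assumes P: "is_submonoid P" and U: "x \<in> sgring P" "y \<in> sgring P" "z \<in> sgring P"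
  obtains m m' n c a a' where "\<exists>l<n. c l \<noteq> 0" "a \<in> sgring P" "a' \<in> sgring P"
    "x ^ m * (y ^ m' * ((\<Sum>l<n. z ^ l * cst (c l)) + a' * y) + a * x) = 0"
proof -
  interpret type_domain "sgring P :: 'k sgr set" using P by (rule type_domain_sgring)
  obtain n c where nz: "\<exists>i<n. \<exists>j<n. \<exists>l<n. c i j l \<noteq> 0"
    and rel: "(\<Sum>i<n. \<Sum>j<n. \<Sum>l<n. cst (c i j l) * (x ^ i * y ^ j * z ^ l)) = 0"
    by (rule algebraic_dependence)
  define B where "B i j = (\<Sum>l<n. z ^ l * cst (c i j l))" for i j
  define A where "A i = (\<Sum>j<n. y ^ j * B i j)" for i
  have BU: "B i j \<in> sgring P" for i j
    unfolding B_def using P U by (intro sgring_sum) (auto simp: sgring_closed)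
  have AU: "A i \<in> sgring P" for i
    unfolding A_def using P U BU by (intro sgring_sum) (auto simp: sgring_closed)
  \<comment> \<open>The lowest power of x that carries a nonzero scalar; \<open>m'\<close> below is
    the lowest such power of y inside \<open>A m\<close>.\<close>
  define m where "m = (LEAST i. i < n \<and> (\<exists>j<n. \<exists>l<n. c i j l \<noteq> 0))"
  have m: "m < n \<and> (\<exists>j<n. \<exists>l<n. c m j l \<noteq> 0)" unfolding m_def by (rule LeastI_ex) (use nz in blast)
  have m0: "A i = 0" if "i < m" for i
  proof -
    have "c i j l = 0" if "j < n" "l < n" for j l
      using not_less_Least[of i "\<lambda>i. i < n \<and> (\<exists>j<n. \<exists>l<n. c i j l \<noteq> 0)"] \<open>i < m\<close> m that unfolding m_def[symmetric] by auto
    then show ?thesis by (simp add: A_def B_def)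
  qed
  define m' where "m' = (LEAST j. j < n \<and> (\<exists>l<n. c m j l \<noteq> 0))"
  have m': "m' < n \<and> (\<exists>l<n. c m m' l \<noteq> 0)" unfolding m'_def by (rule LeastI_ex) (use m in blast)
  have m'0: "B m j = 0" if "j < m'" for j
  proof -
    have "c m j l = 0" if "l < n" for l
      using not_less_Least[of j "\<lambda>j. j < n \<and> (\<exists>l<n. c m j l \<noteq> 0)"] \<open>j < m'\<close> m' that unfolding m'_def[symmetric] by auto
    then show ?thesis by (simp add: B_def)
  qed
  obtain a where a: "a \<in> sgring P" "(\<Sum>i<n. x ^ i * A i) = x ^ m * (A m + a * x)"
    using lowest_power[where A=A and m=m and n=n, OF P U(1) AU m0] m by blast
  obtain a' where a': "a' \<in> sgring P" "A m = y ^ m' * (B m m' + a' * y)"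
    using lowest_power[where A="B m" and m=m' and n=n, OF P U(2) BU m'0] m' unfolding A_def[of m, symmetric] by blast
  have "(\<Sum>i<n. x ^ i * A i) = (\<Sum>i<n. \<Sum>j<n. \<Sum>l<n. cst (c i j l) * (x ^ i * y ^ j * z ^ l))"
    unfolding A_def B_def sum_distrib_left by (intro sum.cong refl) (simp only: ac_simps)
  then have "x ^ m * (y ^ m' * (B m m' + a' * y) + a * x) = 0" using a a' rel by simp
  then show thesis using that[of n "c m m'" a a' m m'] m' a a' unfolding B_def by blast
qed

section \<open>Finitely generated monoids and Noetherianity\<close>

lemma is_submonoid_hull: "is_submonoid (is_submonoid hull (A :: 'a::monoid_add set))"
  by (rule hull_in) (auto simp: is_submonoid_def)

lemma submonoid_zero: "is_submonoid P \<Longrightarrow> 0 \<in> P"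
  and submonoid_add: "is_submonoid P \<Longrightarrow> a \<in> P \<Longrightarrow> b \<in> P \<Longrightarrow> a + b \<in> P"
  by (auto simp: is_submonoid_def)

lemma submonoid_smul: "is_submonoid P \<Longrightarrow> a \<in> P \<Longrightarrow> smul k a \<in> P"
  by (induction k) (auto simp: smul_Suc submonoid_zero submonoid_add)

lemma hull_repr:
  assumes "finite A" "a \<in> is_submonoid hull A"
  shows "\<exists>c. a = (\<Sum>g\<in>A. smul (c g) g)"
proof -
  let ?X = "{a. \<exists>c. a = (\<Sum>g\<in>A. smul (c g) g)}"
  have "is_submonoid ?X" unfolding is_submonoid_def
  proof (intro conjI ballI)
    show "0 \<in> ?X" by (intro CollectI exI[of _ "\<lambda>_. 0"]) simp
    fix a b assume "a \<in> ?X" "b \<in> ?X"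
    then obtain c d where "a = (\<Sum>g\<in>A. smul (c g) g)" "b = (\<Sum>g\<in>A. smul (d g) g)" by blast
    then show "a + b \<in> ?X"
      by (intro CollectI exI[of _ "\<lambda>g. c g + d g"]) (simp add: smul_add sum.distrib)
  qed
  moreover have "A \<subseteq> ?X"
  proof
    fix x assume x: "x \<in> A"
    have "(\<Sum>g\<in>A. smul (if g = x then 1 else 0) g) = (\<Sum>g\<in>A. if g = x then g else 0)"
      by (rule sum.cong) auto
    also have "\<dots> = x" using assms(1) x by (subst sum.delta) auto
    finally show "x \<in> ?X" by (intro CollectI exI[of _ "\<lambda>g. if g = x then 1 else 0"]) simp
  qed
  ultimately have "is_submonoid hull A \<subseteq> ?X" by (intro hull_minimal)
  then show ?thesis using assms(2) by blast
qed

lemma hull_sum: "(\<Sum>g\<in>A. smul (c g) g) \<in> is_submonoid hull A"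
proof -
  have "(\<Sum>g\<in>B. smul (c g) g) \<in> is_submonoid hull A" if "B \<subseteq> A" for B
    using that
  proof (induction B rule: infinite_finite_induct)
    case (insert x B)
    then have "smul (c x) x \<in> is_submonoid hull A"
      by (intro submonoid_smul is_submonoid_hull) (auto intro: hull_inc)
    then show ?case using insert by (simp add: submonoid_add is_submonoid_hull)
  qed (auto simp: submonoid_zero is_submonoid_hull)
  then show ?thesis by blast
qed

text \<open>Some subsequence is monotone, and a decreasing one of naturals is constant once it
  reaches its minimum.\<close>

lemma nat_incseq_subseq: "\<exists>r. strict_mono r \<and> incseq (\<lambda>n. (f :: nat \<Rightarrow> nat) (r n))"
proof -
  obtain g where g: "strict_mono g" "monoseq (\<lambda>n. f (g n))" using seq_monosub by blast
  show ?thesis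
  proof (cases "incseq (\<lambda>n. f (g n))")
    case True then show ?thesis using g by blast
  next
    case False
    then have dec: "decseq (\<lambda>n. f (g n))" using g(2) by (auto simp: monoseq_iff)
    define m where "m = (LEAST v. v \<in> range (\<lambda>n. f (g n)))"
    have "m \<in> range (\<lambda>n. f (g n))" unfolding m_def by (rule LeastI_ex) blast
    then obtain n0 where n0: "m = f (g n0)" by blast
    have le: "m \<le> f (g n)" for n unfolding m_def by (rule Least_le) blast
    have "f (g (n + n0)) = m" for n
      using dec le[of "n + n0"] n0 by (simp add: decseq_def order_antisym)
    then have "incseq (\<lambda>n. f (g (n + n0)))" by (simp add: incseq_def)
    moreover have "strict_mono (\<lambda>n. g (n + n0))" using g(1) by (simp add: strict_mono_def)
    ultimately show ?thesis by blast
  qed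
qed

lemma dickson:
  assumes "finite A"
  shows "\<exists>r. strict_mono r \<and> (\<forall>g\<in>A. incseq (\<lambda>n. (c :: nat \<Rightarrow> 'g \<Rightarrow> nat) (r n) g))"
  using assms
proof (induction A rule: finite_induct)
  case empty
  have "strict_mono (\<lambda>n::nat. n)" by (simp add: strict_mono_def)
  then show ?case by blast
next
  case (insert x A)
  then obtain r where r: "strict_mono r" "\<forall>g\<in>A. incseq (\<lambda>n. c (r n) g)" by blast
  obtain s :: "nat \<Rightarrow> nat" where s: "strict_mono s" "incseq (\<lambda>n. c (r (s n)) x)"
    using nat_incseq_subseq[of "\<lambda>n. c (r n) x"] by blast
  have "strict_mono (\<lambda>n. r (s n))" using r(1) s(1) by (simp add: strict_mono_def)
  moreover have "incseq (\<lambda>n. c (r (s n)) g)" if "g \<in> A" for g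
    using r(2) that s(1) by (simp add: incseq_def strict_mono_less_eq)
  ultimately show ?case using s(2) by blast
qed

text \<open>Dickson's lemma for the coefficient vectors over the generators: when all coefficients
  grow, the difference is again a combination of generators.\<close>

lemma monoid_good_sequence:
  fixes A :: "(nat \<times> nat) set"
  assumes "finite A" "\<And>n :: nat. a n \<in> is_submonoid hull A"
  shows "\<exists>i j. i < j \<and> (\<exists>p\<in>is_submonoid hull A. a j = a i + p)"
proof -
  have "\<exists>c. \<forall>n. a n = (\<Sum>g\<in>A. smul (c n g) g)" using hull_repr[OF assms] by metis
  then obtain c where c: "\<And>n. a n = (\<Sum>g\<in>A. smul (c n g) g)" by blast
  obtain r :: "nat \<Rightarrow> nat" where r: "strict_mono r" "\<forall>g\<in>A. incseq (\<lambda>n. c (r n) g)"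
    using dickson[OF assms(1), of c] by blast
  let ?p = "\<Sum>g\<in>A. smul (c (r 1) g - c (r 0) g) g"
  have le: "c (r 0) g \<le> c (r 1) g" if "g \<in> A" for g
    using r(2) that incseqD[of "\<lambda>n. c (r n) g" 0 1] by simp
  have "a (r 1) = (\<Sum>g\<in>A. smul (c (r 1) g) g)" by (rule c)
  also have "\<dots> = (\<Sum>g\<in>A. smul (c (r 0) g) g + smul (c (r 1) g - c (r 0) g) g)"
  proof (rule sum.cong[OF refl])
    fix g assume "g \<in> A"
    then have "c (r 1) g = c (r 0) g + (c (r 1) g - c (r 0) g)" using le by simp
    then show "smul (c (r 1) g) g = smul (c (r 0) g) g + smul (c (r 1) g - c (r 0) g) g"
      using smul_add by metis
  qed
  also have "\<dots> = (\<Sum>g\<in>A. smul (c (r 0) g) g) + ?p" by (rule sum.distrib)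
  also have "(\<Sum>g\<in>A. smul (c (r 0) g) g) = a (r 0)" by (rule c[symmetric])
  finally have "a (r 1) = a (r 0) + ?p" .
  moreover have "r 0 < r 1" using r(1) by (simp add: strict_mono_def)
  moreover have "?p \<in> is_submonoid hull A" by (rule hull_sum)
  ultimately show ?thesis by (intro exI[of _ "r 0"] exI[of _ "r 1"] conjI bexI[of _ ?p])
qed

text \<open>\<open>E0\<close> collects the members of E that are minimal for divisibility in P. If
  it were infinite, \<open>monoid_good_sequence\<close> would make one member divide another;
  descent in degree leads from every e to \<open>E0\<close>.\<close>

lemma monoid_ideal_finite_basis:
  fixes A :: "(nat \<times> nat) set"
  assumes A: "finite A" "P = is_submonoid hull A" and E: "E \<subseteq> P"
  shows "\<exists>E0. finite E0 \<and> E0 \<subseteq> E \<and> (\<forall>e\<in>E. \<exists>e0\<in>E0. \<exists>p\<in>P. e = e0 + p)"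
proof -
  have P: "is_submonoid P" using A is_submonoid_hull by blast
  define E0 where "E0 = {e \<in> E. \<forall>e'\<in>E. \<forall>p\<in>P. e = e' + p \<longrightarrow> p = 0}"
  have "finite E0"
  proof (rule ccontr)
    assume "infinite E0"
    then obtain f :: "nat \<Rightarrow> nat \<times> nat" where f: "inj f" "range f \<subseteq> E0"
      using infinite_countable_subset by blast
    have "\<And>n. f n \<in> is_submonoid hull A" using f(2) E A unfolding E0_def by blast
    then obtain i j p where ij: "i < j" "p \<in> P" "f j = f i + p"
      using monoid_good_sequence[OF A(1), of f] A(2) by blast
    have "f i \<in> E" "f j \<in> E0" using f(2) by (auto simp: E0_def)
    then have "p = 0" using ij unfolding E0_def by blast
    then have "f j = f i" using ij by simp
    then show False using f(1) ij(1) by (auto dest: injD)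
  qed
  moreover have "\<exists>e0\<in>E0. \<exists>p\<in>P. e = e0 + p" if "e \<in> E" for e
    using that
  proof (induction "size1 e" arbitrary: e rule: less_induct)
    case less
    show ?case
    proof (cases "e \<in> E0")
      case True then show ?thesis using submonoid_zero[OF P] by (intro bexI[of _ e] bexI[of _ 0]) auto
    next
      case False
      then obtain e' p where *: "e' \<in> E" "p \<in> P" "e = e' + p" "p \<noteq> 0" using less.prems by (auto simp: E0_def)
      then have "size1 e' < size1 e" using size1_pos[of p] by simp
      then obtain e0 p' where "e0 \<in> E0" "p' \<in> P" "e' = e0 + p'" using less.hyps * by blast
      then show ?thesis using * submonoid_add[OF P] by (metis add.assoc)
    qed
  qed
  moreover have "E0 \<subseteq> E" unfolding E0_def by blast
  ultimately show ?thesis by (intro exI[of _ E0]) simp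
qed

lemma lexle_add: "lexle a b \<Longrightarrow> lexle (p + a) (p + b)"
  by (auto simp: lexle_def prod_eq_iff)

text \<open>Hilbert's argument with leading exponents. Divisibility is taken in P rather than in the
  lattice, so that the multiplying monomial belongs to the ring. The reduction stops because the
  lexicographic order on pairs of naturals is well-founded.\<close>

lemma noetherian_sgring:
  assumes A: "finite A" "P = is_submonoid hull A"
  shows "noetherian_ring (type_domain.R (sgring P :: 'k::field sgr set))"
proof -
  have P: "is_submonoid P" using A is_submonoid_hull by blast
  interpret type_domain "sgring P :: 'k sgr set" using P by (rule type_domain_sgring)
  show ?thesis
  proof (rule R.noetherian_ringI)
    fix I assume I: "ideal I R"
    have IU: "I \<subseteq> sgring P" and I0: "0 \<in> I" and Ia: "\<And>x y. x \<in> I \<Longrightarrow> y \<in> I \<Longrightarrow> x + y \<in> I"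
      and Im: "\<And>x r. x \<in> I \<Longrightarrow> r \<in> sgring P \<Longrightarrow> r * x \<in> I"
      using I[unfolded ideal_R_iff] by (elim conjE; simp)+
    define E where "E = lead ` (I - {0})"
    have EP: "E \<subseteq> P"
    proof
      fix e assume "e \<in> E"
      then obtain f where f: "f \<in> I" "f \<noteq> 0" "e = lead f" unfolding E_def by blast
      then have "keys f \<subseteq> P" using IU by (auto simp: sgring_def)
      then show "e \<in> P" using lead_in[OF f(2)] f(3) by blast
    qed
    obtain E0 where "finite E0 \<and> E0 \<subseteq> E \<and> (\<forall>e\<in>E. \<exists>e0\<in>E0. \<exists>p\<in>P. e = e0 + p)"
      using monoid_ideal_finite_basis[OF A EP] by (rule exE)
    then have E0: "finite E0" "E0 \<subseteq> E" "\<forall>e\<in>E. \<exists>e0\<in>E0. \<exists>p\<in>P. e = e0 + p" by simp_all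
    have "\<forall>e\<in>E0. \<exists>f. f \<in> I \<and> f \<noteq> 0 \<and> lead f = e"
    proof
      fix e assume "e \<in> E0"
      then have "e \<in> lead ` (I - {0})" using E0(2) unfolding E_def by (rule rev_subsetD)
      then show "\<exists>f. f \<in> I \<and> f \<noteq> 0 \<and> lead f = e"
      proof (rule imageE)
        fix f assume "e = lead f" "f \<in> I - {0}"
        then show ?thesis by (intro exI[of _ f]) simp
      qed
    qed
    from bchoice[OF this] obtain F where F': "\<forall>e\<in>E0. F e \<in> I \<and> F e \<noteq> 0 \<and> lead (F e) = e" by (rule exE)
    then have F: "\<And>e. e \<in> E0 \<Longrightarrow> F e \<in> I \<and> F e \<noteq> 0 \<and> lead (F e) = e" by simp
    let ?G = "F ` E0"
    have GU: "?G \<subseteq> carrier R" using F IU by auto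
    have K: "ideal (Idl\<^bsub>R\<^esub> ?G) R" using R.genideal_ideal[OF GU] .
    have K0: "0 \<in> Idl\<^bsub>R\<^esub> ?G" and Ka: "\<And>x y. x \<in> Idl\<^bsub>R\<^esub> ?G \<Longrightarrow> y \<in> Idl\<^bsub>R\<^esub> ?G \<Longrightarrow> x + y \<in> Idl\<^bsub>R\<^esub> ?G"
      and Km: "\<And>x r. x \<in> Idl\<^bsub>R\<^esub> ?G \<Longrightarrow> r \<in> sgring P \<Longrightarrow> r * x \<in> Idl\<^bsub>R\<^esub> ?G"
      using K[unfolded ideal_R_iff] by (elim conjE; simp)+
    have main: "f \<in> Idl\<^bsub>R\<^esub> ?G" if "f \<in> I" for f
      using that
    proof (induction "lead f" arbitrary: f rule: wf_induct_rule[OF wf_lex_prod[OF wf_less_than wf_less_than]])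
      case (1 f)
      show ?case
      proof (cases "f = 0")
        case True then show ?thesis using K0 by simp
      next
        case False
        then have "lead f \<in> E" using 1 by (auto simp: E_def)
        then obtain e0 p where e0: "e0 \<in> E0" "p \<in> P" "lead f = e0 + p" using E0(3) by blast
        define g where "g = F e0"
        have g: "g \<in> I" "g \<noteq> 0" "lead g = e0" using F e0 by (auto simp: g_def)
        have lg: "lk g e0 \<noteq> 0" using lead_in[OF g(2)] g(3) by (simp add: in_keys_iff)
        \<comment> \<open>The multiple of g with the leading term of f, so that \<open>f - h\<close>
          is zero or has a strictly lower lead.\<close>
        define h where "h = Poly_Mapping.single p (lk f (lead f) / lk g e0) * g"
        have sU: "Poly_Mapping.single p (lk f (lead f) / lk g e0) \<in> sgring P" using e0 by (simp add: single_in_sgring)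
        have hG: "h \<in> Idl\<^bsub>R\<^esub> ?G"
          unfolding h_def using R.genideal_self[OF GU] e0 by (intro Km sU) (auto simp: g_def)
        have "- 1 * h \<in> I" unfolding h_def using Im[OF Im[OF g(1) sU], of "- 1"] by simp
        then have f': "f - h \<in> I" using Ia[OF 1(2), of "- h"] by simp
        have "f - h \<in> Idl\<^bsub>R\<^esub> ?G"
        proof (cases "f - h = 0")
          case True then show ?thesis using K0 by metis
        next
          case nz: False
          have "lexle a (lead f)" if "a \<in> keys (f - h)" for a
          proof -
            have "a \<in> keys f \<or> a \<in> keys h" using keys_minus that by blast
            then show ?thesis
            proof
              assume "a \<in> keys f" then show ?thesis using lead_max[OF False] by simp
            next
              assume "a \<in> keys h"
              then obtain b where "b \<in> keys g" "a = p + b" unfolding h_def by (auto elim!: keys_timesD split: if_splits)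
              then show ?thesis using lead_max[OF g(2)] g(3) e0(3) lexle_add[of b e0 p] by (simp add: add.commute)
            qed
          qed
          then have "lexle (lead (f - h)) (lead f)" using lead_in[OF nz] by simp
          moreover have "lk (f - h) (lead f) = 0"
            using lookup_mon_times[of p "lk f (lead f) / lk g e0" g e0] lg e0(3)
            by (simp add: h_def lookup_minus add.commute)
          then have "lead (f - h) \<noteq> lead f" using lead_in[OF nz] by (auto simp: in_keys_iff)
          ultimately have "(lead (f - h), lead f) \<in> less_than <*lex*> less_than"
            by (cases "lead (f - h)"; cases "lead f") (auto simp: lexle_def)
          then show ?thesis using 1(1) f' by blast
        qed
        then have "(f - h) + h \<in> Idl\<^bsub>R\<^esub> ?G" using Ka hG by blast
        then show ?thesis by simp
      qed
    qed
    moreover have "Idl\<^bsub>R\<^esub> ?G \<subseteq> I" using F by (intro R.genideal_minimal[OF I]) blast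
    ultimately show "\<exists>A\<subseteq>carrier R. finite A \<and> I = Idl\<^bsub>R\<^esub> A"
      using GU E0(1) by (intro exI[of _ ?G]) auto
  qed
qed

section \<open>Localization at a prime\<close>

context type_domain
begin

lemma prime_facts:
  assumes "primeideal M R"
  shows "M \<subseteq> U" "0 \<in> M" "\<And>x y. x \<in> M \<Longrightarrow> y \<in> M \<Longrightarrow> x + y \<in> M"
    "\<And>x r. x \<in> M \<Longrightarrow> r \<in> U \<Longrightarrow> r * x \<in> M" "\<And>x r. x \<in> M \<Longrightarrow> r \<in> U \<Longrightarrow> x * r \<in> M"
    "\<And>x y. x \<in> U \<Longrightarrow> y \<in> U \<Longrightarrow> x * y \<in> M \<Longrightarrow> x \<in> M \<or> y \<in> M" "1 \<notin> M"
proof -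
  interpret M: primeideal M R by (rule assms)
  have id: "M \<subseteq> U \<and> 0 \<in> M \<and> (\<forall>x\<in>M. \<forall>y\<in>M. x + y \<in> M) \<and> (\<forall>x\<in>M. \<forall>r\<in>U. r * x \<in> M)"
    using M.ideal_axioms unfolding ideal_R_iff .
  show "M \<subseteq> U" "0 \<in> M" "\<And>x y. x \<in> M \<Longrightarrow> y \<in> M \<Longrightarrow> x + y \<in> M" "\<And>x r. x \<in> M \<Longrightarrow> r \<in> U \<Longrightarrow> r * x \<in> M"
    using id by auto
  then show "\<And>x r. x \<in> M \<Longrightarrow> r \<in> U \<Longrightarrow> x * r \<in> M" by (metis mult.commute)
  show "\<And>x y. x \<in> U \<Longrightarrow> y \<in> U \<Longrightarrow> x * y \<in> M \<Longrightarrow> x \<in> M \<or> y \<in> M" using M.I_prime by simp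
  show "1 \<notin> M" using M.I_notcarr M.one_imp_carrier by auto
qed

end

locale type_domain_prime = type_domain +
  fixes M
  assumes M_prime: "primeideal M (type_domain.R U)"
begin

lemmas M_facts = prime_facts[OF M_prime]

sublocale loc: type_domain_loc U "U - M"
proof unfold_locales
  show "U - M \<subseteq> U" "1 \<in> U - M" "0 \<notin> U - M" using M_facts by auto
  show "\<And>s t. s \<in> U - M \<Longrightarrow> t \<in> U - M \<Longrightarrow> s * t \<in> U - M" using M_facts(6) by auto
qed

abbreviation "L \<equiv> loc.L"
abbreviation "m \<equiv> loc.extn M"

lemma M_ideal: "ideal M R" using M_prime by (rule primeideal.axioms(1))

lemma fr_in_extn:
  assumes "primeideal q R" "q \<subseteq> M" "r \<in> U" "s \<in> U - M"
  shows "loc.fr r s \<in> loc.extn q \<longleftrightarrow> r \<in> q"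
proof
  note q_f = prime_facts[OF assms(1)]
  assume "loc.fr r s \<in> loc.extn q"
  then obtain a t where a: "loc.fr r s = loc.fr a t" "a \<in> q" "t \<in> U - M" unfolding loc.extn_def by blast
  have "a \<in> U" using q_f(1) a(2) by (rule subsetD)
  then have e: "t * r = s * a" using a(1) loc.fr_eq_iff[OF assms(3,4) _ a(3)] by metis
  have "s * a \<in> q" using q_f(4)[OF a(2)] assms(4) by simp
  then have "t * r \<in> q" unfolding e .
  then show "r \<in> q" using q_f(6)[of t r] a(3) assms(2,3) by auto
next
  assume "r \<in> q"
  then show "loc.fr r s \<in> loc.extn q" using assms(4) unfolding loc.extn_def by blast
qed

text \<open>An r outside M is an admissible denominator, so \<open>fr r 1\<close> has the inverse
  \<open>fr 1 r\<close> and lies in no proper ideal.\<close>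

lemma proper_contr:
  assumes "ideal J L" "J \<noteq> carrier L" shows "loc.contr J \<subseteq> M"
proof
  interpret J: ideal J L by fact
  fix r assume "r \<in> loc.contr J"
  then have r: "r \<in> U" "loc.fr r 1 \<in> J" by (auto simp: loc.contr_def)
  show "r \<in> M"
  proof (rule ccontr)
    assume "r \<notin> M"
    then have rS: "r \<in> U - M" using r by auto
    have "loc.fr 1 r \<otimes>\<^bsub>L\<^esub> loc.fr r 1 \<in> J" using r rS J.I_l_closed by simp
    also have "loc.fr 1 r \<otimes>\<^bsub>L\<^esub> loc.fr r 1 = \<one>\<^bsub>L\<^esub>"
      using rS r loc.fr_eq_iff[of r r 1 1] loc.S_one by (simp add: loc.L_one)
    finally show False using J.one_imp_carrier assms(2) by blast
  qed
qed

lemma ideal_sub_m: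
  assumes "ideal J L" "J \<noteq> carrier L" shows "J \<subseteq> m"
proof -
  have "loc.extn (loc.contr J) \<subseteq> m" using proper_contr[OF assms] unfolding loc.extn_def by blast
  then show ?thesis using loc.ideal_eq_extn[OF assms(1)] by metis
qed

lemma m_proper: "m \<noteq> carrier L"
proof
  assume "m = carrier L"
  then have "loc.fr 1 1 \<in> m" using loc.fr_in_L[OF one_closed loc.S_one] by simp
  then show False using fr_in_extn[OF M_prime, of 1 1] loc.S_one M_facts(7) by auto
qed

lemma m_maximal: "maximalideal m L"
proof (rule maximalidealI)
  show "ideal m L" by (rule loc.ideal_extn[OF M_ideal])
  show "carrier L \<noteq> m" using m_proper by metis
  show "\<And>J. ideal J L \<Longrightarrow> m \<subseteq> J \<Longrightarrow> J \<subseteq> carrier L \<Longrightarrow> J = m \<or> J = carrier L"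
    using ideal_sub_m by blast
qed

lemma m_unique:
  assumes "maximalideal m' L" shows "m' = m"
proof -
  interpret m': maximalideal m' L by fact
  have "m' \<subseteq> m" using ideal_sub_m[OF m'.ideal_axioms] m'.I_notcarr by blast
  moreover have "ideal m L" by (rule loc.ideal_extn[OF M_ideal])
  moreover have "m \<subseteq> carrier L" using \<open>ideal m L\<close> by (meson additive_subgroup.a_subset ideal.axioms(1))
  ultimately show ?thesis using m'.I_maximal m_proper by blast
qed

lemma prime_extn:
  assumes "primeideal q R" "q \<subseteq> M" shows "primeideal (loc.extn q) L"
proof (rule primeidealI)
  note q_f = prime_facts[OF assms(1)]
  show "ideal (loc.extn q) L" by (rule loc.ideal_extn[OF primeideal.axioms(1)[OF assms(1)]])
  show "cring L" by (rule loc.cring_L)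
  have "loc.extn q \<subseteq> m" using assms(2) unfolding loc.extn_def by blast
  moreover have "m \<subseteq> carrier L"
    using loc.ideal_extn[OF M_ideal] by (meson additive_subgroup.a_subset ideal.axioms(1))
  ultimately show "carrier L \<noteq> loc.extn q" using m_proper by blast
  fix x y assume xy: "x \<in> carrier L" "y \<in> carrier L" "x \<otimes>\<^bsub>L\<^esub> y \<in> loc.extn q"
  obtain a s where a: "a \<in> U" "s \<in> U - M" "x = loc.fr a s" using xy(1) by (rule loc.L_cases)
  obtain b t where b: "b \<in> U" "t \<in> U - M" "y = loc.fr b t" using xy(2) by (rule loc.L_cases)
  have "loc.fr (a * b) (s * t) \<in> loc.extn q" using xy(3) a b by simp
  then have "a * b \<in> q" using fr_in_extn[OF assms, of "a * b" "s * t"] a(1,2) b(1,2) loc.S_mult[of s t] mult_closed[of a b] by metis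
  then have "a \<in> q \<or> b \<in> q" by (rule q_f(6)[OF a(1) b(1)])
  then show "x \<in> loc.extn q \<or> y \<in> loc.extn q" using a b unfolding loc.extn_def by blast
qed

text \<open>Extension recovers an ideal from its contraction, so strict chains stay strict. Chain
  lengths in \<open>L\<close> can thus be bounded inside the semigroup ring.\<close>

lemma prime_chain_contr:
  assumes "\<forall>i\<le>n. primeideal (p i) L" "\<forall>i<n. p i \<subset> p (Suc i)"
  shows "\<forall>i\<le>n. primeideal (loc.contr (p i)) R \<and> loc.contr (p i) \<subseteq> M"
    and "\<forall>i<n. loc.contr (p i) \<subset> loc.contr (p (Suc i))"
proof -
  show "\<forall>i\<le>n. primeideal (loc.contr (p i)) R \<and> loc.contr (p i) \<subseteq> M"
  proof (intro allI impI conjI)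
    fix i assume "i \<le> n"
    then interpret pi: primeideal "p i" L using assms by blast
    show "primeideal (loc.contr (p i)) R" by (rule loc.prime_contr[OF pi.primeideal])
    show "loc.contr (p i) \<subseteq> M" using proper_contr[OF pi.ideal_axioms] pi.I_notcarr by blast
  qed
  show "\<forall>i<n. loc.contr (p i) \<subset> loc.contr (p (Suc i))"
  proof (intro allI impI)
    fix i assume i: "i < n"
    have id: "ideal (p i) L" "ideal (p (Suc i)) L" using assms(1) i by (auto intro: primeideal.axioms(1))
    have lt: "p i \<subset> p (Suc i)" using assms(2) i by simp
    have "loc.contr (p i) \<noteq> loc.contr (p (Suc i))"
    proof
      assume "loc.contr (p i) = loc.contr (p (Suc i))"
      then have "p i = p (Suc i)" using loc.ideal_eq_extn[OF id(1)] loc.ideal_eq_extn[OF id(2)] by metis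
      then show False using lt by simp
    qed
    moreover have "loc.contr (p i) \<subseteq> loc.contr (p (Suc i))" using lt unfolding loc.contr_def by auto
    ultimately show "loc.contr (p i) \<subset> loc.contr (p (Suc i))" by simp
  qed
qed

end

section \<open>Krull dimension of localized semigroup rings\<close>

lemma ideal_sum_closed:
  assumes "0 \<in> J" "\<And>x y. x \<in> J \<Longrightarrow> y \<in> J \<Longrightarrow> x + y \<in> J" "\<And>i. i \<in> I \<Longrightarrow> f i \<in> J"
  shows "sum f I \<in> J"
  using assms by (induction I rule: infinite_finite_induct) auto

text \<open>In every term of the binomial expansion the exponent of x is at least p or that of y is
  at least q.\<close>

lemma radical_add:
  fixes x y :: "'a::comm_ring_1"
  assumes J: "0 \<in> J" "\<And>x y. x \<in> J \<Longrightarrow> y \<in> J \<Longrightarrow> x + y \<in> J" "\<And>x r. x \<in> J \<Longrightarrow> r \<in> U \<Longrightarrow> r * x \<in> J"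
    and U: "x \<in> U" "y \<in> U" "1 \<in> U" "\<And>a b. a \<in> U \<Longrightarrow> b \<in> U \<Longrightarrow> a * b \<in> U"
    and x: "x ^ p \<in> J" and y: "y ^ q \<in> J"
  shows "(x + y) ^ (p + q) \<in> J"
proof -
  have pw: "z ^ i \<in> U" if "z \<in> U" for z i using that U by (induction i) auto
  \<comment> \<open>U is only assumed closed under products, so the binomial coefficients act by
    repeated addition in J.\<close>
  have nat: "of_nat i * z \<in> J" if "z \<in> J" for i z
    using that J by (induction i) (auto simp: algebra_simps)
  have "x ^ k * y ^ (p + q - k) \<in> J" if "k \<le> p + q" for k
  proof (cases "p \<le> k")
    case True
    then have "x ^ k = x ^ (k - p) * x ^ p" by (simp flip: power_add)
    then have "x ^ k * y ^ (p + q - k) = (y ^ (p + q - k) * x ^ (k - p)) * x ^ p" by (simp add: ac_simps)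
    moreover have "(y ^ (p + q - k) * x ^ (k - p)) * x ^ p \<in> J" using x by (rule J(3)) (intro U pw)
    ultimately show ?thesis by simp
  next
    case False
    then have "p + q - k = (p + q - k - q) + q" by simp
    then have "y ^ (p + q - k) = y ^ (p + q - k - q) * y ^ q" by (metis power_add)
    then have "x ^ k * y ^ (p + q - k) = (x ^ k * y ^ (p + q - k - q)) * y ^ q" by (simp add: ac_simps)
    moreover have "(x ^ k * y ^ (p + q - k - q)) * y ^ q \<in> J" using y by (rule J(3)) (intro U pw)
    ultimately show ?thesis by simp
  qed
  then have "of_nat (p + q choose k) * x ^ k * y ^ (p + q - k) \<in> J" if "k \<le> p + q" for k
    using nat that unfolding mult.assoc by simp
  then show ?thesis unfolding binomial_ring by (intro ideal_sum_closed J(1,2)) auto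
qed

locale sg_prime =
  fixes P :: "(nat \<times> nat) set" and M :: "'k::field sgr set"
  assumes P: "is_submonoid P" and MP: "primeideal M (type_domain.R (sgring P))"
begin

sublocale type_domain_prime "sgring P" M
  using type_domain_sgring[OF P] MP by (intro type_domain_prime.intro type_domain_prime_axioms.intro)

lemma cst_closed [simp]: "cst c \<in> sgring P" by (rule sgring_closed(1)[OF P])

text \<open>Choose x in \<open>q1\<close> outside \<open>q0\<close> and y in \<open>q2\<close>
  outside \<open>q1\<close>. In x^m (y^m' (s + a' y) + a x) = 0 the power of x cancels modulo
  \<open>q0\<close>, then a x drops out and the power of y cancels modulo \<open>q1\<close>, and a'
  y drops out modulo \<open>q2\<close>. So every z is algebraic over the field modulo the top of a
  chain of length two.\<close>

lemma collapse2:
  assumes q: "primeideal q0 R" "primeideal q1 R" "primeideal q2 R" "q0 \<subset> q1" "q1 \<subset> q2" and z: "z \<in> sgring P"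
  obtains n c where "\<exists>l<n. c l \<noteq> 0" "(\<Sum>l<n. z ^ l * cst (c l)) \<in> q2"
proof -
  note q0_f = prime_facts[OF q(1)]
  note q1_f = prime_facts[OF q(2)]
  note q2_f = prime_facts[OF q(3)]
  obtain x y where x: "x \<in> q1" "x \<notin> q0" and y: "y \<in> q2" "y \<notin> q1" using q by blast
  have U: "x \<in> sgring P" "y \<in> sgring P" using x y q1_f(1) q2_f(1) by auto
  obtain m m' n c a a' where c: "\<exists>l<n. c l \<noteq> 0" and a: "a \<in> sgring P" "a' \<in> sgring P"
    and rel: "x ^ m * (y ^ m' * ((\<Sum>l<n. z ^ l * cst (c l)) + a' * y) + a * x) = 0"
    by (rule collapse_relation[OF P U z])
  define s where "s = (\<Sum>l<n. z ^ l * cst (c l))"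
  have sU: "s \<in> sgring P" unfolding s_def using z by (intro sgring_sum[OF P] mult_closed power_closed cst_closed)
  have pw: "w ^ i \<notin> q" if "w \<notin> q" "w \<in> sgring P" "primeideal q R" for w i and q :: "'k sgr set"
  proof -
    note q_f = prime_facts[OF that(3)]
    show ?thesis
    proof (induction i)
      case (Suc i)
      have "\<not> w * w ^ i \<in> q" using q_f(6)[OF that(2) power_closed[OF that(2)]] that(1) Suc by blast
      then show ?case by simp
    qed (use q_f(7) in simp)
  qed
  have U1: "s + a' * y \<in> sgring P" by (intro add_closed mult_closed sU a U)
  then have U2: "y ^ m' * (s + a' * y) + a * x \<in> sgring P" by (intro add_closed mult_closed power_closed a U sU)
  have "x ^ m * (y ^ m' * (s + a' * y) + a * x) = 0" using rel unfolding s_def .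
  then have "x ^ m * (y ^ m' * (s + a' * y) + a * x) \<in> q0" using q0_f(2) by metis
  then have "y ^ m' * (s + a' * y) + a * x \<in> q0"
    using q0_f(6)[OF power_closed[OF U(1)] U2] pw[OF x(2) U(1) q(1)] by blast
  then have "y ^ m' * (s + a' * y) + a * x \<in> q1" using q by blast
  moreover have "(- a) * x \<in> q1" using q1_f(4)[OF x(1), of "- a"] a by simp
  ultimately have "(y ^ m' * (s + a' * y) + a * x) + (- a) * x \<in> q1" by (rule q1_f(3))
  then have "y ^ m' * (s + a' * y) \<in> q1" by simp
  then have "s + a' * y \<in> q1"
    using q1_f(6)[OF power_closed[OF U(2)] U1] pw[OF y(2) U(2) q(2)] by blast
  then have "s + a' * y \<in> q2" using q by blast
  moreover have "(- a') * y \<in> q2" using q2_f(4)[OF y(1), of "- a'"] a by simp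
  ultimately have "(s + a' * y) + (- a') * y \<in> q2" by (rule q2_f(3))
  then have "s \<in> q2" by simp
  then show thesis using c unfolding s_def by (intro that[of n c])
qed

text \<open>A fourth prime permits one more cancellation, and what remains is a nonzero constant, a
  unit, inside \<open>q3\<close>.\<close>

lemma collapse3:
  assumes q: "primeideal q0 R" "primeideal q1 R" "primeideal q2 R" "primeideal q3 R" "q0 \<subset> q1" "q1 \<subset> q2" "q2 \<subset> q3"
  shows False
proof -
  note q2_f = prime_facts[OF q(3)]
  note q3_f = prime_facts[OF q(4)]
  obtain z where z: "z \<in> q3" "z \<notin> q2" using q by blast
  have zU: "z \<in> sgring P" using z q3_f(1) by auto
  obtain n c where c: "\<exists>l<n. c l \<noteq> 0" "(\<Sum>l<n. z ^ l * cst (c l)) \<in> q2"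
    using collapse2[OF q(1-3) q(5,6) zU] by blast
  define k where "k = (LEAST l. l < n \<and> c l \<noteq> 0)"
  have k: "k < n \<and> c k \<noteq> 0" unfolding k_def by (rule LeastI_ex) (use c in blast)
  have k0: "cst (c l) = 0" if "l < k" for l
    using not_less_Least[of l "\<lambda>l. l < n \<and> c l \<noteq> 0"] that k unfolding k_def[symmetric] by auto
  obtain a where a: "a \<in> sgring P" "(\<Sum>l<n. z ^ l * cst (c l)) = z ^ k * (cst (c k) + a * z)"
    using lowest_power[where A="\<lambda>l. cst (c l)" and m=k and n=n, OF P zU cst_closed k0] k by blast
  have "z ^ i \<notin> q2" for i
  proof (induction i)
    case (Suc i)
    have "\<not> z * z ^ i \<in> q2" using q2_f(6)[OF zU power_closed[OF zU]] z(2) Suc by blast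
    then show ?case by simp
  qed (use q2_f(7) in simp)
  moreover have "cst (c k) + a * z \<in> sgring P" by (intro add_closed mult_closed cst_closed a zU)
  moreover have "z ^ k * (cst (c k) + a * z) \<in> q2" using c(2) unfolding a(2) .
  ultimately have "cst (c k) + a * z \<in> q2"
    using q2_f(6)[OF power_closed[OF zU]] by blast
  then have "cst (c k) + a * z \<in> q3" using q by blast
  moreover have "(- a) * z \<in> q3" using q3_f(4)[OF z(1), of "- a"] a by simp
  ultimately have "(cst (c k) + a * z) + (- a) * z \<in> q3" by (rule q3_f(3))
  then have "cst (inverse (c k)) * cst (c k) \<in> q3" using q3_f(4)[of "cst (c k)" "cst (inverse (c k))"] by simp
  then show False using k q3_f(7) by (simp add: mult_single)
qed

definition chain :: "nat \<Rightarrow> bool" where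
  "chain n \<longleftrightarrow> (\<exists>p. (\<forall>i\<le>n. primeideal (p i) L) \<and> (\<forall>i<n. p i \<subset> p (Suc i)))"

lemma krull_dim_chain: "krull_dim L = Sup {enat n | n. chain n}"
  by (simp add: krull_dim_def chain_def)

lemma chain_mono: "chain n \<Longrightarrow> k \<le> n \<Longrightarrow> chain k"
proof -
  assume n: "chain n" and k: "k \<le> n"
  from n obtain p where "\<forall>i\<le>n. primeideal (p i) L" "\<forall>i<n. p i \<subset> p (Suc i)" unfolding chain_def by blast
  then have "(\<forall>i\<le>k. primeideal (p i) L) \<and> (\<forall>i<k. p i \<subset> p (Suc i))" using k by simp
  then show "chain k" unfolding chain_def by (intro exI[of _ p])
qed

lemma no_chain3: "\<not> chain 3"
proof
  assume "chain 3"
  then obtain p where p: "\<forall>i\<le>3. primeideal (p i) L" "\<forall>i<3. p i \<subset> p (Suc i)" unfolding chain_def by blast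
  note q = prime_chain_contr[OF p]
  have "primeideal (loc.contr (p 0)) R" "primeideal (loc.contr (p 1)) R"
    "primeideal (loc.contr (p 2)) R" "primeideal (loc.contr (p 3)) R" using q(1) by auto
  moreover have "loc.contr (p 0) \<subset> loc.contr (p 1)" "loc.contr (p 1) \<subset> loc.contr (p 2)" "loc.contr (p 2) \<subset> loc.contr (p 3)"
    using q(2)[rule_format, of 0] q(2)[rule_format, of 1] q(2)[rule_format, of 2] by (auto simp: numeral_eq_Suc)
  ultimately show False by (rule collapse3)
qed

lemma chain_le2: "chain n \<Longrightarrow> n \<le> 2"
  using chain_mono[of n 3] no_chain3 by linarith

lemma krull_dim_le2: "krull_dim L \<le> 2"
  unfolding krull_dim_chain by (rule Sup_least) (use chain_le2 in \<open>auto simp: numeral_eq_enat\<close>)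

text \<open>The strict bound \<open>enat k\<close> on the supremum is exceeded by a member of the
  set, and \<open>chain_mono\<close> shortens that chain.\<close>

lemma krull_dim_ge_imp_chain:
  assumes "enat (Suc k) \<le> krull_dim L" shows "chain (Suc k)"
proof -
  have "enat k < Sup {enat n | n. chain n}" using assms unfolding krull_dim_chain by (metis Suc_ile_eq)
  then obtain n where "chain n" "k < n" unfolding less_Sup_iff by auto
  then show ?thesis using chain_mono by simp
qed

lemma krull_dim_eq2:
  assumes "primeideal q0 R" "primeideal q1 R" "primeideal q2 R" "q0 \<subset> q1" "q1 \<subset> q2" "q2 \<subseteq> M"
  shows "krull_dim L = 2"
proof -
  have strict: "loc.extn q \<subset> loc.extn q'" if pr: "primeideal q R" "primeideal q' R" and sb: "q \<subset> q'" "q' \<subseteq> M" for q q'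
  proof -
    obtain r where r: "r \<in> q'" "r \<notin> q" using sb by blast
    then have "r \<in> M" using sb by blast
    then have rU: "r \<in> sgring P" using M_facts(1) by blast
    have "q \<subseteq> M" using sb by blast
    then have "loc.fr r 1 \<notin> loc.extn q" "loc.fr r 1 \<in> loc.extn q'"
      using fr_in_extn[OF pr(1) _ rU loc.S_one] fr_in_extn[OF pr(2) sb(2) rU loc.S_one] r by auto
    moreover have "loc.extn q \<subseteq> loc.extn q'" using sb unfolding loc.extn_def by blast
    ultimately show ?thesis by blast
  qed
  let ?p = "\<lambda>i::nat. if i = 0 then loc.extn q0 else if i = 1 then loc.extn q1 else loc.extn q2"
  have sub: "q0 \<subseteq> M" "q1 \<subseteq> M" using assms by auto
  have "primeideal (loc.extn q0) L" "primeideal (loc.extn q1) L" "primeideal (loc.extn q2) L"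
    by (rule prime_extn[OF assms(1) sub(1)] prime_extn[OF assms(2) sub(2)] prime_extn[OF assms(3,6)])+
  then have "\<forall>i\<le>2. primeideal (?p i) L" by simp
  moreover have "\<forall>i<2. ?p i \<subset> ?p (Suc i)"
    using strict[OF assms(1,2,4) sub(2)] strict[OF assms(2,3,5,6)] by (simp add: less_2_cases_iff)
  ultimately have "chain 2" unfolding chain_def by (intro exI[of _ ?p] conjI)
  then have "enat 2 \<le> krull_dim L" unfolding krull_dim_chain by (intro Sup_upper CollectI exI[of _ 2]) simp
  then show ?thesis using krull_dim_le2 by (simp add: numeral_eq_enat)
qed

end

section \<open>The Buchsbaum property of a semigroup ring\<close>

locale bar_monoid =
  fixes P N Pb :: "(nat \<times> nat) set"
  assumes N_fin: "finite N" and P_hull: "P = is_submonoid hull N" and N_zero: "0 \<notin> N"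
    and Pb_def: "Pb = {a. \<forall>n\<in>N. a + n \<in> P}"
begin

lemma P: "is_submonoid P" unfolding P_hull by (rule is_submonoid_hull)

lemma N_P: "n \<in> N \<Longrightarrow> n \<in> P" unfolding P_hull by (rule hull_inc)

lemma P_split:
  assumes "p \<in> P" "p \<noteq> 0" obtains n p' where "n \<in> N" "p' \<in> P" "p = n + p'"
proof -
  let ?X = "{p \<in> P. p = 0 \<or> (\<exists>n\<in>N. \<exists>p'\<in>P. p = n + p')}"
  have "is_submonoid ?X" unfolding is_submonoid_def
  proof (intro conjI ballI)
    show "0 \<in> ?X" using submonoid_zero[OF P] by simp
    fix a b assume ab: "a \<in> ?X" "b \<in> ?X"
    then have P': "a \<in> P" "b \<in> P" "a + b \<in> P" using submonoid_add[OF P] by auto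
    show "a + b \<in> ?X"
    proof (cases "a = 0")
      case True then show ?thesis using ab by simp
    next
      case False
      then obtain n p' where n: "n \<in> N" "p' \<in> P" "a = n + p'" using ab(1) by blast
      then have "a + b = n + (p' + b)" "p' + b \<in> P" using P' submonoid_add[OF P] by (auto simp: add.assoc)
      then show ?thesis using n(1) P'(3) by blast
    qed
  qed
  moreover have "N \<subseteq> ?X"
  proof
    fix n assume n: "n \<in> N"
    then have "n = n + 0" "n \<in> P" by (auto intro: N_P)
    then show "n \<in> ?X" using n submonoid_zero[OF P] by blast
  qed
  ultimately have "P \<subseteq> ?X" unfolding P_hull by (intro hull_minimal)
  then show thesis using assms that by blast
qed

text \<open>Splitting one generator n off p puts a + n into P by definition, and the rest of p is in
  P.\<close>

lemma Pb_add_P: "a \<in> Pb \<Longrightarrow> p \<in> P \<Longrightarrow> p \<noteq> 0 \<Longrightarrow> a + p \<in> P"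
proof -
  assume a: "a \<in> Pb" "p \<in> P" "p \<noteq> 0"
  obtain n p' where n: "n \<in> N" "p' \<in> P" "p = n + p'" using P_split[OF a(2,3)] by blast
  then have "a + p = (a + n) + p'" by (simp add: add.assoc)
  moreover have "a + n \<in> P" using a(1) n(1) by (simp add: Pb_def)
  ultimately show "a + p \<in> P" using n(2) submonoid_add[OF P] by simp
qed

lemma P_Pb: "p \<in> P \<Longrightarrow> p \<in> Pb"
  by (auto simp: Pb_def intro: submonoid_add[OF P] N_P)

lemma Pb: "is_submonoid Pb" unfolding is_submonoid_def
proof (intro conjI ballI)
  show "0 \<in> Pb" using P_Pb submonoid_zero[OF P] by blast
  fix a b assume ab: "a \<in> Pb" "b \<in> Pb"
  show "a + b \<in> Pb" unfolding Pb_def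
  proof (intro CollectI ballI)
    fix n assume n: "n \<in> N"
    then have "b + n \<in> P" using ab by (simp add: Pb_def)
    moreover have "b + n \<noteq> 0" using n N_zero by (metis add_is_0 fst_add snd_add fst_zero snd_zero prod_eq_iff)
    ultimately have "a + (b + n) \<in> P" using Pb_add_P ab by blast
    then show "a + b + n \<in> P" by (simp add: add.assoc)
  qed
qed

text \<open>Induction on i + j: \<open>a + n1\<close> and \<open>a + n2\<close> satisfy the
  hypotheses with one index lowered, so both lie in \<open>Pb\<close>, and \<open>cm\<close> brings
  a into \<open>Pb\<close>.\<close>

lemma grid:
  assumes "n1 \<in> Pb" "n2 \<in> Pb" and cm: "\<And>a. a + n1 \<in> Pb \<Longrightarrow> a + n2 \<in> Pb \<Longrightarrow> a \<in> Pb"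
  shows "a + smul i n1 \<in> Pb \<Longrightarrow> a + smul j n2 \<in> Pb \<Longrightarrow> a \<in> Pb"
proof (induction "i + j" arbitrary: a i j rule: less_induct)
  case less
  show ?case
  proof (cases "i = 0 \<or> j = 0")
    case True then show ?thesis using less.prems by auto
  next
    case False
    then obtain i' j' where ij: "i = Suc i'" "j = Suc j'" by (metis not0_implies_Suc)
    have X: "(a + n1) + smul i' n1 \<in> Pb" using less.prems(1) by (simp add: ij smul_Suc add.assoc)
    have Y: "(a + n1) + smul j n2 \<in> Pb"
      using submonoid_add[OF Pb less.prems(2) assms(1)] by (simp add: add.assoc add.left_commute add.commute)
    have 1: "a + n1 \<in> Pb" by (rule less.hyps[OF _ X Y]) (simp add: ij)
    have X': "(a + n2) + smul j' n2 \<in> Pb" using less.prems(2) by (simp add: ij smul_Suc add.assoc)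
    have Y': "(a + n2) + smul i n1 \<in> Pb"
      using submonoid_add[OF Pb less.prems(1) assms(2)] by (simp add: add.assoc add.left_commute add.commute)
    have 2: "a + n2 \<in> Pb" by (rule less.hyps[OF _ Y' X']) (simp add: ij)
    show ?thesis using cm 1 2 by blast
  qed
qed

end

text \<open>\<open>T1\<close> cuts out the face of P along the first ray. Subtraction can leave N^2,
  so \<open>cone\<close> provides x - e n2 as an element of N^2; whether it lies in
  \<open>Pb\<close> is a separate question, answered by \<open>grid\<close>.\<close>

locale simplicial_pair = bar_monoid +
  fixes T1 :: "(nat \<times> nat) set" and n1 n2 :: "nat \<times> nat"
  assumes n1: "n1 \<in> P" "n1 \<noteq> 0" and n2: "n2 \<in> P" "n2 \<noteq> 0"
    and multiple: "\<And>p. p \<in> P \<Longrightarrow> p \<noteq> 0 \<Longrightarrow> \<exists>k>0. \<exists>i j. smul k p = smul i n1 + smul j n2"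
    and face: "0 \<in> T1" "n1 \<in> T1" "n2 \<notin> T1" "\<And>a b. a \<in> P \<Longrightarrow> b \<in> P \<Longrightarrow> a + b \<in> T1 \<longleftrightarrow> a \<in> T1 \<and> b \<in> T1"
    and cone: "\<And>x a i e. x \<in> Pb \<Longrightarrow> a \<in> Pb \<Longrightarrow> x + smul i n1 = a + smul e n2 \<Longrightarrow> \<exists>y. x = y + smul e n2"
begin

text \<open>Division with remainder by q, read as a polynomial of degree e in the monomial of
  \<open>n2\<close>. Exponents of the remainder cannot be lowered by e n2 inside \<open>Pb\<close>.
  Monomials are reduced by induction on their degree, since the lower terms of q only produce
  smaller exponents.\<close>

lemma divide_by_ray_polynomial:
  fixes q b :: "'k::field sgr"
  assumes q: "keys q \<subseteq> {smul i n2 | i. i \<le> e}" "lk q (smul e n2) \<noteq> 0" and b: "b \<in> sgring Pb"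
  shows "\<exists>b' r. b = q * b' + r \<and> b' \<in> sgring Pb \<and> keys r \<subseteq> {a \<in> Pb. \<nexists>c. c \<in> Pb \<and> a = c + smul e n2}"
proof -
  let ?A = "{a \<in> Pb. \<nexists>c. c \<in> Pb \<and> a = c + smul e n2}"
  define D where "D = {q * b' + r | b' r. b' \<in> sgring Pb \<and> keys r \<subseteq> ?A}"
  have D_I: "q * b' + r \<in> D" if "b' \<in> sgring Pb" "keys r \<subseteq> ?A" for b' r using that unfolding D_def by blast
  have D0: "0 \<in> D" using D_I[of 0 0] sgring_closed[OF Pb] by simp
  have Dadd: "x + y \<in> D" if "x \<in> D" "y \<in> D" for x y
  proof -
    obtain b' r b'' r' where "x = q * b' + r" "y = q * b'' + r'" "b' \<in> sgring Pb" "b'' \<in> sgring Pb"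
      "keys r \<subseteq> ?A" "keys r' \<subseteq> ?A" using \<open>x \<in> D\<close> \<open>y \<in> D\<close> unfolding D_def by blast
    moreover from this have "keys (r + r') \<subseteq> ?A" using Poly_Mapping.keys_add[of r r'] by blast
    ultimately have "q * (b' + b'') + (r + r') \<in> D" using D_I sgring_closed(4)[OF Pb] by blast
    then show ?thesis using \<open>x = _\<close> \<open>y = _\<close> by (simp add: algebra_simps)
  qed
  have Dmon: "Poly_Mapping.single a c \<in> D" if "a \<in> Pb" for a c
    using that
  proof (induction "size1 a" arbitrary: a c rule: less_induct)
    case less
    show ?case
    proof (cases "a \<in> ?A")
      case True
      then have "q * 0 + Poly_Mapping.single a c \<in> D" by (intro D_I) (auto simp: sgring_closed[OF Pb])
      then show ?thesis by simp
    next
      case False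
      then obtain y where y: "y \<in> Pb" "a = y + smul e n2" using less.prems by blast
      \<comment> \<open>The quotient term: the top term of q times u is the monomial at a with
        coefficient c, and the other products sit at y + i n2 with i < e.\<close>
      define u where "u = Poly_Mapping.single y (c / lk q (smul e n2))"
      have lku: "lk (q * u) (k + y) = lk q k * (c / lk q (smul e n2))" for k
        using lookup_mon_times[of y "c / lk q (smul e n2)" q k] by (simp add: u_def mult.commute add.commute)
      have rest: "- (q * u) + Poly_Mapping.single a c = (\<Sum>k\<in>keys (- (q * u) + Poly_Mapping.single a c).
          Poly_Mapping.single k (lk (- (q * u) + Poly_Mapping.single a c) k))" by (rule sum_monomials)
      have "Poly_Mapping.single k d \<in> D" if k: "k \<in> keys (- (q * u) + Poly_Mapping.single a c)" for k d
      proof -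
        have "lk (- (q * u) + Poly_Mapping.single a c) a = 0"
          using lku[of "smul e n2"] q(2) y(2) by (simp add: lookup_minus add.commute)
        then have ka: "k \<noteq> a" using k by (auto simp: in_keys_iff)
        then have "k \<in> keys (q * u)" using k by (auto simp: in_keys_iff lookup_minus lookup_single when_def split: if_splits)
        then obtain s where s: "s \<in> keys q" "k = s + y" unfolding u_def by (auto elim!: keys_timesD split: if_splits)
        then obtain i where i: "i \<le> e" "s = smul i n2" using q(1) by blast
        then have "i < e" using ka s y(2) by (metis add.commute order_le_less)
        then have "size1 k < size1 a" using s i y size1_pos[OF n2(2)] by simp
        moreover have "k \<in> Pb" using s i y submonoid_add[OF Pb] submonoid_smul[OF Pb P_Pb[OF n2(1)]] by simp
        ultimately show ?thesis using less.hyps by blast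
      qed
      then have "- (q * u) + Poly_Mapping.single a c \<in> D" by (subst rest) (intro ideal_sum_closed D0 Dadd)
      moreover have "q * u + 0 \<in> D" using y by (intro D_I) (auto simp: u_def single_in_sgring)
      ultimately have "(- (q * u) + Poly_Mapping.single a c) + (q * u + 0) \<in> D" by (rule Dadd)
      then show ?thesis by simp
    qed
  qed
  have "b \<in> D"
    by (subst sum_monomials[of b]) (use b Dmon in \<open>auto simp: sgring_def intro!: ideal_sum_closed D0 Dadd\<close>)
  then show ?thesis unfolding D_def by blast
qed

lemma ray_poly_top:
  fixes q :: "'k::field sgr"
  assumes "keys q \<subseteq> range (\<lambda>i. smul i n)" "q \<noteq> 0" "n \<noteq> 0"
  obtains e where "keys q \<subseteq> {smul i n | i. i \<le> e}" "lk q (smul e n) \<noteq> 0"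
proof -
  have inj: "inj (\<lambda>i. smul i n)" using assms(3) by (auto simp: inj_def smul_def prod_eq_iff)
  let ?I = "{i. smul i n \<in> keys q}"
  have "finite ?I" using finite_vimageI[OF _ inj, of "keys q"] by (simp add: vimage_def)
  moreover have "?I \<noteq> {}" using assms(1,2) nz_keys[of q] by blast
  ultimately have mx: "Max ?I \<in> ?I" "\<And>i. i \<in> ?I \<Longrightarrow> i \<le> Max ?I" using Max_in[of ?I] Max_ge[of ?I] by blast+
  have "keys q \<subseteq> {smul i n | i. i \<le> Max ?I}"
  proof
    fix a assume a: "a \<in> keys q"
    then obtain i where i: "a = smul i n" using assms(1) by blast
    then have "i \<le> Max ?I" using mx(2) a by simp
    then show "a \<in> {smul i n | i. i \<le> Max ?I}" using i by blast
  qed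
  moreover have "lk q (smul (Max ?I) n) \<noteq> 0" using mx(1) unfolding mem_Collect_eq in_keys_iff .
  ultimately show thesis by (rule that)
qed

text \<open>This is the regularity of p, q on k[Pb]. Division leaves p r = q d with a remainder r.
  If d is nonzero, a term of maximal degree survives in q d and hence occurs in p r, at x + i n1 for
  some exponent x of r. By \<open>cone\<close> and \<open>grid\<close>, x is y + e n2 with y in
  \<open>Pb\<close>, which a remainder excludes.\<close>

lemma ray_regular:
  fixes p q b c :: "'k::field sgr"
  assumes cm: "\<And>a. a + n1 \<in> Pb \<Longrightarrow> a + n2 \<in> Pb \<Longrightarrow> a \<in> Pb"
    and p: "keys p \<subseteq> range (\<lambda>i. smul i n1)" "p \<noteq> 0" and q: "keys q \<subseteq> range (\<lambda>i. smul i n2)" "q \<noteq> 0"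
    and bc: "b \<in> sgring Pb" "c \<in> sgring Pb" "p * b = q * c"
  obtains b' where "b' \<in> sgring Pb" "b = q * b'"
proof -
  obtain e where e: "keys q \<subseteq> {smul i n2 | i. i \<le> e}" "lk q (smul e n2) \<noteq> 0"
    using ray_poly_top[OF q n2(2)] by blast
  obtain b' r where b': "b = q * b' + r" "b' \<in> sgring Pb" and r: "keys r \<subseteq> {a \<in> Pb. \<nexists>c. c \<in> Pb \<and> a = c + smul e n2}"
    using divide_by_ray_polynomial[OF e bc(1)] by blast
  define d where "d = c - p * b'"
  have pU: "p \<in> sgring Pb" using p(1) submonoid_smul[OF Pb P_Pb[OF n1(1)]] by (auto simp: sgring_def)
  have "c + - (p * b') \<in> sgring Pb" using pU b' bc by (intro sgring_closed[OF Pb])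
  then have dU: "d \<in> sgring Pb" by (simp add: d_def)
  have eq: "p * r = q * d" using bc(3) b'(1) by (simp add: d_def algebra_simps)
  have "d = 0"
  proof (rule ccontr)
    assume "d \<noteq> 0"
    then have ne: "size1 ` keys d \<noteq> {}" "finite (size1 ` keys d)" using nz_keys by auto
    then have "Max (size1 ` keys d) \<in> size1 ` keys d" by (rule Max_in[rotated])
    then obtain a where a: "a \<in> keys d" "size1 a = Max (size1 ` keys d)" by auto
    have mx: "size1 a' \<le> size1 a" if "a' \<in> keys d" for a' using that ne a by auto
    \<comment> \<open>Since a has maximal degree in d and \<open>n2\<close> has positive degree,
      only the top term of q can contribute here.\<close>
    have "lk (q * d) (smul e n2 + a) = lk q (smul e n2) * lk d a"
    proof (rule lookup_times_unique)
      fix s a' assume s: "s \<in> keys q" "a' \<in> keys d" and sum: "s + a' = smul e n2 + a"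
      obtain i where i: "i \<le> e" "s = smul i n2" using s e by blast
      have "size1 s + size1 a' = e * size1 n2 + size1 a" using arg_cong[OF sum, of size1] by simp
      then have "i * size1 n2 + size1 a' = e * size1 n2 + size1 a" using i(2) by simp
      then have "e * size1 n2 \<le> i * size1 n2" using mx[OF s(2)] by linarith
      then have "e \<le> i" using size1_pos[OF n2(2)] by simp
      then show "s = smul e n2 \<and> a' = a" using i sum by (auto simp: prod_eq_iff)
    qed
    then have "smul e n2 + a \<in> keys (p * r)" using a(1) e(2) eq by (simp add: in_keys_iff)
    then obtain s x where x: "s \<in> keys p" "x \<in> keys r" "smul e n2 + a = s + x" by (rule keys_timesD)
    then obtain i where i: "s = smul i n1" using p(1) by blast
    have aPb: "a \<in> Pb" using a(1) dU by (auto simp: sgring_def)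
    have xPb: "x \<in> Pb" using x(2) r by blast
    have xe: "x + smul i n1 = a + smul e n2" using x(3) i by (simp add: add.commute)
    then obtain y where y: "x = y + smul e n2" using cone[OF xPb aPb] by blast
    have "y + smul i n1 = a" using xe y by (auto simp: prod_eq_iff)
    then have "y \<in> Pb" using grid[OF P_Pb[OF n1(1)] P_Pb[OF n2(1)] cm, of y i e] aPb xPb y by simp
    then show False using x(2) r y by blast
  qed
  then have "p * r = 0" using eq by simp
  then have "r = 0" using p(2) sgr_no_zero_divisors[of p r] by auto
  then show thesis using b' by (intro that[of b']) auto
qed

end

section \<open>Cancellation, and polynomials supported on a ray\<close>

lemma sgr_cancel: "z \<noteq> 0 \<Longrightarrow> z * x = z * y \<Longrightarrow> x = (y :: 'k::field sgr)"
  using sgr_no_zero_divisors[of z "x - y"] by (auto simp: algebra_simps)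

lemma lookup_times_zero: "lk (f * g) 0 = lk f 0 * lk (g :: 'k::field sgr) 0"
  using lookup_times_unique[of f g 0 0] by (simp add: prod_eq_iff)

lemma mon_power: "Poly_Mapping.single a c ^ k = Poly_Mapping.single (smul k a) (c ^ k :: 'k::field)"
  by (induction k) (auto simp: mult_single smul_Suc)

lemma smul_inj: "a \<noteq> 0 \<Longrightarrow> smul i a = smul j a \<longleftrightarrow> i = j"
  by (auto simp: smul_def prod_eq_iff)

text \<open>Different powers of the monomial have different exponents because a is nonzero, so no
  coefficients merge.\<close>

lemma ray_poly_sum:
  fixes c :: "nat \<Rightarrow> 'k::field"
  assumes "a \<noteq> 0"
  shows "keys (\<Sum>l<n. mon a ^ l * cst (c l)) \<subseteq> range (\<lambda>i. smul i a)"
    and "k < n \<Longrightarrow> lk (\<Sum>l<n. mon a ^ l * cst (c l)) (smul k a) = c k"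
proof -
  have eq: "(\<Sum>l<n. mon a ^ l * cst (c l)) = (\<Sum>l<n. Poly_Mapping.single (smul l a) (c l))"
    by (simp add: mon_power mult_single)
  show "keys (\<Sum>l<n. mon a ^ l * cst (c l)) \<subseteq> range (\<lambda>i. smul i a)"
  proof
    fix x assume "x \<in> keys (\<Sum>l<n. mon a ^ l * cst (c l))"
    then have "(\<Sum>l<n. lk (Poly_Mapping.single (smul l a) (c l)) x) \<noteq> 0" unfolding eq by (simp add: in_keys_iff lookup_sum)
    then obtain l where "lk (Poly_Mapping.single (smul l a) (c l)) x \<noteq> 0" by (meson sum.neutral)
    then have "x = smul l a" by (auto simp: lookup_single when_def split: if_splits)
    then show "x \<in> range (\<lambda>i. smul i a)" by simp
  qed
  assume "k < n"
  have "lk (\<Sum>l<n. mon a ^ l * cst (c l)) (smul k a) = (\<Sum>l<n. if l = k then c l else 0)"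
    unfolding eq lookup_sum by (rule sum.cong) (auto simp: lookup_single when_def smul_inj[OF assms])
  then show "lk (\<Sum>l<n. mon a ^ l * cst (c l)) (smul k a) = c k" using \<open>k < n\<close> by simp
qed

lemma ray_poly_power:
  fixes f :: "'k::field sgr"
  assumes "keys f \<subseteq> range (\<lambda>i. smul i a)" shows "keys (f ^ n) \<subseteq> range (\<lambda>i. smul i a)"
proof (induction n)
  case 0
  have "keys (f ^ 0) = {0}" by simp
  also have "\<dots> \<subseteq> range (\<lambda>i. smul i a)" by (auto intro: image_eqI[of _ _ 0])
  finally show ?case .
next
  case (Suc n)
  show ?case
  proof
    fix x assume "x \<in> keys (f ^ Suc n)"
    then have "x \<in> keys (f * f ^ n)" by simp
    then obtain b c where bc: "b \<in> keys f" "c \<in> keys (f ^ n)" "x = b + c" by (rule keys_timesD)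
    then obtain i j where "b = smul i a" "c = smul j a" using assms Suc by blast
    then have "x = smul (i + j) a" using bc(3) by (simp add: smul_add)
    then show "x \<in> range (\<lambda>i. smul i a)" by simp
  qed
qed

lemma sgr_power_nz: "f \<noteq> 0 \<Longrightarrow> (f :: 'k::field sgr) ^ n \<noteq> 0"
proof (induction n)
  case (Suc n) then show ?case using sgr_no_zero_divisors[of f "f ^ n"] by simp
qed simp

lemma lexmax_exists: "finite Y \<Longrightarrow> Y \<noteq> {} \<Longrightarrow> \<exists>a\<in>Y. \<forall>b\<in>Y. lexle b a"
proof (induction Y rule: finite_ne_induct)
  case (singleton x)
  show ?case by (simp add: lexle_def)
next
  case (insert x F)
  then obtain a where a: "a \<in> F" "\<forall>b\<in>F. lexle b a" by blast
  show ?case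
  proof (cases "lexle x a")
    case True then show ?thesis using a by (intro bexI[of _ a]) auto
  next
    case False
    have "\<forall>b\<in>F. lexle b x"
    proof
      fix b assume "b \<in> F"
      then have "lexle b a" using a by blast
      then show "lexle b x" using False by (auto simp: lexle_def)
    qed
    then show ?thesis by (intro bexI[of _ x]) (auto simp: lexle_def)
  qed
qed

section \<open>Maximal ideals of k[P] and the Buchsbaum condition at each of them\<close>

context simplicial_pair
begin

text \<open>The irrelevant maximal ideal, the kernel of the map to the constant coefficient.\<close>

definition M0 :: "'k::field sgr set" where "M0 = {f \<in> sgring P. lk f 0 = 0}"

abbreviation RP :: "'k::field sgr ring" where "RP \<equiv> type_domain.R (sgring P)"

lemma dom: "type_domain (sgring P :: 'k::field sgr set)" by (rule type_domain_sgring[OF P])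

lemma M0_ideal: "ideal M0 (RP :: 'k::field sgr ring)"
  unfolding type_domain.ideal_R_iff[OF dom]
proof (intro conjI ballI)
  show "M0 \<subseteq> sgring P" by (auto simp: M0_def)
  show "0 \<in> M0" by (simp add: M0_def sgring_closed[OF P])
  show "x + y \<in> M0" if "x \<in> M0" "y \<in> M0" for x y :: "'k sgr"
    using that by (simp add: M0_def sgring_closed[OF P] lookup_add)
  show "r * x \<in> M0" if "x \<in> M0" "r \<in> sgring P" for x r :: "'k sgr"
    using that by (simp add: M0_def sgring_closed[OF P] lookup_times_zero)
qed

lemma M0_maximal: "maximalideal M0 (RP :: 'k::field sgr ring)"
proof (rule maximalidealI)
  interpret type_domain "sgring P :: 'k sgr set" by (rule dom)
  show "ideal M0 R" by (rule M0_ideal)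
  have "1 \<notin> (M0 :: 'k sgr set)" by (simp add: M0_def)
  then show "carrier R \<noteq> M0" using one_closed by auto
  fix J assume J: "ideal J R" "M0 \<subseteq> J" "J \<subseteq> carrier R"
  have Jc: "\<And>x y. x \<in> J \<Longrightarrow> y \<in> J \<Longrightarrow> x + y \<in> J" "\<And>x r. x \<in> J \<Longrightarrow> r \<in> sgring P \<Longrightarrow> r * x \<in> J"
    using J(1)[unfolded ideal_R_iff] by simp_all
  show "J = M0 \<or> J = carrier R"
  proof (cases "J \<subseteq> M0")
    case False
    then obtain j where j: "j \<in> J" "j \<notin> M0" by blast
    then have jU: "j \<in> sgring P" using J(3) by auto
    then have c: "lk j 0 \<noteq> 0" using j(2) by (simp add: M0_def)
    have "cst (lk j 0) - j \<in> M0"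
      unfolding M0_def using minus_closed[OF sgring_closed(1)[OF P] jU] by (simp add: lookup_minus)
    then have "cst (lk j 0) - j \<in> J" using J(2) by (rule rev_subsetD)
    then have "(cst (lk j 0) - j) + j \<in> J" by (rule Jc(1)[OF _ j(1)])
    then have "cst (lk j 0) \<in> J" by simp
    then have "cst (inverse (lk j 0)) * cst (lk j 0) \<in> J" by (rule Jc(2)[OF _ sgring_closed(1)[OF P]])
    moreover have "cst (inverse (lk j 0)) * cst (lk j 0) = 1" using c by (simp add: mult_single)
    ultimately have one: "1 \<in> J" by metis
    have "sgring P \<subseteq> J"
    proof
      fix x :: "'k sgr" assume "x \<in> sgring P"
      then have "x * 1 \<in> J" by (rule Jc(2)[OF one])
      then show "x \<in> J" unfolding mult_1_right .
    qed
    then show ?thesis using J(3) by simp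
  next
    case True
    then show ?thesis using J(2) by (intro disjI1 subset_antisym)
  qed
qed

lemma M0_times_bar:
  fixes f g :: "'k::field sgr"
  assumes "f \<in> M0" "g \<in> sgring Pb" shows "f * g \<in> sgring P"
  unfolding sgring_def
proof (intro CollectI subsetI)
  fix k assume "k \<in> keys (f * g)"
  then obtain a b where k: "a \<in> keys f" "b \<in> keys g" "k = a + b" by (rule keys_timesD)
  then have "a \<in> P" "b \<in> Pb" using assms by (auto simp: sgring_def M0_def)
  moreover have "a \<noteq> 0" using k(1) assms(1) by (auto simp: M0_def in_keys_iff)
  ultimately have "b + a \<in> P" using Pb_add_P by simp
  then show "k \<in> P" using k(3) by (simp add: add.commute)
qed

lemma P_sub_bar: "f \<in> sgring P \<Longrightarrow> f \<in> sgring Pb"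
  using P_Pb by (auto simp: sgring_def)

text \<open>Such a w becomes a unit after localizing at M, while w k[Pb] lies in k[P]. Hence k[P]
  and k[Pb] have the same localization at M.\<close>

lemma escape:
  fixes M :: "'k::field sgr set"
  assumes "maximalideal M RP" "M \<noteq> M0"
  obtains w where "w \<in> M0" "w \<notin> M"
proof -
  interpret M: maximalideal M RP by (rule assms)
  interpret M0: maximalideal "M0 :: 'k sgr set" RP by (rule M0_maximal)
  have "\<not> M0 \<subseteq> M" using M0.I_maximal[OF M.ideal_axioms _ M.a_subset] assms(2) M.I_notcarr by metis
  then show thesis using that by blast
qed

text \<open>At \<open>M0\<close> the square of f b is f (f b^2) with f b^2 in k[P], so it lies in M,
  and M is prime. Elsewhere an escaping w gives w (f b) = (w b) f in M.\<close>

lemma bar_product_in_maximal: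
  fixes M :: "'k::field sgr set"
  assumes M: "maximalideal M RP" "primeideal M RP" and f: "f \<in> M" and b: "b \<in> sgring Pb" and fb: "f * b \<in> sgring P"
  shows "f * b \<in> M"
proof -
  note M_f = type_domain.prime_facts[OF dom M(2)]
  have fU: "f \<in> sgring P" using M_f(1) f by (rule subsetD)
  show ?thesis
  proof (cases "M = M0")
    case True
    have "b * b \<in> sgring Pb" by (rule sgring_closed(5)[OF Pb b b])
    then have "f * (b * b) \<in> sgring P" using M0_times_bar f True by blast
    then have "f * (b * b) * f \<in> M" by (rule M_f(4)[OF f])
    then have "(f * b) * (f * b) \<in> M" by (simp add: ac_simps)
    then show ?thesis using M_f(6)[OF fb fb] by blast
  next
    case False
    then obtain w where w: "w \<in> M0" "w \<notin> M" using escape[OF M(1)] by blast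
    have wU: "w \<in> sgring P" using w(1) by (simp add: M0_def)
    have "w * b \<in> sgring P" using M0_times_bar[OF w(1) b] .
    then have "(w * b) * f \<in> M" by (rule M_f(4)[OF f])
    then have "w * (f * b) \<in> M" by (simp add: ac_simps)
    then show ?thesis using M_f(6)[OF wU fb] w(2) by blast
  qed
qed

text \<open>M contains nonzero polynomials g and f in the two ray monomials, and powers of them are
  combinations of \<open>f1\<close> and \<open>f2\<close> up to denominators. From s r f2 = t f1 one
  gets f^n r1 = f1 B1 and g^n' r1 = f1 B2, hence g^n' B1 = f^n B2. Regularity on k[Pb] gives B1 =
  f^n b' and so r1 = f1 b' with b' in k[Pb].\<close>

lemma weak_numerators:
  fixes M :: "'k::field sgr set"
  assumes cm: "\<forall>a. a + n1 \<in> Pb \<longrightarrow> a + n2 \<in> Pb \<longrightarrow> a \<in> Pb"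
    and M: "maximalideal M RP" "primeideal M RP"
    and q: "primeideal q0 RP" "primeideal q1 RP" "primeideal q2 RP" "q0 \<subset> q1" "q1 \<subset> q2" "q2 \<subseteq> M"
    and f12: "f1 \<in> M" "f2 \<in> M"
    and rad: "\<forall>g\<in>M. \<exists>n::nat. \<exists>s. s \<in> sgring P - M \<and> (\<exists>x y. x \<in> sgring P \<and> y \<in> sgring P \<and> s * g ^ n = x * f1 + y * f2)"
  shows "f1 \<noteq> 0"
    and "r \<in> sgring P \<Longrightarrow> s \<in> sgring P - M \<Longrightarrow> t \<in> sgring P \<Longrightarrow> s * (r * f2) = t * f1 \<Longrightarrow> g' \<in> M \<Longrightarrow>
      \<exists>s'\<in>sgring P - M. \<exists>t'\<in>sgring P. s' * (g' * r) = t' * f1"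
proof -
  interpret S: sg_prime P M using P M(2) by (rule sg_prime.intro)
  note M_f = S.prime_facts[OF M(2)]
  have fU: "f1 \<in> sgring P" "f2 \<in> sgring P" using M_f(1) f12 by auto
  have SM: "x * y \<in> sgring P - M" if "x \<in> sgring P - M" "y \<in> sgring P - M" for x y
    using that by (rule S.loc.S_mult)
  have U1: "mon n1 \<in> sgring P" "mon n2 \<in> sgring P" using n1 n2 by (auto intro: single_in_sgring)
  \<comment> \<open>Modulo \<open>q2\<close> the monomial of \<open>n2\<close> is algebraic over the
    field. This produces a nonzero polynomial in it inside M even when M is not the irrelevant
    ideal.\<close>
  obtain k c where c: "\<exists>l<k. c l \<noteq> 0" "(\<Sum>l<k. mon n2 ^ l * cst (c l)) \<in> q2"
    using S.collapse2[OF q(1-5) U1(2)] by blast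
  define f where "f = (\<Sum>l<k. mon n2 ^ l * cst (c l))"
  have f: "f \<in> M" "keys f \<subseteq> range (\<lambda>i. smul i n2)"
    unfolding f_def by (rule subsetD[OF q(6) c(2)], rule ray_poly_sum(1)[OF n2(2)])
  have fnz: "f \<noteq> 0"
  proof
    assume "f = 0"
    then have "c l = 0" if "l < k" for l using ray_poly_sum(2)[OF n2(2) that, of c] unfolding f_def by simp
    then show False using c(1) by blast
  qed
  obtain k' c' where c': "\<exists>l<k'. c' l \<noteq> 0" "(\<Sum>l<k'. mon n1 ^ l * cst (c' l)) \<in> q2"
    using S.collapse2[OF q(1-5) U1(1)] by blast
  define g where "g = (\<Sum>l<k'. mon n1 ^ l * cst (c' l))"
  have g: "g \<in> M" "keys g \<subseteq> range (\<lambda>i. smul i n1)"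
    unfolding g_def by (rule subsetD[OF q(6) c'(2)], rule ray_poly_sum(1)[OF n1(2)])
  have gnz: "g \<noteq> 0"
  proof
    assume "g = 0"
    then have "c' l = 0" if "l < k'" for l using ray_poly_sum(2)[OF n1(2) that, of c'] unfolding g_def by simp
    then show False using c'(1) by blast
  qed
  obtain n \<sigma>1 a1 b1 where F: "\<sigma>1 \<in> sgring P - M" "a1 \<in> sgring P" "b1 \<in> sgring P" "\<sigma>1 * f ^ n = a1 * f1 + b1 * f2"
    using bspec[OF rad f(1)] by (elim exE conjE)
  obtain n' \<sigma>2 a2 b2 where G: "\<sigma>2 \<in> sgring P - M" "a2 \<in> sgring P" "b2 \<in> sgring P" "\<sigma>2 * g ^ n' = a2 * f1 + b2 * f2"
    using bspec[OF rad g(1)] by (elim exE conjE)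
  have \<sigma>U: "\<sigma>1 \<in> sgring P" "\<sigma>2 \<in> sgring P" using F(1) G(1) by auto
  have fn: "f ^ n \<noteq> 0" "g ^ n' \<noteq> 0" using sgr_power_nz fnz gnz by auto
  have reg: "\<exists>b'. b' \<in> sgring Pb \<and> b = f ^ n * b'" if "b \<in> sgring P" "d \<in> sgring P" "g ^ n' * b = f ^ n * d" for b d
  proof -
    have bd: "b \<in> sgring Pb" "d \<in> sgring Pb" using that(1,2) by (auto intro: P_sub_bar)
    show ?thesis
      by (rule ray_regular[OF cm[rule_format] ray_poly_power[OF g(2)] fn(2) ray_poly_power[OF f(2)] fn(1) bd that(3)]) blast+
  qed
  \<comment> \<open>If \<open>f1\<close> were zero, the same argument would write the denominator
    \<open>\<sigma>2 * \<sigma>1\<close> as f2 b', which lies in M.\<close>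
  show nz: "f1 \<noteq> 0"
  proof
    assume "f1 = 0"
    then have F': "\<sigma>1 * f ^ n = b1 * f2" and G': "\<sigma>2 * g ^ n' = b2 * f2" using F(4) G(4) by simp_all
    have "g ^ n' * (\<sigma>2 * b1) = (\<sigma>2 * g ^ n') * b1" by (simp only: ac_simps)
    also have "\<dots> = (b1 * f2) * b2" unfolding G' by (simp only: ac_simps)
    also have "\<dots> = f ^ n * (\<sigma>1 * b2)" unfolding F'[symmetric] by (simp only: ac_simps)
    finally obtain b' where b': "b' \<in> sgring Pb" "\<sigma>2 * b1 = f ^ n * b'"
      using reg[of "\<sigma>2 * b1" "\<sigma>1 * b2"] S.mult_closed \<sigma>U F G by blast
    have "f ^ n * (\<sigma>2 * \<sigma>1) = \<sigma>2 * (\<sigma>1 * f ^ n)" by (simp only: ac_simps)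
    also have "\<dots> = (\<sigma>2 * b1) * f2" unfolding F' by (simp only: ac_simps)
    also have "\<dots> = f ^ n * (f2 * b')" unfolding b'(2) by (simp only: ac_simps)
    finally have e: "\<sigma>2 * \<sigma>1 = f2 * b'" by (rule sgr_cancel[OF fn(1)])
    have s: "\<sigma>2 * \<sigma>1 \<in> sgring P - M" by (rule SM[OF G(1) F(1)])
    have "f2 * b' \<in> M" using bar_product_in_maximal[OF M f12(2) b'(1)] s unfolding e by blast
    then show False using s unfolding e by blast
  qed
  assume r: "r \<in> sgring P" and s: "s \<in> sgring P - M" and t: "t \<in> sgring P" and eq: "s * (r * f2) = t * f1" and g': "g' \<in> M"
  have sU: "s \<in> sgring P" using s by blast
  have g'U: "g' \<in> sgring P" using M_f(1) g' by (rule subsetD)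
  \<comment> \<open>r times all denominators, so that the following equations hold in k[P]
    itself.\<close>
  define r1 where "r1 = \<sigma>1 * \<sigma>2 * s * r"
  define B1 where "B1 = \<sigma>2 * (a1 * s * r + b1 * t)"
  define B2 where "B2 = \<sigma>1 * (a2 * s * r + b2 * t)"
  have BU: "B1 \<in> sgring P" "B2 \<in> sgring P"
    unfolding B1_def B2_def by (intro S.mult_closed S.add_closed \<sigma>U F G sU r t)+
  have "f ^ n * r1 = (\<sigma>1 * f ^ n) * \<sigma>2 * s * r" unfolding r1_def by (simp only: ac_simps)
  also have "\<dots> = \<sigma>2 * (a1 * s * r * f1 + b1 * (s * (r * f2)))" unfolding F(4) by (simp only: algebra_simps)
  also have "\<dots> = f1 * B1" unfolding eq B1_def by (simp only: algebra_simps)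
  finally have E1: "f ^ n * r1 = f1 * B1" .
  have "g ^ n' * r1 = (\<sigma>2 * g ^ n') * \<sigma>1 * s * r" unfolding r1_def by (simp only: ac_simps)
  also have "\<dots> = \<sigma>1 * (a2 * s * r * f1 + b2 * (s * (r * f2)))" unfolding G(4) by (simp only: algebra_simps)
  also have "\<dots> = f1 * B2" unfolding eq B2_def by (simp only: algebra_simps)
  finally have E2: "g ^ n' * r1 = f1 * B2" .
  have "f1 * (g ^ n' * B1) = g ^ n' * (f1 * B1)" by (simp only: ac_simps)
  also have "\<dots> = f ^ n * (g ^ n' * r1)" unfolding E1[symmetric] by (simp only: ac_simps)
  also have "\<dots> = f1 * (f ^ n * B2)" unfolding E2 by (simp only: ac_simps)
  finally have "g ^ n' * B1 = f ^ n * B2" by (rule sgr_cancel[OF nz])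
  then obtain b' where b': "b' \<in> sgring Pb" "B1 = f ^ n * b'" using reg[OF BU] by blast
  have "f ^ n * r1 = f ^ n * (f1 * b')" unfolding E1 b'(2) by (simp only: ac_simps)
  then have r1: "r1 = f1 * b'" by (rule sgr_cancel[OF fn(1)])
  have SS: "\<sigma>1 * \<sigma>2 * s \<in> sgring P - M" by (intro SM F(1) G(1) s)
  show "\<exists>s'\<in>sgring P - M. \<exists>t'\<in>sgring P. s' * (g' * r) = t' * f1"
  \<comment> \<open>So far b' is only in k[Pb]. The factor \<open>g'\<close> at \<open>M0\<close>,
    or an escaping w elsewhere, brings it back into k[P].\<close>
  proof (cases "M = M0")
    case True
    then have "g' * b' \<in> sgring P" using M0_times_bar[OF _ b'(1)] g' by blast
    moreover have "(\<sigma>1 * \<sigma>2 * s) * (g' * r) = g' * r1" unfolding r1_def by (simp only: ac_simps)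
    then have "(\<sigma>1 * \<sigma>2 * s) * (g' * r) = (g' * b') * f1" unfolding r1 by (simp only: ac_simps)
    ultimately show ?thesis using SS by (intro bexI)
  next
    case False
    then obtain w where w: "w \<in> M0" "w \<notin> M" using escape[OF M(1)] by blast
    then have wS: "w \<in> sgring P - M" by (simp add: M0_def)
    have "g' * (w * b') \<in> sgring P" by (rule S.mult_closed[OF g'U M0_times_bar[OF w(1) b'(1)]])
    moreover have "(w * (\<sigma>1 * \<sigma>2 * s)) * (g' * r) = g' * (w * r1)" unfolding r1_def by (simp only: ac_simps)
    then have "(w * (\<sigma>1 * \<sigma>2 * s)) * (g' * r) = (g' * (w * b')) * f1" unfolding r1 by (simp only: ac_simps)
    moreover have "w * (\<sigma>1 * \<sigma>2 * s) \<in> sgring P - M" by (rule SM[OF wS SS])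
    ultimately show ?thesis by (intro bexI)
  qed
qed

text \<open>The dimension bound leaves systems of zero, one or two parameters. The condition at the
  first parameter follows from its being nonzero in a domain; the one at the second is
  \<open>weak_numerators\<close>.\<close>

lemma local_buchsbaum:
  fixes M :: "'k::field sgr set"
  assumes cm: "\<forall>a. a + n1 \<in> Pb \<longrightarrow> a + n2 \<in> Pb \<longrightarrow> a \<in> Pb"
    and M: "maximalideal M RP" "primeideal M RP" and noeth: "noetherian_ring (RP :: 'k sgr ring)"
  shows "buchsbaum_local_ring (localization RP (carrier RP - M))"
proof -
  interpret S: sg_prime P M using P M(2) by (rule sg_prime.intro)
  note M_f = S.prime_facts[OF M(2)]
  have L: "localization RP (carrier RP - M) = S.L" by (simp add: S.loc.L_def)
  have m_elem: "\<exists>f s. f \<in> M \<and> s \<in> sgring P - M \<and> x = S.loc.fr f s" if "x \<in> S.m" for x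
    using that unfolding S.loc.extn_def by blast
  have first: "y \<otimes>\<^bsub>S.L\<^esub> a \<in> Idl\<^bsub>S.L\<^esub> {}"
    if H: "f1 \<noteq> 0" "f1 \<in> M" "s1 \<in> sgring P - M" "a \<in> carrier S.L" "a \<otimes>\<^bsub>S.L\<^esub> S.loc.fr f1 s1 \<in> Idl\<^bsub>S.L\<^esub> {}" "y \<in> S.m" for f1 s1 a y
  proof -
    obtain r s where rs: "r \<in> sgring P" "s \<in> sgring P - M" "a = S.loc.fr r s" using H(4) by (rule S.loc.L_cases)
    have f1U: "f1 \<in> sgring P" using M_f(1) H(2) by (rule subsetD)
    have "S.loc.fr (r * f1) (s * s1) = \<zero>\<^bsub>S.L\<^esub>"
      using H(5) unfolding rs(3) S.loc.L_mult[OF rs(1,2) f1U H(3)] S.loc.Idl_empty by simp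
    then have "r * f1 = 0"
      using S.loc.fr_eq_zero[OF S.mult_closed[OF rs(1) f1U] S.loc.S_mult[OF rs(2) H(3)]] by simp
    then have "r = 0" using sgr_no_zero_divisors[of r f1] H(1) by metis
    then have "a = \<zero>\<^bsub>S.L\<^esub>" using S.loc.fr_eq_zero[OF rs(1,2)] rs(3) by simp
    moreover have "y \<in> carrier S.L"
    proof -
      obtain h t where h: "h \<in> M" "t \<in> sgring P - M" "y = S.loc.fr h t" using m_elem[OF H(6)] by blast
      have "h \<in> sgring P" using M_f(1) h(1) by (rule subsetD)
      then show ?thesis unfolding h(3) by (rule S.loc.fr_in_L[OF _ h(2)])
    qed
    ultimately show ?thesis by (simp add: S.loc.Idl_empty)
  qed
  have main: "weak_sequence S.L S.m xs" if sop: "system_of_parameters S.L S.m xs" for xs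
  proof -
    have len: "enat (length xs) = krull_dim S.L" and sub: "set xs \<subseteq> S.m"
      and rad: "\<And>y. y \<in> S.m \<Longrightarrow> \<exists>n::nat. y [^]\<^bsub>S.L\<^esub> n \<in> Idl\<^bsub>S.L\<^esub> (set xs)"
      using sop unfolding system_of_parameters_def by auto
    have "enat (length xs) \<le> 2" using len S.krull_dim_le2 by simp
    then have "length xs \<le> 2" by (simp add: numeral_eq_enat)
    then consider "xs = []" | x1 where "xs = [x1]" | x1 x2 where "xs = [x1, x2]"
      by (cases xs; cases "tl xs"; cases "tl (tl xs)") auto
    then show ?thesis
    proof cases
      case 1 then show ?thesis by (simp add: weak_sequence_def)
    next
      case 2
      obtain f1 s1 where f1: "f1 \<in> M" "s1 \<in> sgring P - M" "x1 = S.loc.fr f1 s1" using m_elem[of x1] sub 2 by auto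
      have f1U: "f1 \<in> sgring P" using M_f(1) f1(1) by (rule subsetD)
      have "enat (Suc 0) \<le> krull_dim S.L" using len 2 by simp
      then have "S.chain (Suc 0)" by (rule S.krull_dim_ge_imp_chain)
      then obtain p where p: "\<forall>i\<le>Suc 0. primeideal (p i) S.L" "\<forall>i<Suc 0. p i \<subset> p (Suc i)" unfolding S.chain_def by blast
      \<comment> \<open>If the single parameter were zero, every element of the maximal ideal would
        be nilpotent, hence zero, against the chain of length one.\<close>
      have "f1 \<noteq> 0"
      proof
        assume f10: "f1 = 0"
        have p01: "p 0 \<subset> p 1" using p(2) by simp
        then obtain y where y: "y \<in> p 1" "y \<notin> p 0" by blast
        interpret p0: primeideal "p 0" S.L using p(1) by simp
        interpret p1: primeideal "p 1" S.L using p(1) by simp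
        have "p 1 \<subseteq> S.m" using S.ideal_sub_m[OF p1.ideal_axioms] p1.I_notcarr by metis
        then have ym: "y \<in> S.m" using y(1) by blast
        obtain h t where h: "h \<in> M" "t \<in> sgring P - M" "y = S.loc.fr h t" using m_elem[OF ym] by blast
        have hU: "h \<in> sgring P" using M_f(1) h(1) by (rule subsetD)
        obtain n where "y [^]\<^bsub>S.L\<^esub> (n::nat) \<in> Idl\<^bsub>S.L\<^esub> {x1}" using rad[OF ym] 2 by auto
        then have "S.loc.fr (h ^ n) (t ^ n) \<in> Idl\<^bsub>S.L\<^esub> {S.loc.fr f1 s1}"
          unfolding h(3) f1(3) S.loc.L_pow[OF hU h(2)] .
        then obtain u b where "u \<in> sgring P - M" "u * h ^ n = b * f1"
          using S.loc.Idl_single[OF f1U f1(2) S.power_closed[OF hU] S.loc.S_pow[OF h(2)]] by blast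
        then have "u * h ^ n = 0" "u \<noteq> 0" using f10 S.loc.S_nz by auto
        then have "h = 0" using sgr_no_zero_divisors[of u "h ^ n"] sgr_power_nz[of h n] by metis
        then have "y = \<zero>\<^bsub>S.L\<^esub>" using S.loc.fr_eq_zero[OF hU h(2)] h(3) by simp
        then show False using y(2) p0.zero_closed by simp
      qed
      then show ?thesis using first[OF _ f1(1,2)] 2 f1(3) by (simp add: weak_sequence_def)
    next
      case 3
      obtain f1 s1 where f1: "f1 \<in> M" "s1 \<in> sgring P - M" "x1 = S.loc.fr f1 s1" using m_elem[of x1] sub 3 by auto
      obtain f2 s2 where f2: "f2 \<in> M" "s2 \<in> sgring P - M" "x2 = S.loc.fr f2 s2" using m_elem[of x2] sub 3 by auto
      have fU: "f1 \<in> sgring P" "f2 \<in> sgring P" using M_f(1) f1(1) f2(1) by auto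
      have "enat (Suc 1) \<le> krull_dim S.L" using len 3 by (simp add: numeral_eq_Suc)
      then have "S.chain (Suc 1)" by (rule S.krull_dim_ge_imp_chain)
      then obtain p where p: "\<forall>i\<le>Suc 1. primeideal (p i) S.L" "\<forall>i<Suc 1. p i \<subset> p (Suc i)" unfolding S.chain_def by blast
      note q = S.prime_chain_contr[OF p]
      let ?q = "\<lambda>i. S.loc.contr (p i)"
      have q1: "primeideal (?q 0) RP" "primeideal (?q 1) RP" "primeideal (?q (Suc 1)) RP" "?q (Suc 1) \<subseteq> M"
        using q(1)[rule_format, of 0] q(1)[rule_format, of 1] q(1)[rule_format, of "Suc 1"] by simp_all
      have q2: "?q 0 \<subset> ?q 1" "?q 1 \<subset> ?q (Suc 1)" using q(2)[rule_format, of 0] q(2)[rule_format, of 1] by simp_all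
      have radn: "\<exists>n::nat. \<exists>s. s \<in> sgring P - M \<and> (\<exists>x y. x \<in> sgring P \<and> y \<in> sgring P \<and> s * g ^ n = x * f1 + y * f2)"
        if "g \<in> M" for g
      proof -
        have gU: "g \<in> sgring P" using M_f(1) that by (rule subsetD)
        have "S.loc.fr g 1 \<in> S.m" using that S.loc.S_one unfolding S.loc.extn_def by blast
        then obtain n where "S.loc.fr g 1 [^]\<^bsub>S.L\<^esub> (n::nat) \<in> Idl\<^bsub>S.L\<^esub> {x1, x2}" using rad 3 by auto
        then have "S.loc.fr (g ^ n) (1 ^ n) \<in> Idl\<^bsub>S.L\<^esub> {S.loc.fr f1 s1, S.loc.fr f2 s2}"
          unfolding f1(3) f2(3) S.loc.L_pow[OF gU S.loc.S_one] .
        then show ?thesis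
          using S.loc.Idl_pair[OF fU(1) f1(2) fU(2) f2(2) S.power_closed[OF gU] S.loc.S_pow[OF S.loc.S_one]] by blast
      qed
      then have radn': "\<forall>g\<in>M. \<exists>n::nat. \<exists>s. s \<in> sgring P - M \<and> (\<exists>x y. x \<in> sgring P \<and> y \<in> sgring P \<and> s * g ^ n = x * f1 + y * f2)" ..
      note W = weak_numerators[OF cm M q1(1-3) q2 q1(4) f1(1) f2(1) radn']
      have second: "y \<otimes>\<^bsub>S.L\<^esub> a \<in> Idl\<^bsub>S.L\<^esub> {x1}"
        if H: "a \<in> carrier S.L" "a \<otimes>\<^bsub>S.L\<^esub> x2 \<in> Idl\<^bsub>S.L\<^esub> {x1}" "y \<in> S.m" for a y
      proof -
        obtain r s where rs: "r \<in> sgring P" "s \<in> sgring P - M" "a = S.loc.fr r s" using H(1) by (rule S.loc.L_cases)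
        obtain h t where h: "h \<in> M" "t \<in> sgring P - M" "y = S.loc.fr h t" using m_elem[OF H(3)] by blast
        have hU: "h \<in> sgring P" using M_f(1) h(1) by (rule subsetD)
        have "S.loc.fr (r * f2) (s * s2) \<in> Idl\<^bsub>S.L\<^esub> {S.loc.fr f1 s1}"
          using H(2) unfolding rs(3) f2(3) f1(3) S.loc.L_mult[OF rs(1,2) fU(2) f2(2)] .
        then obtain u b where ub: "u \<in> sgring P - M" "b \<in> sgring P" "u * (r * f2) = b * f1"
          using S.loc.Idl_single[OF fU(1) f1(2) S.mult_closed[OF rs(1) fU(2)] S.loc.S_mult[OF rs(2) f2(2)]] by blast
        have "\<exists>s'\<in>sgring P - M. \<exists>t'\<in>sgring P. s' * (h * r) = t' * f1"
          by (rule W(2)[OF rs(1) ub h(1)])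
        then have "S.loc.fr (h * r) (t * s) \<in> Idl\<^bsub>S.L\<^esub> {S.loc.fr f1 s1}"
          using S.loc.Idl_single[OF fU(1) f1(2) S.mult_closed[OF hU rs(1)] S.loc.S_mult[OF h(2) rs(2)]] by blast
        then show ?thesis unfolding rs(3) h(3) f1(3) S.loc.L_mult[OF hU h(2) rs(1,2)] .
      qed
      have nz: "f1 \<noteq> 0" by (rule W(1))
      show ?thesis unfolding weak_sequence_def
      proof (intro allI impI ballI)
        fix i a y assume i: "i < length xs" and a: "a \<in> carrier S.L" "a \<otimes>\<^bsub>S.L\<^esub> xs ! i \<in> Idl\<^bsub>S.L\<^esub> (set (take i xs))" and y: "y \<in> S.m"
        have "i = 0 \<or> i = 1" using i 3 by auto
        then show "y \<otimes>\<^bsub>S.L\<^esub> a \<in> Idl\<^bsub>S.L\<^esub> (set (take i xs))"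
          using first[OF nz f1(1,2) a(1) _ y] second[OF a(1) _ y] a(2) 3 f1(3) by auto
      qed
    qed
  qed
  show ?thesis unfolding L buchsbaum_local_ring_def
    using S.loc.cring_L S.loc.noetherian_L[OF noeth] S.m_maximal S.m_unique main by blast
qed

end

section \<open>Both directions of the criterion for the semigroup ring\<close>

context simplicial_pair
begin

lemma noeth: "noetherian_ring (RP :: 'k::field sgr ring)"
  by (rule noetherian_sgring[OF N_fin P_hull])

lemma buchsbaum_if:
  assumes cm: "\<forall>a. a + n1 \<in> Pb \<longrightarrow> a + n2 \<in> Pb \<longrightarrow> a \<in> Pb"
  shows "buchsbaum_ring (RP :: 'k::field sgr ring)"
proof -
  interpret type_domain "sgring P :: 'k sgr set" by (rule dom)
  have "buchsbaum_local_ring (localization R (carrier R - M))" if "maximalideal M R" for M :: "'k sgr set"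
    by (rule local_buchsbaum[OF cm that R.maximalideal_prime[OF that] noeth])
  then show ?thesis unfolding buchsbaum_ring_def using cring_R noeth by simp
qed

text \<open>If two factors both have exponents in \<open>T1\<close>, the sum of the
  lexicographically largest ones arises in only one way, since by \<open>face\<close> both summands
  of an exponent in \<open>T1\<close> are in \<open>T1\<close>. So the product keeps a term
  there.\<close>

lemma face_prime: "primeideal {f \<in> sgring P. \<forall>a\<in>keys f. a \<notin> T1} (RP :: 'k::field sgr ring)"
proof (rule primeidealI)
  interpret type_domain "sgring P :: 'k sgr set" by (rule dom)
  let ?q = "{f \<in> sgring P. \<forall>a\<in>keys f. a \<notin> T1} :: 'k sgr set"
  have mem: "f \<in> ?q \<longleftrightarrow> f \<in> sgring P \<and> (\<forall>a\<in>keys f. a \<notin> T1)" for f by simp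
  show "cring R" by (rule cring_R)
  show "ideal ?q R" unfolding ideal_R_iff
  proof (intro conjI ballI)
    show "?q \<subseteq> sgring P" by blast
    show "0 \<in> ?q" by simp
    fix x y assume "x \<in> ?q" "y \<in> ?q"
    then show "x + y \<in> ?q" using Poly_Mapping.keys_add[of x y] add_closed[of x y] unfolding mem by blast
  next
    fix x r :: "'k sgr" assume x: "x \<in> ?q" and r: "r \<in> sgring P"
    have "a \<notin> T1" if a: "a \<in> keys (r * x)" for a
    proof -
      obtain b c where bc: "b \<in> keys r" "c \<in> keys x" "a = b + c" using a by (rule keys_timesD)
      have "b \<in> P" "c \<in> P" "c \<notin> T1" using bc x r by (auto simp: sgring_def)
      then show ?thesis using face(4)[of b c] bc(3) by simp
    qed
    moreover have "x \<in> sgring P" using x by simp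
    ultimately show "r * x \<in> ?q" unfolding mem using mult_closed[OF r] by blast
  qed
  have "1 \<notin> ?q" using face(1) by simp
  then show "carrier R \<noteq> ?q" using one_closed by (metis R_simps(1))
  fix f g assume f: "f \<in> carrier R" and g: "g \<in> carrier R" and fg: "f \<otimes>\<^bsub>R\<^esub> g \<in> ?q"
  show "f \<in> ?q \<or> g \<in> ?q"
  proof (rule ccontr)
    assume n: "\<not> (f \<in> ?q \<or> g \<in> ?q)"
    have "keys f \<inter> T1 \<noteq> {}" "keys g \<inter> T1 \<noteq> {}" using n f g by auto
    then obtain a b where a: "a \<in> keys f \<inter> T1" "\<forall>c\<in>keys f \<inter> T1. lexle c a"
      and b: "b \<in> keys g \<inter> T1" "\<forall>c\<in>keys g \<inter> T1. lexle c b"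
      using lexmax_exists[of "keys f \<inter> T1"] lexmax_exists[of "keys g \<inter> T1"] by auto
    have "f \<in> sgring P" "g \<in> sgring P" using f g by simp_all
    then have kP: "keys f \<subseteq> P" "keys g \<subseteq> P" by (auto simp: sgring_def)
    have abT: "a + b \<in> T1" using face(4)[of a b] a(1) b(1) kP by blast
    have "lk (f * g) (a + b) = lk f a * lk g b"
    proof (rule lookup_times_unique)
      fix a' b' assume k: "a' \<in> keys f" "b' \<in> keys g" "a' + b' = a + b"
      then have "a' \<in> T1" "b' \<in> T1" using face(4)[of a' b'] kP abT by auto
      then have "lexle a' a" "lexle b' b" using a(2) b(2) k by auto
      then show "a' = a \<and> b' = b" using k(3) by (auto simp: lexle_def prod_eq_iff)
    qed
    then have "a + b \<in> keys (f * g)" using a(1) b(1) by (simp add: in_keys_iff)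
    then show False using fg abT by simp
  qed
qed

lemma multiple_in_square_ideal:
  assumes "p \<in> P" "p \<noteq> 0"
  shows "\<exists>k. (\<exists>b\<in>P. smul k p = b + smul 2 n1) \<or> (\<exists>b\<in>P. smul k p = b + smul 2 n2)"
proof -
  obtain k i j where k: "k > 0" "smul k p = smul i n1 + smul j n2" using multiple[OF assms] by blast
  \<comment> \<open>Doubling turns a positive coefficient into one of at least 2, so a whole
    \<open>smul 2 n1\<close> or \<open>smul 2 n2\<close> splits off.\<close>
  have eq: "smul (2 * k) p = smul (2 * i) n1 + smul (2 * j) n2"
    using k(2) by (metis smul_smul smul_add_right)
  have P': "smul l n1 \<in> P" "smul l n2 \<in> P" for l using submonoid_smul[OF P] n1 n2 by auto
  have "i \<noteq> 0 \<or> j \<noteq> 0"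
  proof (rule ccontr)
    assume "\<not> ?thesis"
    then have "smul k p = 0" using k(2) by simp
    then show False using k(1) assms(2) by (auto simp: prod_eq_iff)
  qed
  then show ?thesis
  proof
    assume "i \<noteq> 0"
    then have "2 * i = (2 * i - 2) + 2" by simp
    then have "smul (2 * i) n1 = smul (2 * i - 2) n1 + smul 2 n1" by (metis smul_add)
    then have "smul (2 * k) p = (smul (2 * i - 2) n1 + smul (2 * j) n2) + smul 2 n1"
      using eq by (simp only: ac_simps)
    moreover have "smul (2 * i - 2) n1 + smul (2 * j) n2 \<in> P" using P' submonoid_add[OF P] by blast
    ultimately show ?thesis by blast
  next
    assume "j \<noteq> 0"
    then have "2 * j = (2 * j - 2) + 2" by simp
    then have "smul (2 * j) n2 = smul (2 * j - 2) n2 + smul 2 n2" by (metis smul_add)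
    then have "smul (2 * k) p = (smul (2 * i) n1 + smul (2 * j - 2) n2) + smul 2 n2"
      using eq by (simp only: ac_simps)
    moreover have "smul (2 * i) n1 + smul (2 * j - 2) n2 \<in> P" using P' submonoid_add[OF P] by blast
    ultimately show ?thesis by blast
  qed
qed

text \<open>A single term has a power in J because some multiple of its exponent lies in P + 2 n1 or
  P + 2 n2; sums of terms follow by \<open>radical_add\<close>.\<close>

lemma M0_radical:
  fixes f :: "'k::field sgr"
  assumes "f \<in> M0"
  defines "J \<equiv> {x * mon (smul 2 n1) + y * mon (smul 2 n2) | x y. x \<in> sgring P \<and> y \<in> sgring P}"
  shows "\<exists>n. f ^ n \<in> J"
proof -
  interpret S: sg_prime P "M0 :: 'k sgr set"
  proof (rule sg_prime.intro[OF P])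
    interpret type_domain "sgring P :: 'k sgr set" by (rule dom)
    show "primeideal (M0 :: 'k sgr set) R" by (rule R.maximalideal_prime[OF M0_maximal])
  qed
  have n12: "mon (smul 2 n1) \<in> sgring P" "mon (smul 2 n2) \<in> sgring P"
    by (rule single_in_sgring[OF submonoid_smul[OF P n1(1)]], rule single_in_sgring[OF submonoid_smul[OF P n2(1)]])
  have Jid: "ideal J S.R" unfolding J_def by (rule S.loc.ideal_two[OF n12])
  have J: "0 \<in> J" "\<And>x y. x \<in> J \<Longrightarrow> y \<in> J \<Longrightarrow> x + y \<in> J" "\<And>x r. x \<in> J \<Longrightarrow> r \<in> sgring P \<Longrightarrow> r * x \<in> J"
    using Jid[unfolded S.ideal_R_iff] by simp_all
  have J1: "x * mon (smul 2 n1) \<in> J" if "x \<in> sgring P" for x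
    unfolding J_def using that by (intro CollectI exI[of _ x] exI[of _ 0]) simp
  have J2: "x * mon (smul 2 n2) \<in> J" if "x \<in> sgring P" for x
    unfolding J_def using that by (intro CollectI exI[of _ 0] exI[of _ x]) simp
  have single: "\<exists>n. Poly_Mapping.single p c ^ n \<in> J" if p: "p \<in> P" "p \<noteq> 0" for p and c :: 'k
  proof -
    obtain k where "(\<exists>b\<in>P. smul k p = b + smul 2 n1) \<or> (\<exists>b\<in>P. smul k p = b + smul 2 n2)"
      using multiple_in_square_ideal[OF p] by blast
    then show ?thesis
    proof
      assume "\<exists>b\<in>P. smul k p = b + smul 2 n1"
      then obtain b where b: "b \<in> P" "smul k p = b + smul 2 n1" by blast
      have "Poly_Mapping.single p c ^ k = Poly_Mapping.single b (c ^ k) * mon (smul 2 n1)"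
        by (simp add: mon_power b(2) mult_single)
      then show ?thesis using J1[OF single_in_sgring[OF b(1)], of "c ^ k"] by metis
    next
      assume "\<exists>b\<in>P. smul k p = b + smul 2 n2"
      then obtain b where b: "b \<in> P" "smul k p = b + smul 2 n2" by blast
      have "Poly_Mapping.single p c ^ k = Poly_Mapping.single b (c ^ k) * mon (smul 2 n2)"
        by (simp add: mon_power b(2) mult_single)
      then show ?thesis using J2[OF single_in_sgring[OF b(1)], of "c ^ k"] by metis
    qed
  qed
  have "\<exists>n. (\<Sum>a\<in>A. Poly_Mapping.single a (lk f a)) ^ n \<in> J" if "finite A" "A \<subseteq> P - {0}" for A
    using that
  proof (induction A rule: finite_induct)
    case empty
    have "(0 :: 'k sgr) ^ 1 \<in> J" using J(1) by simp
    then show ?case unfolding sum.empty by (rule exI)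
  next
    case (insert a A)
    let ?x = "Poly_Mapping.single a (lk f a)" and ?y = "\<Sum>a\<in>A. Poly_Mapping.single a (lk f a)"
    obtain p q where pq: "?x ^ p \<in> J" "?y ^ q \<in> J" using insert single[of a "lk f a"] by blast
    have xy: "?x \<in> sgring P" "?y \<in> sgring P"
      using insert.prems by (auto intro!: single_in_sgring sgring_sum[OF P])
    have "(?x + ?y) ^ (p + q) \<in> J"
      by (rule radical_add[where U="sgring P", OF J(1) _ _ xy S.one_closed _ pq]) (simp_all add: J(2,3))
    moreover have "(\<Sum>a\<in>insert a A. Poly_Mapping.single a (lk f a)) = ?x + ?y"
      by (rule sum.insert[OF insert.hyps(1,2)])
    ultimately show ?case by (intro exI[of _ "p + q"]) simp
  qed
  moreover have "keys f \<subseteq> P - {0}" using assms(1) by (auto simp: M0_def sgring_def in_keys_iff)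
  ultimately have "\<exists>n. (\<Sum>a\<in>keys f. Poly_Mapping.single a (lk f a)) ^ n \<in> J" by simp
  then show ?thesis using sum_monomials[of f] by simp
qed

text \<open>The test parameters u and v sit at 2 n1 and 2 n2, because a + 2 n1 = (a + n1) + n1 and
  likewise a + 2 n2 lie in P. The monomials there satisfy x v = z u, so the weak sequence property
  puts y x into the ideal of u for each generator monomial y. On exponents this says that a + n is
  in P for every generator n.\<close>

lemma cm_if_buchsbaum:
  assumes buch: "buchsbaum_ring (RP :: 'k::field sgr ring)" and a: "a + n1 \<in> Pb" "a + n2 \<in> Pb"
  shows "a \<in> Pb"
proof -
  interpret D: type_domain "sgring P :: 'k sgr set" by (rule dom)
  have prime: "primeideal (M0 :: 'k sgr set) RP" by (rule D.R.maximalideal_prime[OF M0_maximal])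
  interpret S: sg_prime P "M0 :: 'k sgr set" by (rule sg_prime.intro[OF P prime])
  note S.loc.S_U [simp del]
  have L: "localization RP (carrier RP - M0) = S.L" by (simp add: S.loc.L_def)
  have "buchsbaum_local_ring S.L" using buch M0_maximal[where 'k='k] unfolding buchsbaum_ring_def L[symmetric] by blast
  then obtain m' where m': "maximalideal m' S.L"
    and weak: "\<forall>xs. system_of_parameters S.L m' xs \<longrightarrow> weak_sequence S.L m' xs"
    unfolding buchsbaum_local_ring_def by blast
  have mm: "m' = S.m" by (rule S.m_unique[OF m'])
  define q1 where "q1 = ({f \<in> sgring P. \<forall>a\<in>keys f. a \<notin> T1} :: 'k sgr set)"
  have q0: "primeideal ({0} :: 'k sgr set) RP" using D.R.zeroprimeideal by simp
  have q1p: "primeideal q1 RP" unfolding q1_def by (rule face_prime)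
  have nU: "mon n1 \<in> (sgring P :: 'k sgr set)" "mon n2 \<in> (sgring P :: 'k sgr set)"
    by (rule single_in_sgring[OF n1(1)], rule single_in_sgring[OF n2(1)])
  have n2q: "mon n2 \<in> q1" unfolding q1_def mem_Collect_eq using face(3) by (intro conjI nU(2)) simp
  have n1M: "mon n1 \<in> (M0 :: 'k sgr set)" using nU n1(2) by (simp add: M0_def lookup_single)
  have n1q: "mon n1 \<notin> q1" unfolding q1_def using face(2) by simp
  have q1M: "q1 \<subseteq> M0" unfolding q1_def M0_def using face(1) by (auto simp: in_keys_iff)
  have nz: "mon n2 \<noteq> (0 :: 'k sgr)" using lookup_single_eq[of n2 "1::'k"] by (metis lookup_zero one_neq_zero)
  have "0 \<in> q1" unfolding q1_def using sgring_closed(2)[OF P] by simp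
  then have "{0} \<subset> q1" using n2q nz by (intro psubsetI) auto
  moreover have "q1 \<subset> M0" using q1M n1M n1q by blast
  ultimately have dim: "krull_dim S.L = 2" by (rule S.krull_dim_eq2[OF q0 q1p prime _ _ subset_refl])
  define u where "u = (mon (smul 2 n1) :: 'k sgr)"
  define v where "v = (mon (smul 2 n2) :: 'k sgr)"
  have P2: "smul 2 n1 \<in> P" "smul 2 n2 \<in> P" using submonoid_smul[OF P] n1 n2 by auto
  have uvU: "u \<in> sgring P" "v \<in> sgring P"
    unfolding u_def v_def by (rule single_in_sgring[OF P2(1)], rule single_in_sgring[OF P2(2)])
  have n2z: "smul 2 n1 \<noteq> 0" "smul 2 n2 \<noteq> 0" using n1 n2 by (auto simp: prod_eq_iff)
  have uvM: "u \<in> M0" "v \<in> M0" using uvU n2z by (simp_all add: M0_def u_def v_def lookup_single)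
  have in_m: "S.loc.fr f 1 \<in> S.m" if "f \<in> M0" for f
    unfolding S.loc.extn_def using that S.loc.S_one by (intro CollectI exI[of _ f] exI[of _ 1] conjI refl)
  let ?xs = "[S.loc.fr u 1, S.loc.fr v 1]"
  have "system_of_parameters S.L S.m ?xs" unfolding system_of_parameters_def
  proof (intro conjI ballI)
    show "enat (length ?xs) = krull_dim S.L" unfolding dim by (simp add: numeral_eq_enat)
    show "set ?xs \<subseteq> S.m" using in_m uvM by simp
    fix y assume "y \<in> S.m"
    then obtain h t where h: "h \<in> M0" "t \<in> sgring P - M0" "y = S.loc.fr h t" unfolding S.loc.extn_def by blast
    have hU: "h \<in> sgring P" using h(1) by (simp add: M0_def)
    obtain n x z where xz: "x \<in> sgring P" "z \<in> sgring P" "h ^ n = x * u + z * v"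
      using M0_radical[OF h(1)] unfolding u_def v_def by blast
    then have "1 * h ^ n = x * u + z * v" by simp
    then have "S.loc.fr (h ^ n) (t ^ n) \<in> Idl\<^bsub>S.L\<^esub> {S.loc.fr u 1, S.loc.fr v 1}"
      using S.loc.Idl_pair[OF uvU(1) S.loc.S_one uvU(2) S.loc.S_one D.power_closed[OF hU] S.loc.S_pow[OF h(2)]]
        xz(1,2) S.loc.S_one by blast
    then have "y [^]\<^bsub>S.L\<^esub> n \<in> Idl\<^bsub>S.L\<^esub> (set ?xs)" unfolding h(3) S.loc.L_pow[OF hU h(2)] by simp
    then show "\<exists>n::nat. y [^]\<^bsub>S.L\<^esub> n \<in> Idl\<^bsub>S.L\<^esub> (set ?xs)" by (rule exI)
  qed
  then have W: "weak_sequence S.L S.m ?xs" using weak mm by simp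
  have aP: "a + smul 2 n1 \<in> P" "a + smul 2 n2 \<in> P"
    using Pb_add_P[OF a(1) n1] Pb_add_P[OF a(2) n2] by (simp_all add: numeral_2_eq_2 smul_Suc add.assoc)
  define x where "x = (mon (a + smul 2 n1) :: 'k sgr)"
  define z where "z = (mon (a + smul 2 n2) :: 'k sgr)"
  have xzU: "x \<in> sgring P" "z \<in> sgring P" 
    unfolding x_def z_def by (rule single_in_sgring[OF aP(1)], rule single_in_sgring[OF aP(2)])
  have "1 * (x * v) = z * u" unfolding x_def z_def u_def v_def by (simp add: mult_single ac_simps)
  then have "S.loc.fr (x * v) (1 * 1) \<in> Idl\<^bsub>S.L\<^esub> {S.loc.fr u 1}"
    using S.loc.Idl_single[OF uvU(1) S.loc.S_one D.mult_closed[OF xzU(1) uvU(2)] S.loc.S_mult[OF S.loc.S_one S.loc.S_one]]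
      xzU(2) S.loc.S_one by blast
  then have I: "S.loc.fr x 1 \<otimes>\<^bsub>S.L\<^esub> S.loc.fr v 1 \<in> Idl\<^bsub>S.L\<^esub> {S.loc.fr u 1}"
    unfolding S.loc.L_mult[OF xzU(1) S.loc.S_one uvU(2) S.loc.S_one] .
  have W1: "y \<otimes>\<^bsub>S.L\<^esub> S.loc.fr x 1 \<in> Idl\<^bsub>S.L\<^esub> {S.loc.fr u 1}" if "y \<in> S.m" for y
    using W[unfolded weak_sequence_def, rule_format, of 1 "S.loc.fr x 1" y]
      S.loc.fr_in_L[OF xzU(1) S.loc.S_one] I that by simp
  have "a + n \<in> P" if n: "n \<in> N" for n
  proof -
    have nP: "n \<in> P" "n \<noteq> 0" using n N_P N_zero by auto
    define y where "y = (mon n :: 'k sgr)"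
    have yU: "y \<in> sgring P" unfolding y_def by (rule single_in_sgring[OF nP(1)])
    have "y \<in> M0" using yU nP(2) by (simp add: M0_def y_def lookup_single)
    then have "S.loc.fr y 1 \<otimes>\<^bsub>S.L\<^esub> S.loc.fr x 1 \<in> Idl\<^bsub>S.L\<^esub> {S.loc.fr u 1}" by (intro W1 in_m)
    then have "S.loc.fr (y * x) (1 * 1) \<in> Idl\<^bsub>S.L\<^esub> {S.loc.fr u 1}"
      unfolding S.loc.L_mult[OF yU S.loc.S_one xzU(1) S.loc.S_one] .
    then obtain s b where sb: "s \<in> sgring P - M0" "b \<in> sgring P" "s * (y * x) = b * u"
      using S.loc.Idl_single[OF uvU(1) S.loc.S_one D.mult_closed[OF yU xzU(1)] S.loc.S_mult[OF S.loc.S_one S.loc.S_one]] by blast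
    \<comment> \<open>The constant term of s makes the exponent of y x survive in s (y x) = b u, so
      it is an exponent of b plus 2 n1.\<close>
    have s0: "lk s 0 \<noteq> 0" using sb(1) by (simp add: M0_def)
    have yx: "y * x = mon (n + (a + smul 2 n1))" unfolding y_def x_def by (simp add: mult_single)
    have "lk (b * u) (n + (a + smul 2 n1)) = lk (mon (n + (a + smul 2 n1)) * s) ((n + (a + smul 2 n1)) + 0)"
      unfolding sb(3)[symmetric] yx by (simp add: mult.commute)
    also have "\<dots> = lk s 0" by (subst lookup_mon_times) simp
    finally have "n + (a + smul 2 n1) \<in> keys (b * u)" using s0 by (simp add: in_keys_iff)
    then obtain c d where cd: "c \<in> keys b" "d \<in> keys u" "n + (a + smul 2 n1) = c + d" by (rule keys_timesD)
    have "d = smul 2 n1" using cd(2) unfolding u_def by simp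
    then have "a + n = c" using cd(3) by (auto simp: prod_eq_iff)
    then show ?thesis using cd(1) sb(2) by (auto simp: sgring_def)
  qed
  then show ?thesis unfolding Pb_def by blast
qed

theorem buchsbaum_iff:
  "buchsbaum_semigroup TYPE('k::field) P \<longleftrightarrow> (\<forall>a. a + n1 \<in> Pb \<longrightarrow> a + n2 \<in> Pb \<longrightarrow> a \<in> Pb)"
proof -
  have "semigroup_ring TYPE('k) P = RP"
    unfolding semigroup_ring_carrier[OF P] type_domain.R_def[OF dom] ..
  then show ?thesis unfolding buchsbaum_semigroup_def using buchsbaum_if cm_if_buchsbaum by metis
qed

end

section \<open>Dilates of convex sets\<close>

text \<open>Real factors are allowed because points are assembled below from parts with non-integral
  weights.\<close>

lemma dilate_add:
  fixes S :: "'a::real_vector set"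
  assumes S: "convex S" and h: "0 \<le> h" "x \<in> (\<lambda>y. h *\<^sub>R y) ` S" and k: "0 \<le> k" "y \<in> (\<lambda>y. k *\<^sub>R y) ` S"
  shows "x + y \<in> (\<lambda>y. (h + k) *\<^sub>R y) ` S"
proof -
  obtain f g where f: "f \<in> S" "x = h *\<^sub>R f" and g: "g \<in> S" "y = k *\<^sub>R g" using h k by blast
  show ?thesis
  proof (cases "h + k = 0")
    case True
    then have "h = 0" "k = 0" using h k by auto
    then show ?thesis using f g by auto
  next
    case False
    then have pos: "h + k > 0" using h k by auto
    have "(h / (h + k)) *\<^sub>R f + (k / (h + k)) *\<^sub>R g \<in> S"
      using pos h k by (intro convexD[OF S f(1) g(1)]) (auto simp: add_divide_distrib[symmetric])
    moreover have "x + y = (h + k) *\<^sub>R ((h / (h + k)) *\<^sub>R f + (k / (h + k)) *\<^sub>R g)"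
      using pos f g by (simp add: scaleR_right_distrib)
    ultimately show ?thesis by blast
  qed
qed

lemma dilate_scale:
  fixes S :: "'a::real_vector set"
  assumes "x \<in> (\<lambda>y. h *\<^sub>R y) ` S" shows "r *\<^sub>R x \<in> (\<lambda>y. (r * h) *\<^sub>R y) ` S"
proof -
  obtain y where "y \<in> S" "x = h *\<^sub>R y" using assms by blast
  then show ?thesis by (intro image_eqI[of _ _ y]) simp_all
qed

lemma pt_simps [simp]: "pt 0 = 0" "pt (a + b) = pt a + pt b" "pt (smul k a) = real k *\<^sub>R pt a"
  by (auto simp: pt_def smul_def prod_eq_iff)

lemma pt_inj [simp]: "pt a = pt b \<longleftrightarrow> a = b"
  by (auto simp: pt_def prod_eq_iff)

section \<open>Two-dimensional wedges\<close>

text \<open>The two extremal rays are treated uniformly: the sign \<open>\<epsilon>\<close> reverses the orientation when the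
  roles of \<open>v\<close> and \<open>v'\<close> are exchanged.\<close>

locale wedge =
  fixes F :: "(real \<times> real) set" and \<epsilon> :: real and v v' :: "real \<times> real" and D :: "real \<times> real \<Rightarrow> real \<times> real \<Rightarrow> real"
  defines "D \<equiv> \<lambda>x y. \<epsilon> * (fst x * snd y - snd x * fst y)"
  assumes d_pos: "D v' v > 0" and F_convex: "convex F"
    and F_pos: "\<And>x. x \<in> F \<Longrightarrow> 0 \<le> fst x \<and> 0 \<le> snd x"
    and F_wedge: "\<And>x. x \<in> F \<Longrightarrow> 0 \<le> D x v \<and> 0 \<le> D v' x"
    and F_ray: "\<exists>s>0. s *\<^sub>R v \<in> F" and F_ray': "\<exists>s>0. s *\<^sub>R v' \<in> F"
begin

lemma D_simps: "D (x + y) z = D x z + D y z" "D z (x + y) = D z x + D z y"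
  "D (x - y) z = D x z - D y z" "D z (x - y) = D z x - D z y"
  "D (r *\<^sub>R x) z = r * D x z" "D z (r *\<^sub>R x) = r * D z x" "D x x = 0" "D 0 z = 0" "D z 0 = 0"
  by (simp_all add: D_def algebra_simps)

lemma D_anti: "D x y = - D y x"
  by (simp add: D_def algebra_simps)

text \<open>Cramer's rule: up to the factor \<open>D v' v\<close>, the numbers \<open>D v' x\<close>
  and \<open>D x v\<close> are the coordinates of x along v and v'. In particular
  \<open>D x v\<close> is proportional to the distance from the ray of v.\<close>

lemma dec: "D v' v *\<^sub>R x = D v' x *\<^sub>R v + D x v *\<^sub>R v'"
  by (simp add: D_def prod_eq_iff algebra_simps)

lemma dec': "x = (D v' x / D v' v) *\<^sub>R v + (D x v / D v' v) *\<^sub>R v'"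
proof -
  have "x = (1 / D v' v) *\<^sub>R (D v' v *\<^sub>R x)" using d_pos by simp
  also have "\<dots> = (D v' x / D v' v) *\<^sub>R v + (D x v / D v' v) *\<^sub>R v'" unfolding dec by (simp add: scaleR_right_distrib)
  finally show ?thesis .
qed

definition W where "W = {x. 0 \<le> D x v \<and> 0 \<le> D v' x}"

lemma v_pos: "0 \<le> fst v \<and> 0 \<le> snd v" and v'_pos: "0 \<le> fst v' \<and> 0 \<le> snd v'"
proof -
  obtain s where s: "s > 0" "s *\<^sub>R v \<in> F" using F_ray by blast
  then show "0 \<le> fst v \<and> 0 \<le> snd v" using F_pos[OF s(2)] by (simp add: zero_le_mult_iff)
  obtain s' where s': "s' > 0" "s' *\<^sub>R v' \<in> F" using F_ray' by blast
  then show "0 \<le> fst v' \<and> 0 \<le> snd v'" using F_pos[OF s'(2)] by (simp add: zero_le_mult_iff)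
qed

lemma W_pos: assumes "x \<in> W" shows "0 \<le> fst x \<and> 0 \<le> snd x"
proof -
  have c: "0 \<le> D v' x / D v' v" "0 \<le> D x v / D v' v" using assms d_pos by (auto simp: W_def)
  have "fst x = (D v' x / D v' v) * fst v + (D x v / D v' v) * fst v'" using arg_cong[OF dec'[of x], of fst] by simp
  moreover have "snd x = (D v' x / D v' v) * snd v + (D x v / D v' v) * snd v'" using arg_cong[OF dec'[of x], of snd] by simp
  ultimately show ?thesis using c v_pos v'_pos by (metis add_nonneg_nonneg mult_nonneg_nonneg)
qed

lemma on_v: "D x v = 0 \<Longrightarrow> x = (D v' x / D v' v) *\<^sub>R v"
  using dec'[of x] by simp

lemma W_add: "x \<in> W \<Longrightarrow> y \<in> W \<Longrightarrow> x + y \<in> W" and W_scale: "0 \<le> r \<Longrightarrow> x \<in> W \<Longrightarrow> r *\<^sub>R x \<in> W"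
  by (simp_all add: W_def D_simps)

lemma F_W: "x \<in> F \<Longrightarrow> x \<in> W" using F_wedge by (simp add: W_def)

text \<open>The components of x along the two rays lie in dilates of F, and by convexity the
  dilation factors add.\<close>

lemma W_cone:
  assumes "x \<in> W" shows "\<exists>c\<ge>0. \<exists>f\<in>F. x = c *\<^sub>R f"
proof -
  obtain s s' where s: "s > 0" "s *\<^sub>R v \<in> F" "s' > 0" "s' *\<^sub>R v' \<in> F" using F_ray F_ray' by blast
  define a b where "a = D v' x / D v' v / s" and "b = D x v / D v' v / s'"
  have ab: "0 \<le> a" "0 \<le> b" using assms d_pos s by (auto simp: W_def a_def b_def)
  have "a *\<^sub>R (s *\<^sub>R v) \<in> (\<lambda>y. a *\<^sub>R y) ` F" "b *\<^sub>R (s' *\<^sub>R v') \<in> (\<lambda>y. b *\<^sub>R y) ` F" using s by blast+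
  then have "a *\<^sub>R (s *\<^sub>R v) + b *\<^sub>R (s' *\<^sub>R v') \<in> (\<lambda>y. (a + b) *\<^sub>R y) ` F" using dilate_add[OF F_convex ab(1) _ ab(2)] by blast
  moreover have "a *\<^sub>R (s *\<^sub>R v) + b *\<^sub>R (s' *\<^sub>R v') = x" using dec'[of x] s by (simp add: a_def b_def)
  ultimately show ?thesis using ab by (intro exI[of _ "a + b"]) auto
qed

end

text \<open>F lies in the angle at p between the directions of A and B. The edge towards A bounds F
  on the side away from the origin, the edge towards B on the side facing it.\<close>

locale corner = wedge +
  fixes p A B :: "real \<times> real" and s :: real
  assumes s: "0 < s" "p = s *\<^sub>R v" and pAB: "p \<in> F" "A \<in> F" "B \<in> F"
    and orient: "D (B - p) (A - p) > 0" and A_off: "D A v > 0" and B_off: "D B v > 0"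
    and corner: "\<And>x. x \<in> F \<Longrightarrow> 0 \<le> D (B - p) (x - p) \<and> 0 \<le> D (x - p) (A - p)"
begin

text \<open>\<open>\<phi>\<close> and \<open>\<psi>\<close> are the linear functionals with value 1
  on the lines through p, A and through p, B. Since \<phi> \<le> 1 \<le> \<psi> on F, a point of hF
  satisfies \<phi> \<le> h \<le> \<psi>.\<close>

definition \<phi> where "\<phi> x = D x (p - A) / D A p"
definition \<psi> where "\<psi> x = D (B - p) x / D B p"

lemma off: "D A p > 0" "D B p > 0"
  using s A_off B_off by (simp_all add: D_simps)

lemma lin: "\<phi> (x + y) = \<phi> x + \<phi> y" "\<phi> (r *\<^sub>R x) = r * \<phi> x" "\<psi> (x + y) = \<psi> x + \<psi> y" "\<psi> (r *\<^sub>R x) = r * \<psi> x"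
  "\<phi> (x - y) = \<phi> x - \<phi> y" "\<psi> (x - y) = \<psi> x - \<psi> y"
  by (simp_all add: \<phi>_def \<psi>_def D_simps add_divide_distrib diff_divide_distrib right_diff_distrib)

lemma at_vertices: "\<phi> p = 1" "\<phi> A = 1" "\<psi> p = 1" "\<psi> B = 1"
  using off D_anti[of p A] D_anti[of p B] by (simp_all add: \<phi>_def \<psi>_def D_simps)

lemma p_v: "D p v = 0" using s by (simp add: D_simps)

text \<open>As \<phi> does not vanish on v, \<open>D x v\<close> and \<phi> are linear coordinates
  of the plane; equalities of points are checked in them.\<close>

lemma inj: assumes "D x v = D y v" "\<phi> x = \<phi> y" shows "x = y"
proof -
  have "D (x - y) v = 0" using assms(1) by (simp add: D_simps)
  then have z: "x - y = (D v' (x - y) / D v' v) *\<^sub>R v" by (rule on_v)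
  have "s * \<phi> v = 1" using lin(2)[of s v] at_vertices(1) unfolding s(2)[symmetric] by simp
  then have "\<phi> v \<noteq> 0" by auto
  moreover have "(D v' (x - y) / D v' v) * \<phi> v = 0" using arg_cong[OF z, of \<phi>] assms(2) by (simp add: lin)
  ultimately have "D v' (x - y) / D v' v = 0" by (metis mult_eq_0_iff)
  then have "x - y = 0" using z by (metis scaleR_zero_left)
  then show ?thesis by simp
qed

text \<open>The rate at which \<psi> - \<phi> grows away from the ray. Edges of consecutive dilates
  cross where \<psi> - \<phi> = 1, which is the origin of the constant
  \<open>1 / \<kappa>\<close>.\<close>

definition \<kappa> where "\<kappa> = (\<psi> v' - \<phi> v') / D v' v"

text \<open>Both functionals are 1 at p, so they agree on v and their difference is a multiple of
  \<open>D x v\<close>.\<close>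

lemma psi_phi: "\<psi> x = \<phi> x + \<kappa> * D x v"
proof -
  have "s * \<phi> v = 1" "s * \<psi> v = 1"
    using lin(2)[of s v] lin(4)[of s v] at_vertices(1,3) unfolding s(2)[symmetric] by simp_all
  then have "\<phi> v = \<psi> v" using s(1) by (metis mult_left_cancel less_irrefl)
  moreover have "\<phi> x = (D v' x / D v' v) * \<phi> v + (D x v / D v' v) * \<phi> v'" using arg_cong[OF dec'[of x], of \<phi>] by (simp add: lin)
  moreover have "\<psi> x = (D v' x / D v' v) * \<psi> v + (D x v / D v' v) * \<psi> v'" using arg_cong[OF dec'[of x], of \<psi>] by (simp add: lin)
  ultimately show ?thesis using d_pos by (simp add: \<kappa>_def field_simps)
qed

lemma kappa_pos: "\<kappa> > 0"
proof -
  have "\<psi> A - \<psi> p > 0" using orient off by (simp add: \<psi>_def D_simps diff_divide_distrib[symmetric])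
  then have "\<kappa> * D A v > 0" using psi_phi[of A] at_vertices by simp
  then show ?thesis using A_off by (simp add: zero_less_mult_iff)
qed

lemma F_bounds: assumes "x \<in> F" shows "\<phi> x \<le> 1" "1 \<le> \<psi> x"
proof -
  have "0 \<le> D (B - p) (x - p) / D B p" using corner[OF assms] off by simp
  then have "0 \<le> \<psi> x - \<psi> p" by (simp add: \<psi>_def D_simps diff_divide_distrib)
  then show "1 \<le> \<psi> x" using at_vertices by simp
  have "0 \<le> D (x - p) (A - p) / D A p" using corner[OF assms] off by simp
  then have "0 \<le> \<phi> p - \<phi> x" by (simp add: \<phi>_def D_simps diff_divide_distrib)
  then show "\<phi> x \<le> 1" using at_vertices by simp
qed

text \<open>A crossing lies on the line \<phi> = h and on the line \<psi> = h + 1;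
  \<open>psi_phi\<close> converts the difference.\<close>

lemma crossing_values:
  assumes "V \<in> crossing p A B h" shows "\<phi> V = h" "D V v = 1 / \<kappa>"
proof -
  obtain x y where x: "x \<in> closed_segment p A" "V = real h *\<^sub>R x" and y: "y \<in> closed_segment p B" "V = real (Suc h) *\<^sub>R y"
    using assms unfolding crossing_def by blast
  obtain u where "x = (1 - u) *\<^sub>R p + u *\<^sub>R A" using x(1) by (auto simp: in_segment)
  then have "\<phi> x = 1" by (simp add: lin at_vertices)
  then show 1: "\<phi> V = h" using x(2) by (simp add: lin)
  obtain w where "y = (1 - w) *\<^sub>R p + w *\<^sub>R B" using y(1) by (auto simp: in_segment)
  then have "\<psi> y = 1" by (simp add: lin at_vertices)
  then have "\<psi> V = real (Suc h)" using y(2) by (simp add: lin)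
  then have "\<kappa> * D V v = 1" using 1 psi_phi[of V] by simp
  then show "D V v = 1 / \<kappa>" using kappa_pos by (simp add: field_simps)
qed

lemma crossing_shift:
  assumes "V \<in> crossing p A B h" shows "V + p \<in> crossing p A B (Suc h)"
proof -
  have V: "V \<in> (\<lambda>y. real h *\<^sub>R y) ` closed_segment p A" "V \<in> (\<lambda>y. real (Suc h) *\<^sub>R y) ` closed_segment p B"
    using assms unfolding crossing_def by auto
  have p1: "p \<in> (\<lambda>y. 1 *\<^sub>R y) ` closed_segment p A" "p \<in> (\<lambda>y. 1 *\<^sub>R y) ` closed_segment p B" by auto
  have "V + p \<in> (\<lambda>y. (real h + 1) *\<^sub>R y) ` closed_segment p A"
    by (rule dilate_add[OF convex_closed_segment _ V(1) _ p1(1)]) auto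
  moreover have "V + p \<in> (\<lambda>y. (real (Suc h) + 1) *\<^sub>R y) ` closed_segment p B"
    by (rule dilate_add[OF convex_closed_segment _ V(2) _ p1(2)]) auto
  ultimately show ?thesis by (simp add: crossing_def add.commute)
qed

lemma crossing_dilate:
  assumes "V \<in> crossing p A B h" shows "V \<in> (\<lambda>y. real h *\<^sub>R y) ` F" "V \<in> (\<lambda>y. real (Suc h) *\<^sub>R y) ` F"
proof -
  have "closed_segment p A \<subseteq> F" "closed_segment p B \<subseteq> F"
    by (rule closed_segment_subset[OF pAB(1,2) F_convex], rule closed_segment_subset[OF pAB(1,3) F_convex])
  then show "V \<in> (\<lambda>y. real h *\<^sub>R y) ` F" "V \<in> (\<lambda>y. real (Suc h) *\<^sub>R y) ` F" using assms unfolding crossing_def by blast+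
qed

lemma crossing_shifts: "V \<in> crossing p A B j \<Longrightarrow> V + real k *\<^sub>R p \<in> crossing p A B (j + k)"
proof (induction k)
  case (Suc k)
  have "V + real (Suc k) *\<^sub>R p = (V + real k *\<^sub>R p) + p" by (simp add: algebra_simps)
  then show ?case using crossing_shift[OF Suc.IH[OF Suc.prems]] by (simp only: add_Suc_right)
qed simp

text \<open>Right of the crossing level \<open>j\<close>, the part of \<open>hF\<close> left of the line through the crossings is the
  triangle spanned by \<open>hp\<close> and the crossings of levels \<open>h\<close> and \<open>h - 1\<close>.\<close>

lemma strip_membership:
  assumes V: "V \<in> crossing p A B j" and h: "j < h" and x: "0 \<le> D x v" "D x v \<le> 1 / \<kappa>" "\<phi> x \<le> h" "h \<le> \<psi> x"
  shows "x \<in> dilate h F"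
proof -
  obtain k where k: "h = Suc (j + k)" using h less_iff_Suc_add by blast
  define V1 where "V1 = V + real (Suc k) *\<^sub>R p"
  define V2 where "V2 = V + real k *\<^sub>R p"
  have c1: "V1 \<in> crossing p A B h" using crossing_shifts[OF V, of "Suc k"] unfolding V1_def k by simp
  have c2: "V2 \<in> crossing p A B (j + k)" using crossing_shifts[OF V, of k] unfolding V2_def .
  have m1: "V1 \<in> (\<lambda>y. real h *\<^sub>R y) ` F" by (rule crossing_dilate(1)[OF c1])
  have m2: "V2 \<in> (\<lambda>y. real h *\<^sub>R y) ` F" unfolding k by (rule crossing_dilate(2)[OF c2])
  have m0: "real h *\<^sub>R p \<in> (\<lambda>y. real h *\<^sub>R y) ` F" using pAB(1) by blast
  \<comment> \<open>Barycentric coordinates: l is the fraction of the way to \<nu>, and m is the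
    share of \<open>V2\<close>, where \<phi> is h - 1 instead of h.\<close>
  define l where "l = D x v * \<kappa>"
  define m where "m = h - \<phi> x"
  have l: "0 \<le> l" "l \<le> 1" using x kappa_pos by (auto simp: l_def field_simps)
  have m: "0 \<le> m" "m \<le> l" using x psi_phi[of x] by (auto simp: m_def l_def mult.commute)
  have eq: "x = (1 - l) *\<^sub>R (real h *\<^sub>R p) + ((l - m) *\<^sub>R V1 + m *\<^sub>R V2)" (is "_ = ?y")
  proof (rule inj)
    have "D ?y v = l / \<kappa>" using crossing_values(2)[OF c1] crossing_values(2)[OF c2] p_v kappa_pos
      by (simp add: D_simps field_simps)
    then show "D x v = D ?y v" using kappa_pos by (simp add: l_def)
    have "\<phi> ?y = h - m" using crossing_values(1)[OF c1] crossing_values(1)[OF c2] at_vertices k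
      by (simp add: lin algebra_simps)
    then show "\<phi> x = \<phi> ?y" by (simp add: m_def)
  qed
  have "(l - m) *\<^sub>R V1 + m *\<^sub>R V2 \<in> (\<lambda>y. ((l - m) * h + m * h) *\<^sub>R y) ` F"
    using m by (intro dilate_add[OF F_convex _ dilate_scale[OF m1] _ dilate_scale[OF m2]]) auto
  then have "?y \<in> (\<lambda>y. ((1 - l) * h + ((l - m) * h + m * h)) *\<^sub>R y) ` F"
    using m l by (intro dilate_add[OF F_convex _ dilate_scale[OF m0] _]) auto
  moreover have "(1 - l) * h + ((l - m) * h + m * h) = h" by (simp add: algebra_simps)
  ultimately show ?thesis using eq by simp
qed

text \<open>Adding q p raises \<phi> and \<psi> by q, so membership in hF gives \<phi> x \<le> h - q
  \<le> \<psi> x. As \<phi> x > j, the level h - q is above j and \<open>strip_membership\<close>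
  applies to x.\<close>

lemma gap_periodic:
  assumes V: "V \<in> crossing p A B j" and x: "0 \<le> D x v" "D x v \<le> 1 / \<kappa>" "j < \<phi> x"
    and q: "x + real q *\<^sub>R p \<in> dilate h F"
  shows "\<exists>h. x \<in> dilate h F"
proof -
  obtain f where f: "f \<in> F" "x + real q *\<^sub>R p = real h *\<^sub>R f" using q by blast
  have "\<phi> x + q = h * \<phi> f" using arg_cong[OF f(2), of \<phi>] by (simp add: lin at_vertices)
  also have "\<dots> \<le> h" using F_bounds(1)[OF f(1)] by (simp add: mult_left_le)
  finally have 1: "\<phi> x + q \<le> h" .
  have "real h \<le> h * \<psi> f" using F_bounds(2)[OF f(1)] by (simp add: mult_le_cancel_left1)
  also have "\<dots> = \<psi> x + q" using arg_cong[OF f(2), of \<psi>] by (simp add: lin at_vertices)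
  finally have 2: "h \<le> \<psi> x + q" .
  have "real q < h" using 1 x(3) by simp
  then have "x \<in> dilate (h - q) F" using 1 2 x by (intro strip_membership[OF V]) auto
  then show ?thesis by blast
qed

text \<open>Beyond \<nu> the difference \<psi> - \<phi> is at least 1, so an integer h fits between
  the two values. Far along the ray this h is large enough for the point to lie in h times the
  triangle p, A, B.\<close>

lemma far_points:
  assumes x: "1 / \<kappa> \<le> D x v" and q: "q > 0"
  shows "\<exists>K::nat. \<exists>h. x + (real K * real q) *\<^sub>R p \<in> dilate h F"
proof -
  \<comment> \<open>By \<open>psi_phi\<close>, \<alpha> is \<psi> A - 1 and \<beta> is 1 - \<phi> B.
    The constant C bounds h times the sum of the weights of A and B used below.\<close>
  define \<alpha> where "\<alpha> = \<kappa> * D A v"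
  define \<beta> where "\<beta> = \<kappa> * D B v"
  have ab: "\<alpha> > 0" "\<beta> > 0" using kappa_pos A_off B_off by (simp_all add: \<alpha>_def \<beta>_def)
  define C where "C = 1 / \<beta> + \<kappa> * D x v / \<alpha>"
  obtain K :: nat where K: "C + \<bar>\<phi> x\<bar> + 1 < K" using reals_Archimedean2[of "C + \<bar>\<phi> x\<bar> + 1"] by (rule exE)
  define y where "y = x + (real K * real q) *\<^sub>R p"
  have "real K \<le> real K * real q" using q by (simp add: mult_le_cancel_left1)
  moreover have "\<phi> y = \<phi> x + real K * real q" by (simp add: y_def lin at_vertices)
  ultimately have big: "C + 1 < \<phi> y" using K by linarith
  have C0: "C \<ge> 0"
  proof -
    have "0 < 1 / \<kappa>" using kappa_pos by simp
    then have "0 \<le> D x v" using x by linarith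
    then show ?thesis using ab kappa_pos by (simp add: C_def)
  qed
  define h where "h = nat \<lceil>\<phi> y\<rceil>"
  have "0 \<le> \<lceil>\<phi> y\<rceil>" using big C0 by linarith
  then have "real h = of_int \<lceil>\<phi> y\<rceil>" by (simp add: h_def)
  then have h: "\<phi> y \<le> h" "h \<le> \<phi> y + 1" by linarith+
  have hC: "C < h" "0 < real h" using h big C0 by linarith+
  have Dy: "D y v = D x v" by (simp add: y_def D_simps p_v)
  have psi: "\<psi> y = \<phi> y + \<kappa> * D x v" using psi_phi[of y] Dy by simp
  have k1: "1 \<le> \<kappa> * D x v" using x kappa_pos by (simp add: field_simps)
  \<comment> \<open>The weights of B and A, solved from \<phi> f = 1 - r \<beta> and \<psi> f = 1 +
    t \<alpha>.\<close>
  define r where "r = (h - \<phi> y) / (h * \<beta>)"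
  define t where "t = (\<psi> y - h) / (h * \<alpha>)"
  have r: "0 \<le> r" "r * h \<le> 1 / \<beta>" using h hC ab by (auto simp: r_def field_simps)
  have t: "0 \<le> t" "t * h \<le> \<kappa> * D x v / \<alpha>" using h hC ab k1 psi by (auto simp: t_def field_simps)
  have "(r + t) * h \<le> h" using r t hC(1) by (simp add: C_def algebra_simps)
  then have rt: "r + t \<le> 1" using hC(2) by (simp add: mult_le_cancel_right1)
  define f where "f = (1 - r - t) *\<^sub>R p + (t *\<^sub>R A + r *\<^sub>R B)"
  have "f \<in> F"
  proof -
    have "p + t *\<^sub>R (A - p) + r *\<^sub>R (B - p) \<in> convex hull {p, A, B}" unfolding convex_hull_3_alt
      by (intro CollectI exI[of _ t] exI[of _ r]) (use r t rt in auto)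
    moreover have "convex hull {p, A, B} \<subseteq> F" using pAB F_convex by (intro hull_minimal) auto
    moreover have "f = p + t *\<^sub>R (A - p) + r *\<^sub>R (B - p)" by (simp add: f_def algebra_simps)
    ultimately show ?thesis by auto
  qed
  moreover have "y = real h *\<^sub>R f"
  proof (rule inj)
    have pB: "\<phi> B = 1 - \<beta>" using psi_phi[of B] at_vertices by (simp add: \<beta>_def)
    have pf: "\<phi> f = 1 - r * \<beta>" by (simp add: f_def lin at_vertices pB algebra_simps)
    have "\<phi> (real h *\<^sub>R f) = real h * (1 - r * \<beta>)" by (simp only: lin(2) pf)
    also have "\<dots> = h - h * \<beta> * r" by (simp add: algebra_simps)
    finally have "\<phi> (real h *\<^sub>R f) = h - h * \<beta> * r" .
    moreover have "h * \<beta> * r = h - \<phi> y" using hC ab by (simp add: r_def)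
    ultimately show p: "\<phi> y = \<phi> (real h *\<^sub>R f)" by simp
    have pA: "\<psi> A = 1 + \<alpha>" using psi_phi[of A] at_vertices by (simp add: \<alpha>_def)
    have pf: "\<psi> f = 1 + t * \<alpha>" by (simp add: f_def lin at_vertices pA algebra_simps)
    have "\<psi> (real h *\<^sub>R f) = real h * (1 + t * \<alpha>)" by (simp only: lin(4) pf)
    also have "\<dots> = h + h * \<alpha> * t" by (simp add: algebra_simps)
    finally have "\<psi> (real h *\<^sub>R f) = h + h * \<alpha> * t" .
    moreover have "h * \<alpha> * t = \<psi> y - h" using hC ab by (simp add: t_def)
    ultimately have "\<psi> y = \<psi> (real h *\<^sub>R f)" by simp
    then have "\<kappa> * D y v = \<kappa> * D (real h *\<^sub>R f) v" using p psi_phi[of y] psi_phi[of "real h *\<^sub>R f"] by linarith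
    then show "D y v = D (real h *\<^sub>R f) v" using kappa_pos by simp
  qed
  ultimately show ?thesis unfolding y_def by blast
qed

text \<open>V and V + p are distinct crossings on one level set of \<open>D x v\<close>, so they
  span \<nu>.\<close>

lemma strip_line:
  assumes V: "V \<in> crossing p A B j" and nu: "affine \<nu>" "aff_dim \<nu> = 1" "\<forall>h\<ge>j. crossing p A B h \<subseteq> \<nu>"
  shows "\<nu> = {x. D x v = 1 / \<kappa>}"
proof -
  have p0: "p \<noteq> 0" using at_vertices(1) by (auto simp: \<phi>_def D_simps)
  have VV: "{V, V + p} \<subseteq> \<nu>" using nu(3)[rule_format, of j] nu(3)[rule_format, of "Suc j"] V crossing_shift[OF V] by auto
  have "affine hull {V, V + p} = \<nu>"
  proof (rule affine_dim_equal)
    show "affine hull {V, V + p} \<subseteq> \<nu>" using VV nu(1) by (intro hull_minimal) auto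
    show "aff_dim (affine hull {V, V + p}) = aff_dim \<nu>" using nu(2) p0 by (simp add: aff_dim_2)
  qed (use nu(1) in auto)
  then have eq: "\<nu> = range (\<lambda>u. V + u *\<^sub>R p)" by (simp add: affine_hull_2_alt)
  show ?thesis
  proof (intro equalityI subsetI)
    fix x assume "x \<in> \<nu>"
    then show "x \<in> {x. D x v = 1 / \<kappa>}" unfolding eq using crossing_values(2)[OF V] p_v by (auto simp: D_simps)
  next
    fix x assume "x \<in> {x. D x v = 1 / \<kappa>}"
    then have "x = V + (\<phi> x - \<phi> V) *\<^sub>R p"
      using crossing_values(2)[OF V] p_v by (intro inj) (auto simp: D_simps lin at_vertices)
    then show "x \<in> \<nu>" unfolding eq by blast
  qed
qed

text \<open>Slice parallel to p through x. The slice runs from b, on the opposite ray, to t, on the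
  segment from j p to V, where \<phi> = j; x lies between them because it is in W and \<phi> x \<le>
  j.\<close>

lemma below_crossing:
  assumes V: "V \<in> crossing p A B j" and x: "x \<in> W" "D x v \<le> 1 / \<kappa>" "\<phi> x \<le> j" and \<tau>: "\<tau> = {c *\<^sub>R v' | c. 0 \<le> c}"
  shows "x \<in> convex hull ({0, real j *\<^sub>R p, V} \<union> ({x. D x v = 1 / \<kappa>} \<inter> \<tau>))" (is "_ \<in> ?H")
proof -
  define c where "c = 1 / \<kappa>"
  have c: "c > 0" using kappa_pos by (simp add: c_def)
  \<comment> \<open>The point where \<nu> meets the opposite ray.\<close>
  define w where "w = (c / D v' v) *\<^sub>R v'"
  have w\<tau>: "w \<in> \<tau>" unfolding w_def \<tau> using c d_pos by (intro CollectI exI[of _ "c / D v' v"]) auto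
  have wc: "D w v = c" using d_pos by (simp add: w_def D_simps)
  have H: "0 \<in> ?H" "real j *\<^sub>R p \<in> ?H" "V \<in> ?H" "w \<in> ?H"
    using w\<tau> wc by (auto simp: c_def intro!: hull_inc)
  define l where "l = D x v / c"
  have l: "0 \<le> l" "l \<le> 1" using x c by (auto simp: l_def W_def c_def field_simps)
  define b where "b = l *\<^sub>R w + (1 - l) *\<^sub>R 0"
  define t where "t = l *\<^sub>R V + (1 - l) *\<^sub>R (real j *\<^sub>R p)"
  have bt: "b \<in> ?H" "t \<in> ?H"
    unfolding b_def t_def
    by (rule convexD[OF convex_convex_hull H(4) H(1)] convexD[OF convex_convex_hull H(3) H(2)]; use l in simp)+
  have Dt: "D t v = D x v" using crossing_values(2)[OF V] p_v c by (simp add: t_def D_simps l_def c_def)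
  have Db: "D b v = D x v" using wc c by (simp add: b_def D_simps l_def)
  have pt: "\<phi> t = j" using crossing_values(1)[OF V] by (simp add: t_def lin at_vertices algebra_simps)
  have xb: "x = b + (\<phi> x - \<phi> b) *\<^sub>R p" using Db p_v by (intro inj) (auto simp: D_simps lin at_vertices)
  have pv: "D v' p > 0" using d_pos s by (simp add: D_simps)
  have "D v' b = 0" by (simp add: b_def w_def D_simps)
  then have "D v' x = (\<phi> x - \<phi> b) * D v' p" using arg_cong[OF xb, of "D v'"] by (simp add: D_simps)
  then have ge: "\<phi> b \<le> \<phi> x" using x(1) pv by (simp add: W_def zero_le_mult_iff)
  show ?thesis
  proof (cases "\<phi> b = j")
    case True
    then have "x = t" using ge x(3) pt Dt by (intro inj) auto
    then show ?thesis using bt by simp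
  next
    case False
    then have pos: "real j - \<phi> b > 0" using ge x(3) by simp
    define m where "m = (\<phi> x - \<phi> b) / (j - \<phi> b)"
    have m: "0 \<le> m" "m \<le> 1" using pos ge x(3) by (auto simp: m_def)
    have "x = m *\<^sub>R t + (1 - m) *\<^sub>R b"
    proof (rule inj)
      show "D x v = D (m *\<^sub>R t + (1 - m) *\<^sub>R b) v" using Dt Db by (simp add: D_simps algebra_simps)
      have "m * (j - \<phi> b) = \<phi> x - \<phi> b" using pos by (simp add: m_def)
      then show "\<phi> x = \<phi> (m *\<^sub>R t + (1 - m) *\<^sub>R b)" using pt by (simp add: lin algebra_simps)
    qed
    moreover have "m *\<^sub>R t + (1 - m) *\<^sub>R b \<in> ?H"
      by (rule convexD[OF convex_convex_hull bt(2) bt(1)]) (use m in simp_all)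
    ultimately show ?thesis by simp
  qed
qed

end

section \<open>Rational cones\<close>

lemma rat_cone_minimal:
  assumes "0 \<in> T" "\<And>x y. x \<in> T \<Longrightarrow> y \<in> T \<Longrightarrow> x + y \<in> T" "\<And>q g. q \<in> \<rat> \<Longrightarrow> 0 \<le> q \<Longrightarrow> g \<in> G \<Longrightarrow> q *\<^sub>R g \<in> T"
  shows "rat_cone G \<subseteq> T"
proof
  fix x assume "x \<in> rat_cone G"
  then obtain p :: nat and q f where x: "x = (\<Sum>i<p. q i *\<^sub>R f i)" "\<forall>i<p. q i \<in> \<rat> \<and> 0 \<le> q i \<and> f i \<in> G"
    unfolding rat_cone_def by blast
  have "(\<Sum>i\<in>I. q i *\<^sub>R f i) \<in> T" if "finite I" "I \<subseteq> {..<p}" for I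
    using that by (induction I) (use assms x(2) in auto)
  then show "x \<in> T" using x(1) by simp
qed

lemma rat_cone_scaled: "q \<in> \<rat> \<Longrightarrow> 0 \<le> q \<Longrightarrow> g \<in> G \<Longrightarrow> q *\<^sub>R g \<in> rat_cone G"
  unfolding rat_cone_def
  by (intro CollectI exI[of _ "1::nat"] exI[of _ "\<lambda>_. q"] exI[of _ "\<lambda>_. g"]) simp

lemma rat_cone_zero: "0 \<in> rat_cone G"
  unfolding rat_cone_def by (intro CollectI exI[of _ "0::nat"]) simp

lemma rat_cone_add:
  assumes "x \<in> rat_cone G" "y \<in> rat_cone G" shows "x + y \<in> rat_cone G"
proof -
  obtain p :: nat and q f where x: "x = (\<Sum>i<p. q i *\<^sub>R f i)" "\<forall>i<p. q i \<in> \<rat> \<and> 0 \<le> q i \<and> f i \<in> G"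
    using assms(1) unfolding rat_cone_def by blast
  obtain p' :: nat and q' f' where y: "y = (\<Sum>i<p'. q' i *\<^sub>R f' i)" "\<forall>i<p'. q' i \<in> \<rat> \<and> 0 \<le> q' i \<and> f' i \<in> G"
    using assms(2) unfolding rat_cone_def by blast
  define r where "r i = (if i < p then q i else q' (i - p))" for i
  define g where "g i = (if i < p then f i else f' (i - p))" for i
  have "(\<Sum>i<p + p'. r i *\<^sub>R g i) = (\<Sum>i<p. r i *\<^sub>R g i) + (\<Sum>i\<in>{p..<p + p'}. r i *\<^sub>R g i)"
    by (subst sum.union_disjoint[symmetric]) (auto intro: sum.cong simp: ivl_disj_un)
  also have "(\<Sum>i\<in>{p..<p + p'}. r i *\<^sub>R g i) = (\<Sum>i<p'. r (i + p) *\<^sub>R g (i + p))"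
    using sum.shift_bounds_nat_ivl[of "\<lambda>i. r i *\<^sub>R g i" 0 p p'] by (simp add: add.commute atLeast0LessThan)
  also have "\<dots> = y" unfolding y(1) by (simp add: r_def g_def)
  also have "(\<Sum>i<p. r i *\<^sub>R g i) = x" unfolding x(1) by (rule sum.cong) (auto simp: r_def g_def)
  finally have "x + y = (\<Sum>i<p + p'. r i *\<^sub>R g i)" by simp
  moreover have "\<forall>i<p + p'. r i \<in> \<rat> \<and> 0 \<le> r i \<and> g i \<in> G" using x(2) y(2) by (auto simp: r_def g_def)
  ultimately show ?thesis unfolding rat_cone_def by blast
qed

lemma rat_cone_rat_scale:
  assumes "x \<in> rat_cone G" "q \<in> \<rat>" "0 \<le> q" shows "q *\<^sub>R x \<in> rat_cone G"
proof -
  have "rat_cone G \<subseteq> {x. q *\<^sub>R x \<in> rat_cone G}"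
    by (rule rat_cone_minimal)
      (use assms in \<open>auto simp: rat_cone_zero scaleR_right_distrib intro!: rat_cone_add rat_cone_scaled\<close>)
  then show ?thesis using assms(1) by blast
qed

section \<open>Far points, interior and sides of a wedge\<close>

context wedge
begin

lemma ray_between:
  assumes s: "s1 *\<^sub>R v \<in> F" "s2 *\<^sub>R v \<in> F" "s1 < s2" and y: "s1 \<le> y" "y \<le> s2"
  shows "y *\<^sub>R v \<in> F"
proof -
  define a b where "a = (s2 - y) / (s2 - s1)" and "b = (y - s1) / (s2 - s1)"
  have ab: "0 \<le> a" "0 \<le> b" using s y by (simp_all add: a_def b_def)
  have "a + b = (s2 - s1) / (s2 - s1)" unfolding a_def b_def by (simp only: add_divide_distrib[symmetric]) simp
  then have ab1: "a + b = 1" using s by simp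
  have b: "b * (s2 - s1) = y - s1" using s by (simp add: b_def)
  have "a * s1 + b * s2 = (a + b) * s1 + b * (s2 - s1)" by (simp add: algebra_simps)
  then have "a * s1 + b * s2 = y" unfolding ab1 b by simp
  then have "a *\<^sub>R (s1 *\<^sub>R v) + b *\<^sub>R (s2 *\<^sub>R v) = y *\<^sub>R v" by (simp flip: scaleR_left_distrib)
  moreover have "a *\<^sub>R (s1 *\<^sub>R v) + b *\<^sub>R (s2 *\<^sub>R v) \<in> F" by (rule convexD[OF F_convex s(1,2) ab ab1])
  ultimately show ?thesis by simp
qed

text \<open>The component of x along the opposite ray uses up a dilation factor l. The remaining
  factor H = h - l covers the interval from H s1 to H s2 on the ray, and once its length is at least
  b some translate by a multiple of b falls into it.\<close>

lemma segment_far_points: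
  assumes s: "s1 *\<^sub>R v \<in> F" "s2 *\<^sub>R v \<in> F" "0 \<le> s1" "s1 < s2" and b: "b > 0" and x: "0 \<le> D x v"
  shows "\<exists>K::nat. \<exists>h. x + (real K * b) *\<^sub>R v \<in> dilate h F"
proof -
  obtain s' where s': "s' > 0" "s' *\<^sub>R v' \<in> F" using F_ray' by blast
  define z where "z = s' *\<^sub>R v'"
  define l where "l = D x v / D v' v / s'"
  define \<mu> where "\<mu> = D v' x / D v' v"
  have l0: "0 \<le> l" using x s' d_pos by (simp add: l_def)
  have x_eq: "x = l *\<^sub>R z + \<mu> *\<^sub>R v" using dec'[of x] s' by (simp add: l_def z_def \<mu>_def add.commute)
  \<comment> \<open>Ensures that H is positive, that H (s2 - s1) is at least b, and that H s2 is at
    least \<mu>, so that K is a natural number.\<close>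
  obtain h :: nat where h: "l + 1 + b / (s2 - s1) + \<bar>\<mu>\<bar> / s2 < real h" using reals_Archimedean2 by blast
  have s2: "0 < s2" using s by simp
  have nn: "0 \<le> b / (s2 - s1)" "0 \<le> \<bar>\<mu>\<bar> / s2" using b s s2 by simp_all
  define H where "H = real h - l"
  have H: "H > 0" "H \<ge> b / (s2 - s1)" "H \<ge> \<bar>\<mu>\<bar> / s2" using h nn unfolding H_def by linarith+
  have H1: "b \<le> H * (s2 - s1)" using H(2) s(4) by (simp add: pos_divide_le_eq)
  have H2: "\<mu> \<le> H * s2" using H(3) s2 by (simp add: pos_divide_le_eq)
  define u where "u = (H * s2 - \<mu>) / b"
  have u0: "0 \<le> u" using H2 b by (simp add: u_def)
  define K where "K = nat \<lfloor>u\<rfloor>"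
  have "real K = of_int \<lfloor>u\<rfloor>" using u0 by (simp add: K_def)
  then have K: "K \<le> u" "u < K + 1" by linarith+
  have ub: "u * b = H * s2 - \<mu>" using b by (simp add: u_def)
  have up: "\<mu> + K * b \<le> H * s2" using mult_right_mono[OF K(1), of b] b ub by simp
  have "u * b \<le> (K + 1) * b" using K(2) b by (intro mult_right_mono) auto
  then have "H * s2 - b \<le> \<mu> + K * b" unfolding ub by (simp add: algebra_simps)
  then have lo: "H * s1 \<le> \<mu> + K * b" using H1 by (simp add: algebra_simps)
  define y where "y = (\<mu> + K * b) / H"
  have y: "s1 \<le> y" "y \<le> s2" using up lo H(1) by (simp_all add: y_def field_simps)
  have yF: "y *\<^sub>R v \<in> F" by (rule ray_between[OF s(1,2,4) y])
  have m1: "l *\<^sub>R z \<in> (\<lambda>y. l *\<^sub>R y) ` F" using s'(2) unfolding z_def by (rule imageI)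
  have m2: "H *\<^sub>R (y *\<^sub>R v) \<in> (\<lambda>y. H *\<^sub>R y) ` F" using yF by (rule imageI)
  have "l *\<^sub>R z + H *\<^sub>R (y *\<^sub>R v) \<in> (\<lambda>y. (l + H) *\<^sub>R y) ` F"
    using H(1) by (intro dilate_add[OF F_convex l0 m1 _ m2]) simp
  moreover have "l + H = real h" by (simp add: H_def)
  moreover have "H * y = \<mu> + K * b" using H(1) by (simp add: y_def)
  then have "x + (real K * b) *\<^sub>R v = l *\<^sub>R z + H *\<^sub>R (y *\<^sub>R v)" unfolding x_eq by (simp add: scaleR_left_distrib)
  ultimately show ?thesis by (intro exI[of _ K] exI[of _ h]) simp
qed

text \<open>A planar convex set without interior lies on a line. Here that line meets both rays off
  the origin, so F would be the segment between the two points.\<close>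

lemma interior_nonempty:
  assumes "\<not> (\<exists>a b. F = closed_segment a b)" shows "interior F \<noteq> {}"
proof
  assume "interior F = {}"
  then obtain a b where a: "a \<noteq> 0" "F \<subseteq> {x. a \<bullet> x = b}" using empty_interior_subset_hyperplane[OF F_convex] by blast
  obtain s s' where s: "s > 0" "s *\<^sub>R v \<in> F" "s' > 0" "s' *\<^sub>R v' \<in> F" using F_ray F_ray' by blast
  have ab: "a \<bullet> (s *\<^sub>R v) = b" "a \<bullet> (s' *\<^sub>R v') = b" using a(2) s by auto
  have b0: "b \<noteq> 0"
  proof
    assume "b = 0"
    then have "a \<bullet> v = 0" "a \<bullet> v' = 0" using ab s by auto
    then have "a \<bullet> a = 0" using arg_cong[OF dec'[of a], of "\<lambda>x. a \<bullet> x"] by (simp add: inner_add_right)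
    then show False using a(1) by simp
  qed
  have "F \<subseteq> closed_segment (s *\<^sub>R v) (s' *\<^sub>R v')"
  proof
    fix x assume x: "x \<in> F"
    define \<alpha> \<beta> where "\<alpha> = D v' x / D v' v / s" and "\<beta> = D x v / D v' v / s'"
    have ge: "0 \<le> \<alpha>" "0 \<le> \<beta>" using F_wedge[OF x] d_pos s by (auto simp: \<alpha>_def \<beta>_def)
    have xe: "x = \<alpha> *\<^sub>R (s *\<^sub>R v) + \<beta> *\<^sub>R (s' *\<^sub>R v')" using dec'[of x] s by (simp add: \<alpha>_def \<beta>_def)
    have "a \<bullet> x = \<alpha> * (a \<bullet> (s *\<^sub>R v)) + \<beta> * (a \<bullet> (s' *\<^sub>R v'))"
      using arg_cong[OF xe, of "\<lambda>x. a \<bullet> x"] by (simp only: inner_add_right inner_scaleR_right)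
    moreover have "a \<bullet> x = b" using a(2) x by blast
    ultimately have "(\<alpha> + \<beta>) * b = b" unfolding ab by (simp add: distrib_right)
    then have "\<alpha> + \<beta> = 1" using b0 by simp
    then have "\<alpha> = 1 - \<beta>" by simp
    then show "x \<in> closed_segment (s *\<^sub>R v) (s' *\<^sub>R v')" unfolding in_segment using xe ge
      by (intro exI[of _ \<beta>]) auto
  qed
  moreover have "closed_segment (s *\<^sub>R v) (s' *\<^sub>R v') \<subseteq> F" by (rule closed_segment_subset[OF s(2,4) F_convex])
  ultimately show False using assms by blast
qed

text \<open>A common denominator turns a rational point of Z into a lattice point, with nonnegative
  coordinates since Z lies in F.\<close>

lemma open_has_lattice_multiple:
  assumes "open Z" "Z \<noteq> {}" "Z \<subseteq> F"
  shows "\<exists>a h. h > (0::nat) \<and> (\<exists>x\<in>Z. pt a = real h *\<^sub>R x)"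
proof -
  obtain x where x: "x \<in> Z" using assms(2) by blast
  obtain A B where AB: "open A" "open B" "x \<in> A \<times> B" "A \<times> B \<subseteq> Z" using assms(1) x by (rule open_prod_elim)
  have rat: "\<exists>r. r \<in> \<rat> \<and> r \<in> A" if "open A" "y \<in> A" for A and y :: real
  proof -
    obtain e where "e > 0" "ball y e \<subseteq> A" using \<open>open A\<close> \<open>y \<in> A\<close> by (auto simp: open_contains_ball)
    moreover obtain r where "r \<in> \<rat>" "y < r" "r < y + e" using Rats_dense_in_real[of y "y + e"] \<open>e > 0\<close> by auto
    ultimately show ?thesis by (intro exI[of _ r]) (auto simp: dist_real_def)
  qed
  obtain r1 r2 where r: "r1 \<in> \<rat>" "r1 \<in> A" "r2 \<in> \<rat>" "r2 \<in> B" using rat AB by (metis mem_Times_iff)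
  have rZ: "(r1, r2) \<in> Z" using r AB by blast
  then have pos: "0 \<le> r1" "0 \<le> r2" using assms(3) F_pos by force+
  obtain m1 k1 :: nat where 1: "k1 \<noteq> 0" "\<bar>r1\<bar> = real m1 / real k1" using Rats_abs_nat_div_natE[OF r(1)] by metis
  obtain m2 k2 :: nat where 2: "k2 \<noteq> 0" "\<bar>r2\<bar> = real m2 / real k2" using Rats_abs_nat_div_natE[OF r(3)] by metis
  have "pt (m1 * k2, m2 * k1) = real (k1 * k2) *\<^sub>R (r1, r2)" using 1 2 pos by (simp add: pt_def)
  moreover have "k1 * k2 > 0" using 1 2 by simp
  ultimately show ?thesis using rZ by blast
qed

text \<open>The strict inequality holds on a nonempty open set of interior points of F near the ray,
  and one of them has a lattice multiple. So P reaches directions arbitrarily close to the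
  ray.\<close>

lemma small_slope:
  assumes int: "interior F \<noteq> {}" and \<rho>: "\<rho> > 0"
  shows "\<exists>a. a \<in> polygonal_semigroup F \<and> a \<noteq> 0 \<and> D (pt a) v < \<rho> * (fst (pt a) + snd (pt a))"
proof -
  define g where "g x = \<rho> * (fst x + snd x) - D x v" for x
  have glin: "g (x + y) = g x + g y" "g (r *\<^sub>R x) = r * g x" for x y r by (simp_all add: g_def D_simps algebra_simps)
  obtain y0 where y0: "y0 \<in> interior F" using int by blast
  obtain s where s: "s > 0" "s *\<^sub>R v \<in> F" using F_ray by blast
  have vnz: "fst v + snd v > 0"
  proof (rule ccontr)
    assume "\<not> ?thesis"
    then have "fst v = 0" "snd v = 0" using v_pos by auto
    then show False using d_pos by (simp add: D_def)
  qed
  define G where "G = g (s *\<^sub>R v)"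
  have G: "G > 0" using s vnz \<rho> by (simp add: G_def g_def D_simps distrib_left[symmetric])
  \<comment> \<open>Small enough that moving from s v towards \<open>y0\<close> by the fraction t
    keeps g at least G / 2.\<close>
  define t where "t = G / (2 * (G + \<bar>g y0\<bar>))"
  have t: "0 < t" "t \<le> 1" using G by (auto simp: t_def field_simps)
  have tb: "t * (G + \<bar>g y0\<bar>) = G / 2" using G by (simp add: t_def field_simps)
  define x where "x = s *\<^sub>R v - t *\<^sub>R (s *\<^sub>R v - y0)"
  have xi: "x \<in> interior F" unfolding x_def by (rule mem_interior_convex_shrink[OF F_convex y0 s(2) t])
  have "x = (1 - t) *\<^sub>R (s *\<^sub>R v) + t *\<^sub>R y0" by (simp add: x_def algebra_simps)
  then have "g x = (1 - t) * G + t * g y0" by (simp add: glin G_def)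
  also have "\<dots> \<ge> G - t * (G + \<bar>g y0\<bar>)"
  proof -
    have "- \<bar>g y0\<bar> \<le> g y0" by linarith
    then have "t * (- \<bar>g y0\<bar>) \<le> t * g y0" by (rule mult_left_mono) (use t in simp)
    then show ?thesis by (simp add: algebra_simps)
  qed
  finally have gx: "g x > 0" using tb G by simp
  define V where "V = {x \<in> interior F. g x > 0}"
  have "continuous_on UNIV g" unfolding g_def D_def by (intro continuous_intros)
  then have "open {x. 0 < g x}" by (intro open_Collect_less continuous_intros) auto
  then have oV: "open V" unfolding V_def using open_interior by (simp add: Collect_conj_eq open_Int)
  have "x \<in> V" using xi gx by (simp add: V_def)
  then have nV: "V \<noteq> {}" by blast
  have VF: "V \<subseteq> F" unfolding V_def using interior_subset by blast
  obtain a h where ah: "h > (0::nat)" "\<exists>x\<in>V. pt a = real h *\<^sub>R x"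
    using open_has_lattice_multiple[OF oV nV VF] by blast
  then obtain y where yV: "y \<in> V" and y3: "pt a = real h *\<^sub>R y" by blast
  then have y: "y \<in> F" "g y > 0" "pt a = real h *\<^sub>R y" using VF by (auto simp: V_def)
  have "g (pt a) > 0" using y ah by (simp add: glin)
  moreover have "a \<noteq> 0" using \<open>g (pt a) > 0\<close> glin(2)[of 0 0] by auto
  moreover have "a \<in> polygonal_semigroup F" unfolding polygonal_semigroup_def using y by blast
  ultimately show ?thesis by (intro exI[of _ a]) (simp add: g_def)
qed

text \<open>Only the coefficients must be rational, not the points of F. With x = C w and w interior
  to F, a rational q slightly above C gives x = q ((C / q) w) with (C / q) w still in F.\<close>

lemma interior_rat_cone:
  assumes int: "interior F \<noteq> {}" and x: "D x v > 0" "D v' x > 0"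
  shows "x \<in> rat_cone F"
proof -
  obtain y0 where y0: "y0 \<in> interior F" using int by blast
  define M where "M = \<bar>D y0 v\<bar> + \<bar>D v' y0\<bar> + 1"
  define m where "m = min (D x v) (D v' x)"
  have mM: "m > 0" "M > 0" using x by (auto simp: m_def M_def)
  \<comment> \<open>Subtracting a small multiple of an interior point leaves x in the cone; this is
    what makes the normalized point w interior.\<close>
  obtain e where e: "e \<in> \<rat>" "0 < e" "e < m / M" using Rats_dense_in_real[of 0 "m / M"] mM by auto
  have eM: "e * M < m" using e(3) mM by (simp add: pos_less_divide_eq)
  have "e * D y0 v \<le> e * M" "e * D v' y0 \<le> e * M" using e by (auto simp: M_def intro!: mult_left_mono)
  then have "x - e *\<^sub>R y0 \<in> W" using eM by (auto simp: W_def D_simps m_def)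
  then obtain c f where c: "c \<ge> 0" "f \<in> F" "x - e *\<^sub>R y0 = c *\<^sub>R f" using W_cone by blast
  define w where "w = (1 / (e + c)) *\<^sub>R x"
  have ec: "e + c > 0" using e c by simp
  have "w = f - (e / (e + c)) *\<^sub>R (f - y0)"
  proof -
    have "x = e *\<^sub>R y0 + c *\<^sub>R f" using c(3) by (simp add: algebra_simps)
    then have "w = (e / (e + c)) *\<^sub>R y0 + (c / (e + c)) *\<^sub>R f" by (simp add: w_def scaleR_right_distrib)
    moreover have "c / (e + c) = 1 - e / (e + c)" using ec by (simp add: field_simps)
    moreover define k where "k = e / (e + c)"
    ultimately have "w = k *\<^sub>R y0 + (1 - k) *\<^sub>R f" by simp
    then show ?thesis unfolding k_def[symmetric] by (simp add: algebra_simps)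
  qed
  then have "w \<in> interior F" using mem_interior_convex_shrink[OF F_convex y0 c(2), of "e / (e + c)"] e c ec by simp
  then obtain r where r: "r > 0" "ball w r \<subseteq> F" by (auto simp: mem_interior)
  define C where "C = e + c"
  have xw: "x = C *\<^sub>R w" using ec by (simp add: w_def C_def)
  define B where "B = norm w + 1"
  have B: "B > 0" by (simp add: B_def add_nonneg_pos)
  obtain q where q: "q \<in> \<rat>" "C < q" "q < C * (1 + r / B)"
    using Rats_dense_in_real[of C "C * (1 + r / B)"] ec r B by (auto simp: C_def)
  have q0: "q > 0" using q ec by (simp add: C_def)
  have "dist w ((C / q) *\<^sub>R w) = (1 - C / q) * norm w"
  proof -
    have "w - (C / q) *\<^sub>R w = (1 - C / q) *\<^sub>R w" by (simp add: algebra_simps)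
    then show ?thesis using q q0 by (simp add: dist_norm)
  qed
  also have "\<dots> < r"
  proof -
    have "q - C < C * (r / B)" using q(3) by (simp add: algebra_simps)
    also have "\<dots> \<le> q * (r / B)" using q(2) r B by (intro mult_right_mono) auto
    finally have "(q - C) / q < r / B" using q0 by (simp add: pos_divide_less_eq mult.commute)
    moreover have "(q - C) / q = 1 - C / q" using q0 by (simp add: diff_divide_distrib)
    ultimately have "(1 - C / q) * B < r" using B by (simp add: pos_less_divide_eq)
    moreover have "(1 - C / q) * norm w \<le> (1 - C / q) * B" using q q0 by (intro mult_left_mono) (auto simp: B_def)
    ultimately show ?thesis by simp
  qed
  finally have "(C / q) *\<^sub>R w \<in> F" using r by auto
  then have "q *\<^sub>R ((C / q) *\<^sub>R w) \<in> rat_cone F" using q q0 by (intro rat_cone_scaled) auto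
  then show ?thesis using q0 xw by simp
qed

text \<open>What the main proof needs to know about one extremal ray \<open>\<tau>\<close>, its line \<open>\<nu>\<close> and the set \<open>\<Upsilon>\<close>.\<close>

definition side :: "(real \<times> real) set \<Rightarrow> (nat \<times> nat) set \<Rightarrow> real \<Rightarrow> bool" where
  "side \<nu> \<Upsilon> c \<longleftrightarrow> 0 \<le> c \<and> (\<forall>Q\<in>\<nu>. D Q v = c) \<and>
    (\<forall>a u. pt a \<in> W \<longrightarrow> u \<in> polygonal_semigroup F \<longrightarrow> D (pt u) v = 0 \<longrightarrow> a + u \<in> polygonal_semigroup F \<longrightarrow>
       a \<in> \<Upsilon> \<or> a \<in> polygonal_semigroup F \<or> c < D (pt a) v \<or>
       D (pt a) v = c \<and> {r *\<^sub>R v | r. 0 \<le> r} \<subseteq> rat_cone F) \<and>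
    (\<forall>a u. pt a \<in> W \<longrightarrow> c \<le> D (pt a) v \<longrightarrow> u \<in> polygonal_semigroup F \<longrightarrow> u \<noteq> 0 \<longrightarrow> D (pt u) v = 0 \<longrightarrow>
       (\<exists>K. a + smul K u \<in> polygonal_semigroup F))"

lemma P_W: "a \<in> polygonal_semigroup F \<Longrightarrow> pt a \<in> W"
  unfolding polygonal_semigroup_def using F_W W_scale by auto

lemma on_ray_iff: "x \<in> W \<Longrightarrow> x \<in> {r *\<^sub>R v | r. 0 \<le> r} \<longleftrightarrow> D x v = 0"
proof
  assume x: "x \<in> W" "D x v = 0"
  have "0 \<le> D v' x / D v' v" using x d_pos by (simp add: W_def)
  then show "x \<in> {r *\<^sub>R v | r. 0 \<le> r}" using on_v[OF x(2)] by blast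
qed (auto simp: D_simps)

text \<open>Here \<nu> is the ray itself and c = 0. Points on the ray fall under the last
  alternative of \<open>side\<close>, so the ray has to be placed in the rational cone.\<close>

lemma segment_side:
  assumes seg: "segment_case F {r *\<^sub>R v | r. 0 \<le> r} \<nu> \<Upsilon>" shows "side \<nu> \<Upsilon> 0"
proof -
  obtain a b where ab: "a \<noteq> b" "F \<inter> {r *\<^sub>R v | r. 0 \<le> r} = closed_segment a b" and nu: "\<nu> = {r *\<^sub>R v | r. 0 \<le> r}"
    using seg unfolding segment_case_def by blast
  have "a \<in> F \<inter> {r *\<^sub>R v | r. 0 \<le> r}" "b \<in> F \<inter> {r *\<^sub>R v | r. 0 \<le> r}" unfolding ab(2) by auto
  then obtain ra rb where r: "a \<in> F" "a = ra *\<^sub>R v" "0 \<le> ra" "b \<in> F" "b = rb *\<^sub>R v" "0 \<le> rb" by blast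
  define s1 s2 where "s1 = min ra rb" and "s2 = max ra rb"
  have s: "s1 *\<^sub>R v \<in> F" "s2 *\<^sub>R v \<in> F" "0 \<le> s1" "s1 < s2" using r ab(1) by (auto simp: s1_def s2_def min_def max_def)
  \<comment> \<open>F contains an interval of the ray, so r v = q (y v) can be solved with q
    rational and y v in F.\<close>
  have rays: "{r *\<^sub>R v | r. 0 \<le> r} \<subseteq> rat_cone F"
  proof
    fix x assume "x \<in> {r *\<^sub>R v | r. 0 \<le> r}"
    then obtain r where r: "0 \<le> r" "x = r *\<^sub>R v" by blast
    show "x \<in> rat_cone F"
    proof (cases "r = 0")
      case True then show ?thesis using r rat_cone_zero by simp
    next
      case False
      then have r0: "r > 0" using r by simp
      define m where "m = (s1 + s2) / 2"
      have m: "s1 < m" "m < s2" "0 < m" using s by (auto simp: m_def)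
      have "r / s2 < r / m" using m r0 by (intro divide_strict_left_mono) auto
      then obtain q where q: "q \<in> \<rat>" "r / s2 < q" "q < r / m" using Rats_dense_in_real by blast
      have s20: "s2 > 0" using m by simp
      have q0: "q > 0" using q(2) r0 s20 by (meson divide_pos_pos less_trans)
      have "m < r / q" "r / q < s2" using q q0 m s20 by (simp_all add: field_simps)
      then have y: "s1 \<le> r / q" "r / q \<le> s2" using m by auto
      have "(r / q) *\<^sub>R v \<in> F" by (rule ray_between[OF s(1,2,4) y])
      then have "q *\<^sub>R ((r / q) *\<^sub>R v) \<in> rat_cone F" using q q0 by (intro rat_cone_scaled) auto
      then show ?thesis using q0 r by simp
    qed
  qed
  show ?thesis unfolding side_def
  proof (intro conjI allI impI)
    show "\<forall>Q\<in>\<nu>. D Q v = 0" unfolding nu by (auto simp: D_simps)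
    fix a assume a: "pt a \<in> W"
    then have "0 \<le> D (pt a) v" by (simp add: W_def)
    then show "a \<in> \<Upsilon> \<or> a \<in> polygonal_semigroup F \<or> 0 < D (pt a) v \<or>
       D (pt a) v = 0 \<and> {r *\<^sub>R v | r. 0 \<le> r} \<subseteq> rat_cone F" using rays by auto
  next
    fix a u assume a: "pt a \<in> W" "0 \<le> D (pt a) v" and u: "u \<in> polygonal_semigroup F" "u \<noteq> 0" "D (pt u) v = 0"
    obtain b where b: "0 \<le> b" "pt u = b *\<^sub>R v" using on_ray_iff[OF P_W[OF u(1)]] u(3) by blast
    have "b \<noteq> 0" using b(2) u(2) pt_inj[of u 0] by auto
    then obtain K h where "pt a + (real K * b) *\<^sub>R v \<in> dilate h F" using segment_far_points[OF s _ a(2)] b(1) by (metis less_eq_real_def)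
    then have "a + smul K u \<in> polygonal_semigroup F" unfolding polygonal_semigroup_def using b(2) by auto
    then show "\<exists>K. a + smul K u \<in> polygonal_semigroup F" by blast
  qed simp
qed

end

context corner
begin

text \<open>Points not beyond \<nu> lie in \<Upsilon> by \<open>below_crossing\<close> if \<phi>
  \<le> j; for larger \<phi>, \<open>gap_periodic\<close> applies. Points on or beyond \<nu> are
  caught by \<open>far_points\<close>.\<close>

lemma strip_side:
  assumes strip: "strip p A B {r *\<^sub>R v' | r. 0 \<le> r} \<nu> \<Upsilon>" and single: "F \<inter> {r *\<^sub>R v | r. 0 \<le> r} = {p}"
  shows "side \<nu> \<Upsilon> (1 / \<kappa>)"
proof -
  obtain j V where V: "crossing p A B j = {V}" and nu: "affine \<nu>" "aff_dim \<nu> = 1" "\<forall>h\<ge>j. crossing p A B h \<subseteq> \<nu>"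
    and Ups: "\<Upsilon> = {a. pt a \<in> convex hull ({0, real j *\<^sub>R p, V} \<union> (\<nu> \<inter> {r *\<^sub>R v' | r. 0 \<le> r}))}"
    using strip unfolding strip_def by blast
  have V': "V \<in> crossing p A B j" using V by blast
  have nu_eq: "\<nu> = {x. D x v = 1 / \<kappa>}" by (rule strip_line[OF V' nu])
  \<comment> \<open>F meets the ray only in p, so the elements of P on the ray are integer multiples
    of p.\<close>
  have ray: "\<exists>q::nat. pt u = real q *\<^sub>R p" if u: "u \<in> polygonal_semigroup F" "D (pt u) v = 0" for u
  proof -
    obtain i f where f: "f \<in> F" "pt u = real i *\<^sub>R f" using u(1) unfolding polygonal_semigroup_def by blast
    show ?thesis
    proof (cases "i = 0")
      case True then show ?thesis using f by (intro exI[of _ 0]) simp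
    next
      case False
      then have "D f v = 0" using u(2) f(2) by (simp add: D_simps)
      then have "f \<in> F \<inter> {r *\<^sub>R v | r. 0 \<le> r}" using f(1) on_ray_iff[OF F_W[OF f(1)]] by blast
      then have "f = p" using single by blast
      then show ?thesis using f(2) by blast
    qed
  qed
  show ?thesis unfolding side_def
  proof (intro conjI allI impI)
    show "0 \<le> 1 / \<kappa>" using kappa_pos by simp
    show "\<forall>Q\<in>\<nu>. D Q v = 1 / \<kappa>" unfolding nu_eq by simp
    fix a u assume a: "pt a \<in> W" and u: "u \<in> polygonal_semigroup F" "D (pt u) v = 0" and au: "a + u \<in> polygonal_semigroup F"
    show "a \<in> \<Upsilon> \<or> a \<in> polygonal_semigroup F \<or> 1 / \<kappa> < D (pt a) v \<or>
       D (pt a) v = 1 / \<kappa> \<and> {r *\<^sub>R v | r. 0 \<le> r} \<subseteq> rat_cone F"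
    proof (cases "1 / \<kappa> < D (pt a) v")
      case False
      then have le: "D (pt a) v \<le> 1 / \<kappa>" by simp
      show ?thesis
      proof (cases "\<phi> (pt a) \<le> j")
        case True
        then have "a \<in> \<Upsilon>" unfolding Ups nu_eq using below_crossing[OF V' a le True refl] by simp
        then show ?thesis by blast
      next
        case False
        obtain q where q: "pt u = real q *\<^sub>R p" using ray[OF u] by blast
        obtain h where "pt a + real q *\<^sub>R p \<in> dilate h F" using au q unfolding polygonal_semigroup_def by auto
        then have "\<exists>h. pt a \<in> dilate h F" using gap_periodic[OF V' _ le] a False by (simp add: W_def)
        then show ?thesis unfolding polygonal_semigroup_def by blast
      qed
    qed blast
  next
    fix a u assume a: "pt a \<in> W" "1 / \<kappa> \<le> D (pt a) v" and u: "u \<in> polygonal_semigroup F" "u \<noteq> 0" "D (pt u) v = 0"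
    obtain q where q: "pt u = real q *\<^sub>R p" using ray[OF u(1,3)] by blast
    have "q > 0" using q u(2) pt_inj[of u 0] by (cases q) auto
    then obtain K h where "pt a + (real K * real q) *\<^sub>R p \<in> dilate h F" using far_points[OF a(2)] by blast
    then have "a + smul K u \<in> polygonal_semigroup F" unfolding polygonal_semigroup_def using q by auto
    then show "\<exists>K. a + smul K u \<in> polygonal_semigroup F" by blast
  qed
qed

end

section \<open>Minimal generators\<close>

lemma is_submonoidI: "0 \<in> S \<Longrightarrow> (\<And>a b. a \<in> S \<Longrightarrow> b \<in> S \<Longrightarrow> a + b \<in> S) \<Longrightarrow> is_submonoid S"
  unfolding is_submonoid_def by simp

text \<open>Elements of smaller degree than n are generated without n. A splitting into two nonzero
  summands would therefore generate n from the other generators, against minimality.\<close>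

lemma minimal_generator_irreducible:
  assumes mg: "minimal_generating_set N S" and n: "n \<in> N"
  shows "n \<in> S" "n \<noteq> 0" "a \<in> S \<Longrightarrow> b \<in> S \<Longrightarrow> n = a + b \<Longrightarrow> a = 0 \<or> b = 0"
proof -
  let ?h = "is_submonoid hull (N - {n})"
  have S: "S = is_submonoid hull N" using mg by (simp add: minimal_generating_set_def)
  have sm: "is_submonoid ?h" by (rule is_submonoid_hull)
  show nS: "n \<in> S" unfolding S using n by (rule hull_inc)
  have nin: "n \<notin> ?h"
  proof
    assume "n \<in> ?h"
    then have "N \<subseteq> ?h" using hull_subset[of "N - {n}" is_submonoid] by blast
    then have "is_submonoid hull N \<subseteq> ?h" using sm by (rule hull_minimal)
    moreover have "?h \<subseteq> is_submonoid hull N" by (intro hull_mono) blast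
    ultimately have "?h = S" using S by blast
    moreover have "N - {n} \<subset> N" using n by blast
    ultimately show False using mg unfolding minimal_generating_set_def by blast
  qed
  show "n \<noteq> 0" using nin submonoid_zero[OF sm] by metis
  assume ab: "a \<in> S" "b \<in> S" "n = a + b"
  let ?Y = "{x \<in> is_submonoid hull N. size1 x < size1 n \<longrightarrow> x \<in> ?h}"
  have "is_submonoid ?Y"
  proof (rule is_submonoidI)
    show "0 \<in> ?Y" using submonoid_zero[OF sm] submonoid_zero[OF is_submonoid_hull] by simp
    fix x y assume "x \<in> ?Y" "y \<in> ?Y"
    then have x: "x \<in> is_submonoid hull N" "size1 x < size1 n \<longrightarrow> x \<in> ?h"
      and y: "y \<in> is_submonoid hull N" "size1 y < size1 n \<longrightarrow> y \<in> ?h" by simp_all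
    have "x + y \<in> is_submonoid hull N" by (rule submonoid_add[OF is_submonoid_hull x(1) y(1)])
    moreover have "x + y \<in> ?h" if "size1 (x + y) < size1 n"
      using x(2) y(2) that by (intro submonoid_add[OF sm]) simp_all
    ultimately show "x + y \<in> ?Y" by simp
  qed
  moreover have "N \<subseteq> ?Y"
  proof
    fix x assume "x \<in> N"
    then show "x \<in> ?Y" using hull_inc[of x N is_submonoid] hull_inc[of x "N - {n}" is_submonoid] by (cases "x = n") auto
  qed
  ultimately have sub: "is_submonoid hull N \<subseteq> ?Y" by (intro hull_minimal)
  show "a = 0 \<or> b = 0"
  proof (rule ccontr)
    assume "\<not> ?thesis"
    then have "size1 a < size1 n" "size1 b < size1 n" using ab(3) size1_pos[of a] size1_pos[of b] by auto
    then have "a \<in> ?h" "b \<in> ?h" using sub ab(1,2) S by auto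
    then show False using nin ab(3) submonoid_add[OF sm] by blast
  qed
qed

text \<open>Members of N are irreducible, so splitting one over the finite set A shows that it
  belongs to A. The interpretation of \<open>bar_monoid\<close> supplies the splitting.\<close>

lemma finite_minimal_generating_set:
  assumes mg: "minimal_generating_set N S" and A: "finite A" "S = is_submonoid hull A"
  shows "finite N"
proof -
  have S0: "S = is_submonoid hull (A - {0})"
  proof
    show "is_submonoid hull (A - {0}) \<subseteq> S" unfolding A(2) by (intro hull_mono) blast
    have "A \<subseteq> is_submonoid hull (A - {0})"
      using hull_subset[of "A - {0}" is_submonoid] submonoid_zero[OF is_submonoid_hull[of "A - {0}"]] by blast
    then show "S \<subseteq> is_submonoid hull (A - {0})" unfolding A(2) using is_submonoid_hull by (rule hull_minimal)
  qed
  interpret B: bar_monoid S "A - {0}" "{a. \<forall>n\<in>A - {0}. a + n \<in> S}"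
    by unfold_locales (use A(1) S0 in auto)
  have "N \<subseteq> A"
  proof
    fix n assume "n \<in> N"
    note n = minimal_generator_irreducible[OF mg this]
    obtain g p where gp: "g \<in> A - {0}" "p \<in> S" "n = g + p" by (rule B.P_split[OF n(1,2)])
    have "g \<in> S" by (rule B.N_P[OF gp(1)])
    then have "g = 0 \<or> p = 0" using n(3)[of g p] gp(2,3) by blast
    then show "n \<in> A" using gp by auto
  qed
  then show ?thesis using A(1) finite_subset by blast
qed

lemma hull_single: "is_submonoid hull {g} = range (\<lambda>k. smul k g)"
proof
  have "is_submonoid (range (\<lambda>k. smul k g))"
  proof (rule is_submonoidI)
    show "0 \<in> range (\<lambda>k. smul k g)" by (rule range_eqI[of _ _ 0]) simp
    fix a b assume "a \<in> range (\<lambda>k. smul k g)" "b \<in> range (\<lambda>k. smul k g)"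
    then obtain i j where "a = smul i g" "b = smul j g" by blast
    then have "a + b = smul (i + j) g" by (simp add: smul_add)
    then show "a + b \<in> range (\<lambda>k. smul k g)" by (rule range_eqI)
  qed
  moreover have "g \<in> range (\<lambda>k. smul k g)" by (rule range_eqI[of _ _ 1]) simp
  then have "{g} \<subseteq> range (\<lambda>k. smul k g)" by simp
  ultimately show "is_submonoid hull {g} \<subseteq> range (\<lambda>k. smul k g)" by (intro hull_minimal)
  have "g \<in> is_submonoid hull {g}" by (rule hull_inc) simp
  then have "smul k g \<in> is_submonoid hull {g}" for k by (rule submonoid_smul[OF is_submonoid_hull])
  then show "range (\<lambda>k. smul k g) \<subseteq> is_submonoid hull {g}" by blast
qed

section \<open>The Buchsbaum criterion in terms of two linear functionals\<close>

text \<open>\<open>l1\<close> and \<open>l2\<close> vanish on the first and the second ray. The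
  assumptions are symmetric in the rays, see \<open>swap\<close>, and isolate what the algebra needs
  from the polygon.\<close>

locale planar = bar_monoid +
  fixes l1 l2 :: "nat \<times> nat \<Rightarrow> real"
  assumes l_add: "l1 (a + b) = l1 a + l1 b" "l2 (a + b) = l2 a + l2 b"
    and P_nonneg: "a \<in> P \<Longrightarrow> 0 \<le> l1 a" "a \<in> P \<Longrightarrow> 0 \<le> l2 a"
    and diff: "l1 b \<le> l1 a \<Longrightarrow> l2 b \<le> l2 a \<Longrightarrow> \<exists>z. a = b + z"
    and cramer: "0 \<le> l1 a \<Longrightarrow> 0 \<le> l2 a \<Longrightarrow> l1 m1 = 0 \<Longrightarrow> 0 < l2 m1 \<Longrightarrow> l2 m2 = 0 \<Longrightarrow> 0 < l1 m2 \<Longrightarrow>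
      \<exists>k>0. \<exists>i j. smul k a = smul i m1 + smul j m2"
    and rays: "\<exists>u\<in>P. u \<noteq> 0 \<and> l1 u = 0" "\<exists>u\<in>P. u \<noteq> 0 \<and> l2 u = 0"
begin

lemma l_zero: "l1 0 = 0" "l2 0 = 0"
  using l_add[of 0 0] by simp_all

lemma l_smul: "l1 (smul k a) = k * l1 a" "l2 (smul k a) = k * l2 a"
  by (induction k) (simp_all add: l_zero smul_Suc l_add algebra_simps)

lemma l_pos: "l1 a = 0 \<Longrightarrow> 0 \<le> l2 a \<Longrightarrow> a \<noteq> 0 \<Longrightarrow> 0 < l2 a" "l2 a = 0 \<Longrightarrow> 0 \<le> l1 a \<Longrightarrow> a \<noteq> 0 \<Longrightarrow> 0 < l1 a"
proof -
  have "a = 0" if "l1 a = 0" "l2 a = 0"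
    using diff[of a 0] that l_zero by (auto simp: prod_eq_iff)
  then show "l1 a = 0 \<Longrightarrow> 0 \<le> l2 a \<Longrightarrow> a \<noteq> 0 \<Longrightarrow> 0 < l2 a" "l2 a = 0 \<Longrightarrow> 0 \<le> l1 a \<Longrightarrow> a \<noteq> 0 \<Longrightarrow> 0 < l1 a"
    by fastforce+
qed

lemma Pb_nonneg: assumes "a \<in> Pb" shows "0 \<le> l1 a" "0 \<le> l2 a"
proof -
  obtain u1 u2 where u: "u1 \<in> P" "u1 \<noteq> 0" "l1 u1 = 0" "u2 \<in> P" "u2 \<noteq> 0" "l2 u2 = 0" using rays by blast
  show "0 \<le> l1 a" using P_nonneg(1)[OF Pb_add_P[OF assms u(1,2)]] u(3) by (simp add: l_add)
  show "0 \<le> l2 a" using P_nonneg(2)[OF Pb_add_P[OF assms u(4,5)]] u(6) by (simp add: l_add)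
qed

text \<open>Express x through y and an element of the other ray by \<open>cramer\<close>; the second
  coefficient vanishes because \<open>l1\<close> is 0 on x and y.\<close>

lemma commensurable:
  assumes "l1 x = 0" "0 \<le> l2 x" "x \<noteq> 0" "l1 y = 0" "0 \<le> l2 y" "y \<noteq> 0"
  shows "\<exists>K>0. \<exists>k>0. smul K x = smul k y"
proof -
  obtain u2 where u: "u2 \<in> P" "u2 \<noteq> 0" "l2 u2 = 0" using rays by blast
  have p: "0 < l2 x" "0 < l2 y" "0 < l1 u2" using l_pos assms u P_nonneg by auto
  obtain k i j where k: "k > 0" "smul k x = smul i y + smul j u2"
    using cramer[of x y u2] assms p u(3) by auto
  have "j = 0" using arg_cong[OF k(2), of l1] assms p by (simp add: l_add l_smul)
  then have e: "smul k x = smul i y" using k(2) by simp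
  have "i \<noteq> 0"
  proof
    assume "i = 0"
    then have "k * l2 x = 0" using arg_cong[OF e, of l2] by (simp add: l_smul l_zero)
    then show False using k(1) p by simp
  qed
  then show ?thesis using k(1) e by blast
qed

lemma swap: "planar P N Pb l2 l1"
proof unfold_locales
  show "\<exists>k>0. \<exists>i j. smul k a = smul i m1 + smul j m2"
    if "0 \<le> l2 a" "0 \<le> l1 a" "l2 m1 = 0" "0 < l1 m1" "l1 m2 = 0" "0 < l2 m2" for a m1 m2
    using cramer[of a m2 m1] that by (metis add.commute)
qed (use l_add P_nonneg diff rays in auto)

lemma simplicial_pair:
  assumes m: "m1 \<in> P" "m1 \<noteq> 0" "l1 m1 = 0" "m2 \<in> P" "m2 \<noteq> 0" "l2 m2 = 0"
  shows "simplicial_pair P N Pb {a. l1 a = 0} m1 m2"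
proof unfold_locales
  have p: "0 < l2 m1" "0 < l1 m2" using l_pos m P_nonneg by auto
  show "\<exists>k>0. \<exists>i j. smul k a = smul i m1 + smul j m2" if "a \<in> P" "a \<noteq> 0" for a
    using cramer[of a m1 m2] P_nonneg that m p by blast
  show "m2 \<notin> {a. l1 a = 0}" using p by simp
  show "a + b \<in> {a. l1 a = 0} \<longleftrightarrow> a \<in> {a. l1 a = 0} \<and> b \<in> {a. l1 a = 0}" if "a \<in> P" "b \<in> P" for a b
    using P_nonneg[OF that(1)] P_nonneg[OF that(2)] by (simp add: l_add add_nonneg_eq_0_iff)
  show "\<exists>y. x = y + smul e m2" if x: "x \<in> Pb" and a: "a \<in> Pb" and eq: "x + smul i m1 = a + smul e m2" for x a i e
  proof -
    have "l1 x = l1 a + l1 (smul e m2)" using arg_cong[OF eq, of l1] m by (simp add: l_add l_smul)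
    then have "l1 (smul e m2) \<le> l1 x" using Pb_nonneg[OF a] by simp
    moreover have "l2 (smul e m2) \<le> l2 x" using Pb_nonneg[OF x] m by (simp add: l_smul)
    ultimately obtain z where "x = smul e m2 + z" using diff by blast
    then show ?thesis by (metis add.commute)
  qed
qed (use m l_zero in auto)

lemma multiple_in_P:
  assumes "n \<in> Pb" "n \<noteq> 0" "l1 n = 0" shows "\<exists>K>0. smul K n \<in> P"
proof -
  obtain u where u: "u \<in> P" "u \<noteq> 0" "l1 u = 0" using rays by blast
  obtain K k where "K > 0" "smul K n = smul k u"
    using commensurable[of n u] assms u Pb_nonneg P_nonneg by blast
  then show ?thesis using submonoid_smul[OF P u(1)] by auto
qed

definition cm :: "nat \<times> nat \<Rightarrow> nat \<times> nat \<Rightarrow> bool" where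
  "cm n1 n2 \<longleftrightarrow> (\<forall>a. a + n1 \<in> Pb \<longrightarrow> a + n2 \<in> Pb \<longrightarrow> a \<in> Pb)"

lemma cm_grid:
  assumes "cm n1 n2" "n1 \<in> Pb" "n2 \<in> Pb" "a + smul i n1 \<in> Pb" "a + smul j n2 \<in> Pb" shows "a \<in> Pb"
  using grid[OF assms(2,3) _ assms(4,5)] assms(1) unfolding cm_def by blast

text \<open>The ring criterion needs elements of P on the rays, while the given ones only lie in
  \<open>Pb\<close>; multiples lead from one to the other.\<close>

lemma cm_multiples:
  assumes n: "n1 \<in> Pb" "n2 \<in> Pb" and K: "0 < K1" "0 < K2"
  shows "cm (smul K1 n1) (smul K2 n2) \<longleftrightarrow> cm n1 n2"
proof
  assume c: "cm n1 n2"
  show "cm (smul K1 n1) (smul K2 n2)" unfolding cm_def using cm_grid[OF c n] by blast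
next
  assume c: "cm (smul K1 n1) (smul K2 n2)"
  have up: "a + smul K n \<in> Pb" if "a + n \<in> Pb" "n \<in> Pb" "0 < K" for a n K
  proof -
    obtain K' where "K = Suc K'" using \<open>0 < K\<close> by (metis gr0_implies_Suc)
    then have "a + smul K n = (a + n) + smul K' n" by (simp add: smul_Suc add.assoc)
    then show ?thesis using submonoid_add[OF Pb that(1) submonoid_smul[OF Pb that(2)]] by simp
  qed
  show "cm n1 n2" unfolding cm_def using c[unfolded cm_def] up n K by blast
qed

theorem buchsbaum_iff_cm:
  assumes n: "n1 \<in> Pb" "n1 \<noteq> 0" "l1 n1 = 0" "n2 \<in> Pb" "n2 \<noteq> 0" "l2 n2 = 0"
  shows "buchsbaum_semigroup TYPE('k::field) P \<longleftrightarrow> cm n1 n2"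
proof -
  interpret sw: planar P N Pb l2 l1 by (rule swap)
  obtain K1 where K1: "K1 > 0" "smul K1 n1 \<in> P" using multiple_in_P[OF n(1-3)] by blast
  obtain K2 where K2: "K2 > 0" "smul K2 n2 \<in> P" using sw.multiple_in_P[OF n(4-6)] by blast
  have nz: "smul K1 n1 \<noteq> 0" "smul K2 n2 \<noteq> 0" using n K1 K2 by (auto simp: prod_eq_iff)
  have "l1 (smul K1 n1) = 0" "l2 (smul K2 n2) = 0" using n by (simp_all add: l_smul)
  then interpret s: simplicial_pair P N Pb "{a. l1 a = 0}" "smul K1 n1" "smul K2 n2"
    by (intro simplicial_pair K1 K2 nz)
  show ?thesis unfolding s.buchsbaum_iff cm_def[symmetric] by (rule cm_multiples[OF n(1,4) K1(1) K2(1)])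
qed

text \<open>Compare x on the ray with \<open>n1\<close>. If x = n1 + y with y nonzero, then y + n2
  is interior, hence in \<open>Pb\<close>, so \<open>cm\<close> puts y into \<open>Pb\<close> and
  induction applies. If n1 = x + y with y beyond 0, commensurability gives a multiple of
  \<open>n1\<close> that carries y into \<open>Pb\<close>, so y is in \<open>Pb\<close> and the
  irreducibility of \<open>n1\<close> is violated.\<close>

lemma ray_generated_if_cm:
  assumes c: "cm n1 n2" and n: "n1 \<in> Pb" "n1 \<noteq> 0" "l1 n1 = 0" "n2 \<in> Pb" "n2 \<noteq> 0" "l2 n2 = 0"
    and int: "\<And>a. 0 < l1 a \<Longrightarrow> 0 < l2 a \<Longrightarrow> a \<in> Pb"
    and irr: "\<And>a b. a \<in> {a \<in> Pb. l1 a = 0} \<Longrightarrow> b \<in> {a \<in> Pb. l1 a = 0} \<Longrightarrow> n1 = a + b \<Longrightarrow> a = 0 \<or> b = 0"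
  shows "singly_generated {a \<in> Pb. l1 a = 0}"
proof -
  have p: "0 < l2 n1" "0 < l1 n2" using l_pos n Pb_nonneg by auto
  have "\<exists>k. x = smul k n1" if "x \<in> Pb" "l1 x = 0" for x
    using that
  proof (induction "size1 x" arbitrary: x rule: less_induct)
    case less
    show ?case
    proof (cases "x = 0")
      case True then show ?thesis by (intro exI[of _ 0]) simp
    next
      case x0: False
      show ?thesis
      proof (cases "l2 n1 \<le> l2 x")
        case True
        then obtain y where y: "x = n1 + y" using diff[of n1 x] n less.prems by auto
        have ly: "l1 y = 0" "0 \<le> l2 y" using y less.prems n True by (auto simp: l_add)
        show ?thesis
        proof (cases "y = 0")
          case True then show ?thesis using y by (intro exI[of _ 1]) simp
        next
          case False
          then have "0 < l2 y" using l_pos ly by blast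
          then have "y + n2 \<in> Pb" using ly n p by (intro int) (simp_all add: l_add)
          moreover have "y + n1 \<in> Pb" using y less.prems by (simp add: add.commute)
          ultimately have "y \<in> Pb" using c unfolding cm_def by blast
          moreover have "size1 y < size1 x" using y size1_pos[OF n(2)] by simp
          ultimately obtain k where "y = smul k n1" using less.hyps ly by blast
          then show ?thesis using y by (intro exI[of _ "Suc k"]) (simp add: smul_Suc)
        qed
      next
        case False
        then obtain y where y: "n1 = x + y" using diff[of x n1] n less.prems by auto
        have ly: "l1 y = 0" "0 < l2 y" using y less.prems n False by (auto simp: l_add)
        obtain K k where K: "K > 0" "k > 0" "smul K x = smul k n1"
          using commensurable[of x n1] less.prems Pb_nonneg x0 n by blast
        obtain K' where "K = Suc K'" using K(1) by (metis gr0_implies_Suc)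
        then have "y + smul k n1 = n1 + smul K' x" using y K(3)[symmetric] by (simp add: smul_Suc ac_simps)
        then have A: "y + smul k n1 \<in> Pb" using submonoid_add[OF Pb n(1) submonoid_smul[OF Pb less.prems(1)]] by simp
        have "y + n2 \<in> Pb" using ly n p by (intro int) (simp_all add: l_add)
        then have B: "y + smul 1 n2 \<in> Pb" by simp
        have "y \<in> Pb" by (rule cm_grid[OF c n(1,4) A B])
        then have "x = 0 \<or> y = 0" using irr[of x y] less.prems ly y by simp
        then show ?thesis using x0 ly(2) l_zero by auto
      qed
    qed
  qed
  then have "{a \<in> Pb. l1 a = 0} \<subseteq> range (\<lambda>k. smul k n1)" by blast
  moreover have "range (\<lambda>k. smul k n1) \<subseteq> {a \<in> Pb. l1 a = 0}"
    using submonoid_smul[OF Pb n(1)] n(3) by (auto simp: l_smul)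
  ultimately have "{a \<in> Pb. l1 a = 0} = is_submonoid hull {n1}" unfolding hull_single by blast
  then show ?thesis unfolding singly_generated_def by (rule exI)
qed

text \<open>An irreducible n is a multiple of the generator g with g as a summand, so n = g.\<close>

lemma generated_by_irreducible:
  assumes sg: "singly_generated T" and n: "n \<in> T" "n \<noteq> 0"
    and irr: "\<And>a b. a \<in> T \<Longrightarrow> b \<in> T \<Longrightarrow> n = a + b \<Longrightarrow> a = 0 \<or> b = 0" and a: "a \<in> T"
  shows "\<exists>k. a = smul k n"
proof -
  obtain g where g: "T = range (\<lambda>k. smul k g)" using sg unfolding singly_generated_def hull_single by blast
  obtain k where k: "n = smul k g" using n(1) g by blast
  obtain k' where k': "k = Suc k'" using k n(2) by (cases k) auto
  have "g \<in> T" unfolding g by (intro range_eqI[of _ _ 1]) simp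
  moreover have "smul k' g \<in> T" unfolding g by blast
  moreover have "n = g + smul k' g" using k k' by (simp add: smul_Suc)
  ultimately have "g = 0 \<or> smul k' g = 0" using irr by blast
  then have "n = g" using k k' n(2) by (auto simp: smul_Suc)
  then show ?thesis using a g by blast
qed

text \<open>An interior a is in \<open>Pb\<close> by assumption. On the first ray a + n1 is a
  multiple k n1, with k positive because \<open>n1\<close> is nonzero, so a is (k - 1) n1; the
  second ray is alike.\<close>

lemma cm_if_rays_generated:
  assumes n: "n1 \<in> Pb" "n1 \<noteq> 0" "l1 n1 = 0" "n2 \<in> Pb" "n2 \<noteq> 0" "l2 n2 = 0"
    and int: "\<And>a. 0 < l1 a \<Longrightarrow> 0 < l2 a \<Longrightarrow> a \<in> Pb"
    and sg: "singly_generated {a \<in> Pb. l1 a = 0}" "singly_generated {a \<in> Pb. l2 a = 0}"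
    and irr1: "\<And>a b. a \<in> {a \<in> Pb. l1 a = 0} \<Longrightarrow> b \<in> {a \<in> Pb. l1 a = 0} \<Longrightarrow> n1 = a + b \<Longrightarrow> a = 0 \<or> b = 0"
    and irr2: "\<And>a b. a \<in> {a \<in> Pb. l2 a = 0} \<Longrightarrow> b \<in> {a \<in> Pb. l2 a = 0} \<Longrightarrow> n2 = a + b \<Longrightarrow> a = 0 \<or> b = 0"
  shows "cm n1 n2"
  unfolding cm_def
proof (intro allI impI)
  fix a assume a: "a + n1 \<in> Pb" "a + n2 \<in> Pb"
  have ge: "0 \<le> l1 a" "0 \<le> l2 a" using Pb_nonneg[OF a(1)] Pb_nonneg[OF a(2)] n by (auto simp: l_add)
  have fin: "a \<in> Pb" if "a + n = smul k n" "n \<in> Pb" "n \<noteq> 0" for n k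
  proof (cases k)
    case 0
    then show ?thesis using that by (auto simp: prod_eq_iff)
  next
    case (Suc k')
    then have "n + a = n + smul k' n" using that(1) by (simp add: smul_Suc add.commute)
    then have "a = smul k' n" by simp
    then show ?thesis using submonoid_smul[OF Pb that(2)] by simp
  qed
  consider "0 < l1 a" "0 < l2 a" | "l1 a = 0" | "l2 a = 0" using ge by linarith
  then show "a \<in> Pb"
  proof cases
    case 1 then show ?thesis by (rule int)
  next
    case 2
    then have "a + n1 \<in> {a \<in> Pb. l1 a = 0}" "n1 \<in> {a \<in> Pb. l1 a = 0}" using a n by (simp_all add: l_add)
    then obtain k where "a + n1 = smul k n1" using generated_by_irreducible[OF sg(1) _ n(2) irr1] by blast
    then show ?thesis using fin n by blast
  next
    case 3
    then have "a + n2 \<in> {a \<in> Pb. l2 a = 0}" "n2 \<in> {a \<in> Pb. l2 a = 0}" using a n by (simp_all add: l_add)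
    then obtain k where "a + n2 = smul k n2" using generated_by_irreducible[OF sg(2) _ n(5) irr2] by blast
    then show ?thesis using fin n by blast
  qed
qed

end

section \<open>Vertices and extremal rays\<close>

definition det2 :: "real \<times> real \<Rightarrow> real \<times> real \<Rightarrow> real" where
  "det2 x y = fst x * snd y - snd x * fst y"

lemma det2_halfplane: "convex {x. 0 \<le> det2 w (x - p)}"
proof -
  have "{x. 0 \<le> det2 w (x - p)} = {x. (- snd w, fst w) \<bullet> x \<ge> det2 w p}"
    by (auto simp: det2_def inner_prod_def algebra_simps)
  then show ?thesis by (simp only: convex_halfspace_ge)
qed

lemma det2_halfplane': "convex {x. 0 \<le> det2 (x - p) w}"
proof -
  have "{x. 0 \<le> det2 (x - p) w} = {x. 0 \<le> det2 (- w) (x - p)}"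
    by (auto simp: det2_def algebra_simps)
  then show ?thesis by (simp only: det2_halfplane)
qed

text \<open>The oriented triples with indices 0, 1, i and 0, i, last place all vertices, hence F, in
  the angle at \<open>vs ! 0\<close>. There are at least three vertices because F is not a
  segment.\<close>

lemma ccw_corner:
  assumes F: "polytope F" "F \<noteq> {}" "\<not> (\<exists>a b. F = closed_segment a b)" and ccw: "ccw_vertices F vs"
  shows "vs ! 0 \<in> F" "vs ! 1 \<in> F" "last vs \<in> F" "0 < det2 (vs ! 1 - vs ! 0) (last vs - vs ! 0)"
    and "x \<in> F \<Longrightarrow> 0 \<le> det2 (vs ! 1 - vs ! 0) (x - vs ! 0)"
    and "x \<in> F \<Longrightarrow> 0 \<le> det2 (x - vs ! 0) (last vs - vs ! 0)"
proof -
  have ext: "set vs = {v. v extreme_point_of F}"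
    and pos: "\<And>i j k. i < j \<Longrightarrow> j < k \<Longrightarrow> k < length vs \<Longrightarrow> 0 < det2 (vs ! j - vs ! i) (vs ! k - vs ! i)"
    using ccw unfolding ccw_vertices_def det2_def by auto
  have hull: "F = convex hull (set vs)"
    unfolding ext using Krein_Milman_Minkowski[OF polytope_imp_compact[OF F(1)] polytope_imp_convex[OF F(1)]] .
  have len: "3 \<le> length vs"
  proof (rule ccontr)
    assume "\<not> 3 \<le> length vs"
    then consider "vs = []" | a where "vs = [a]" | a b where "vs = [a, b]"
      by (cases vs; cases "tl vs"; cases "tl (tl vs)") auto
    then show False
    proof cases
      case 1 then show ?thesis using hull F(2) by simp
    next
      case 2
      then have "F = closed_segment a a" using hull by simp
      then show ?thesis using F(3) by blast
    next
      case 3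
      then have "F = closed_segment a b" using hull by (simp add: segment_convex_hull)
      then show ?thesis using F(3) by blast
    qed
  qed
  have lst: "last vs = vs ! (length vs - 1)" using len by (intro last_conv_nth) auto
  have inF: "vs ! i \<in> F" if "i < length vs" for i
    unfolding hull using that by (intro hull_inc) simp
  show "vs ! 0 \<in> F" using len by (intro inF) linarith
  show "vs ! 1 \<in> F" using len by (intro inF) linarith
  show "last vs \<in> F" unfolding lst using len by (intro inF) linarith
  show "0 < det2 (vs ! 1 - vs ! 0) (last vs - vs ! 0)" unfolding lst using len by (intro pos) auto
  have "set vs \<subseteq> {x. 0 \<le> det2 (vs ! 1 - vs ! 0) (x - vs ! 0)}"
  proof
    fix y assume "y \<in> set vs"
    then obtain i where "i < length vs \<and> vs ! i = y" unfolding in_set_conv_nth by (rule exE)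
    then have i: "i < length vs" "y = vs ! i" by simp_all
    consider "i = 0" | "i = 1" | "1 < i" by linarith
    then have "0 \<le> det2 (vs ! 1 - vs ! 0) (vs ! i - vs ! 0)"
    proof cases
      case 3 then show ?thesis using pos[of 0 1 i] i(1) by simp
    qed (simp_all add: det2_def)
    then show "y \<in> {x. 0 \<le> det2 (vs ! 1 - vs ! 0) (x - vs ! 0)}" using i(2) by simp
  qed
  then have "F \<subseteq> {x. 0 \<le> det2 (vs ! 1 - vs ! 0) (x - vs ! 0)}"
    unfolding hull by (intro hull_minimal det2_halfplane)
  then show "x \<in> F \<Longrightarrow> 0 \<le> det2 (vs ! 1 - vs ! 0) (x - vs ! 0)" by blast
  have "set vs \<subseteq> {x. 0 \<le> det2 (x - vs ! 0) (last vs - vs ! 0)}"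
  proof
    fix y assume "y \<in> set vs"
    then obtain i where "i < length vs \<and> vs ! i = y" unfolding in_set_conv_nth by (rule exE)
    then have i: "i < length vs" "y = vs ! i" by simp_all
    consider "i = 0" | "0 < i" "i < length vs - 1" | "i = length vs - 1" using i(1) by linarith
    then have "0 \<le> det2 (vs ! i - vs ! 0) (vs ! (length vs - 1) - vs ! 0)"
    proof cases
      case 2
      have "length vs - 1 < length vs" using i(1) by linarith
      then show ?thesis using pos[OF 2] by (simp only: less_imp_le)
    qed (simp_all add: det2_def)
    then show "y \<in> {x. 0 \<le> det2 (x - vs ! 0) (last vs - vs ! 0)}" using i(2) lst by simp
  qed
  then have "F \<subseteq> {x. 0 \<le> det2 (x - vs ! 0) (last vs - vs ! 0)}"
    unfolding hull by (intro hull_minimal det2_halfplane')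
  then show "x \<in> F \<Longrightarrow> 0 \<le> det2 (x - vs ! 0) (last vs - vs ! 0)" by blast
qed

text \<open>A point of the cone with a negative coefficient at \<open>w\<close> would put \<open>w\<close> on the face spanned by \<open>v\<close>.\<close>

lemma face_coefficient:
  fixes F :: "(real \<times> real) set"
  defines "K \<equiv> convex_cone hull F"
  assumes face: "{c *\<^sub>R v | c. 0 \<le> c} face_of K" and w: "w \<in> K" and x: "x \<in> K" "x = a *\<^sub>R v + b *\<^sub>R w"
    and pos: "\<And>y. y \<in> K \<Longrightarrow> 0 \<le> fst y \<and> 0 \<le> snd y" and ind: "det2 w v \<noteq> 0"
  shows "0 \<le> b"
proof (rule ccontr)
  assume "\<not> 0 \<le> b"
  then have b: "b < 0" by simp
  have vK: "v \<in> K"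
  proof -
    have "1 *\<^sub>R v \<in> {c *\<^sub>R v | c. 0 \<le> c}" by (intro CollectI exI[of _ 1]) simp
    then show ?thesis using face face_of_imp_subset by auto
  qed
  have w0: "fst w \<noteq> 0 \<or> snd w \<noteq> 0" using ind by (auto simp: det2_def)
  define y where "y = (- b) *\<^sub>R w"
  have yK: "y \<in> K" unfolding y_def K_def using w b by (intro convex_cone_hull_mul) (auto simp: K_def)
  have sum: "x + y = a *\<^sub>R v" by (simp add: x(2) y_def)
  have ypos: "0 < fst y \<or> 0 < snd y" using pos[OF w] w0 b by (auto simp: y_def mult_neg_pos zero_less_mult_iff order_le_less)
  \<comment> \<open>A negative a would make the sum of two points of the quadrant nonpositive,
    although y is not 0.\<close>
  have sv: "0 \<le> a"
  proof (rule ccontr)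
    assume "\<not> 0 \<le> a"
    then have "a * fst v \<le> 0" "a * snd v \<le> 0" using pos[OF vK] by (auto simp: mult_nonpos_nonneg)
    moreover have "fst x + fst y = a * fst v" "snd x + snd y = a * snd v"
      using arg_cong[OF sum, of fst] arg_cong[OF sum, of snd] by simp_all
    ultimately show False using pos[OF x(1)] pos[OF yK] ypos by linarith
  qed
  have ne: "x \<noteq> y"
  proof
    assume "x = y"
    then have "det2 x v = det2 y v" by simp
    moreover have "det2 x v = b * det2 w v" unfolding x(2) by (simp add: det2_def algebra_simps)
    moreover have "det2 y v = - b * det2 w v" unfolding y_def by (simp add: det2_def algebra_simps)
    ultimately have "b * det2 w v = 0" by simp
    then show False using b ind by simp
  qed
  \<comment> \<open>The midpoint of x and y lies on the face, so the face contains y, a multiple of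
    w.\<close>
  have "midpoint x y = (a / 2) *\<^sub>R v" unfolding midpoint_def sum by simp
  then have m1: "midpoint x y \<in> {c *\<^sub>R v | c. 0 \<le> c}" using sv by (intro CollectI exI[of _ "a / 2"]) simp
  have m2: "midpoint x y \<in> open_segment x y" using ne by simp
  have "y \<in> {c *\<^sub>R v | c. 0 \<le> c}" using face_ofD[OF face m2 x(1) yK m1] by (rule conjunct2)
  then obtain c where "(- b) *\<^sub>R w = c *\<^sub>R v" unfolding y_def by blast
  then have "det2 ((- b) *\<^sub>R w) v = det2 (c *\<^sub>R v) v" by simp
  moreover have "det2 ((- b) *\<^sub>R w) v = - (b * det2 w v)" "det2 (c *\<^sub>R v) v = 0"
    by (simp_all add: det2_def algebra_simps)
  ultimately have "b * det2 w v = 0" by simp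
  then show False using b ind by simp
qed

context wedge
begin

lemma single_side:
  assumes single: "F \<inter> {r *\<^sub>R v | r. 0 \<le> r} = {p}" and strip: "strip p A B {r *\<^sub>R v' | r. 0 \<le> r} \<nu> \<Upsilon>"
    and AB: "A \<in> F" "B \<in> F" and orient: "0 < D (B - p) (A - p)"
    and corner: "\<And>x. x \<in> F \<Longrightarrow> 0 \<le> D (B - p) (x - p) \<and> 0 \<le> D (x - p) (A - p)"
  shows "\<exists>c. side \<nu> \<Upsilon> c"
proof -
  obtain s where s: "s > 0" "s *\<^sub>R v \<in> F" using F_ray by blast
  then have "s *\<^sub>R v \<in> F \<inter> {r *\<^sub>R v | r. 0 \<le> r}" by (intro IntI CollectI exI[of _ s]) auto
  then have "s *\<^sub>R v \<in> {p}" unfolding single .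
  then have p: "p = s *\<^sub>R v" by simp
  have off: "0 < D z v" if "z \<in> F" "z \<noteq> p" for z
  proof -
    have "D z v \<noteq> 0" using on_ray_iff[OF F_W[OF that(1)]] that single by blast
    then show ?thesis using F_wedge[OF that(1)] by simp
  qed
  have "A \<noteq> p" "B \<noteq> p" using orient by (auto simp: D_simps)
  then have off': "0 < D A v" "0 < D B v" using off AB by simp_all
  have pF: "p \<in> F" unfolding p by (rule s(2))
  interpret c: corner F \<epsilon> v v' D p A B s
  proof unfold_locales
    show "0 < \<epsilon> * (fst (B - p) * snd (A - p) - snd (B - p) * fst (A - p))" using orient unfolding D_def .
    show "0 < \<epsilon> * (fst A * snd v - snd A * fst v)" "0 < \<epsilon> * (fst B * snd v - snd B * fst v)"
      using off' unfolding D_def by simp_all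
    fix x assume "x \<in> F"
    then show "0 \<le> \<epsilon> * (fst (B - p) * snd (x - p) - snd (B - p) * fst (x - p)) \<and>
      0 \<le> \<epsilon> * (fst (x - p) * snd (A - p) - snd (x - p) * fst (A - p))" using corner unfolding D_def by blast
  qed (use s(1) p pF AB in simp_all)
  show ?thesis using c.strip_side[OF strip single] by blast
qed

text \<open>Here finite generation enters. If P had no nonzero element on the ray, its finitely many
  generators, and with them P, would stay above some slope \<rho>, against
  \<open>small_slope\<close>.\<close>

lemma ray_point:
  assumes int: "interior F \<noteq> {}" and N: "finite N" "polygonal_semigroup F = is_submonoid hull N"
  shows "\<exists>u\<in>polygonal_semigroup F. u \<noteq> 0 \<and> D (pt u) v = 0"
proof (rule ccontr)
  assume none: "\<not> ?thesis"
  define sz where "sz a = fst (pt a) + snd (pt a)" for a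
  have sz: "0 < sz a" if "a \<noteq> 0" for a using that by (auto simp: sz_def pt_def prod_eq_iff)
  have pos: "0 < D (pt g) v" if "g \<in> N" "g \<noteq> 0" for g
  proof -
    have gP: "g \<in> polygonal_semigroup F" unfolding N(2) using that(1) by (rule hull_inc)
    then have "0 \<le> D (pt g) v" using P_W by (simp add: W_def)
    moreover have "D (pt g) v \<noteq> 0" using none gP that(2) by blast
    ultimately show ?thesis by simp
  qed
  \<comment> \<open>Inserting 1 keeps the set nonempty and its minimum positive.\<close>
  define R where "R = insert 1 ((\<lambda>g. D (pt g) v / sz g) ` (N - {0}))"
  define \<rho> where "\<rho> = Min R"
  have fin: "finite R" "R \<noteq> {}" using N(1) by (auto simp: R_def)
  have rpos: "0 < \<rho>" unfolding \<rho>_def using fin pos sz by (subst Min_gr_iff) (auto simp: R_def)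
  have rle: "\<rho> * sz g \<le> D (pt g) v" if "g \<in> N" for g
  proof (cases "g = 0")
    case True then show ?thesis by (simp add: sz_def D_simps)
  next
    case False
    then have "\<rho> \<le> D (pt g) v / sz g" unfolding \<rho>_def using fin that by (intro Min_le) (auto simp: R_def)
    then show ?thesis using sz[OF False] by (simp add: pos_le_divide_eq)
  qed
  have "is_submonoid {a. \<rho> * sz a \<le> D (pt a) v}"
    by (rule is_submonoidI) (auto simp: sz_def D_simps algebra_simps)
  moreover have "N \<subseteq> {a. \<rho> * sz a \<le> D (pt a) v}" using rle by blast
  ultimately have "is_submonoid hull N \<subseteq> {a. \<rho> * sz a \<le> D (pt a) v}" by (intro hull_minimal)
  moreover obtain a where "a \<in> polygonal_semigroup F" "D (pt a) v < \<rho> * sz a"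
    using small_slope[OF int rpos] unfolding sz_def by blast
  ultimately show False unfolding N(2) by fastforce
qed

lemma lattice_diff:
  assumes "D (pt b) v \<le> D (pt a) v" "D v' (pt b) \<le> D v' (pt a)" shows "\<exists>z. a = b + z"
proof -
  have "pt a - pt b \<in> W" using assms by (simp add: W_def D_simps)
  then have "0 \<le> fst (pt a - pt b) \<and> 0 \<le> snd (pt a - pt b)" by (rule W_pos)
  then have "fst b \<le> fst a" "snd b \<le> snd a" by (simp_all add: pt_def)
  then have "a = b + (fst a - fst b, snd a - snd b)" by (simp add: prod_eq_iff)
  then show ?thesis by (rule exI)
qed

text \<open>Cramer's rule over the integers with determinants K, I and J. Multiplied by \<epsilon>
  all three are nonnegative, so they share a sign and absolute values may be taken.\<close>

lemma lattice_cramer: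
  assumes a: "0 \<le> D (pt a) v" "0 \<le> D v' (pt a)"
    and m: "D (pt m1) v = 0" "0 < D v' (pt m1)" "D v' (pt m2) = 0" "0 < D (pt m2) v"
  shows "\<exists>k>0. \<exists>i j. smul k a = smul i m1 + smul j m2"
proof -
  define d where "d = D v' v"
  have d: "0 < d" using d_pos by (simp add: d_def)
  define \<alpha> where "\<alpha> = D v' (pt m1) / d"
  define \<beta> where "\<beta> = D (pt m2) v / d"
  have ab: "0 < \<alpha>" "0 < \<beta>" using m d by (simp_all add: \<alpha>_def \<beta>_def)
  have m1: "pt m1 = \<alpha> *\<^sub>R v" using dec'[of "pt m1"] m by (simp add: \<alpha>_def d_def)
  have m2: "pt m2 = \<beta> *\<^sub>R v'" using dec'[of "pt m2"] m by (simp add: \<beta>_def d_def)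
  define K I J where "K = int (fst m2) * int (snd m1) - int (snd m2) * int (fst m1)"
    and "I = int (fst m2) * int (snd a) - int (snd m2) * int (fst a)"
    and "J = int (fst a) * int (snd m1) - int (snd a) * int (fst m1)"
  have eK: "\<epsilon> * of_int K = \<beta> * \<alpha> * d"
  proof -
    have "\<epsilon> * of_int K = D (pt m2) (pt m1)" by (simp add: K_def D_def pt_def)
    also have "\<dots> = \<beta> * \<alpha> * d" unfolding m1 m2 by (simp add: D_simps d_def)
    finally show ?thesis .
  qed
  have eI: "\<epsilon> * of_int I = \<beta> * D v' (pt a)"
  proof -
    have "\<epsilon> * of_int I = D (pt m2) (pt a)" by (simp add: I_def D_def pt_def)
    also have "\<dots> = \<beta> * D v' (pt a)" unfolding m2 by (simp add: D_simps)
    finally show ?thesis .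
  qed
  have eJ: "\<epsilon> * of_int J = \<alpha> * D (pt a) v"
  proof -
    have "\<epsilon> * of_int J = D (pt a) (pt m1)" by (simp add: J_def D_def pt_def)
    also have "\<dots> = \<alpha> * D (pt a) v" unfolding m1 by (simp add: D_simps)
    finally show ?thesis .
  qed
  have ge: "0 < \<epsilon> * of_int K" "0 \<le> \<epsilon> * of_int I" "0 \<le> \<epsilon> * of_int J"
    using ab d a by (simp_all add: eK eI eJ)
  have id: "K * int (fst a) = I * int (fst m1) + J * int (fst m2)" "K * int (snd a) = I * int (snd m1) + J * int (snd m2)"
    by (simp_all add: K_def I_def J_def algebra_simps)
  have abs: "\<bar>K\<bar> * int (fst a) = \<bar>I\<bar> * int (fst m1) + \<bar>J\<bar> * int (fst m2)"
    "\<bar>K\<bar> * int (snd a) = \<bar>I\<bar> * int (snd m1) + \<bar>J\<bar> * int (snd m2)" "K \<noteq> 0"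
  proof -
    have "\<epsilon> \<noteq> 0" "K \<noteq> 0" using ge(1) by auto
    then have "(0 < K \<and> 0 \<le> I \<and> 0 \<le> J) \<or> (K < 0 \<and> I \<le> 0 \<and> J \<le> 0)"
    proof (cases "0 < \<epsilon>")
      case True then show ?thesis using ge by (auto simp: zero_less_mult_iff zero_le_mult_iff)
    next
      case False
      then have "\<epsilon> < 0" using \<open>\<epsilon> \<noteq> 0\<close> by simp
      then show ?thesis using ge by (auto simp: zero_less_mult_iff zero_le_mult_iff)
    qed
    then show "\<bar>K\<bar> * int (fst a) = \<bar>I\<bar> * int (fst m1) + \<bar>J\<bar> * int (fst m2)"
      "\<bar>K\<bar> * int (snd a) = \<bar>I\<bar> * int (snd m1) + \<bar>J\<bar> * int (snd m2)"
      using id by (auto simp: abs_if)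
    show "K \<noteq> 0" by fact
  qed
  have n: "nat \<bar>K\<bar> * fst a = nat \<bar>I\<bar> * fst m1 + nat \<bar>J\<bar> * fst m2" "nat \<bar>K\<bar> * snd a = nat \<bar>I\<bar> * snd m1 + nat \<bar>J\<bar> * snd m2"
    using abs(1,2) by (simp_all add: of_nat_eq_iff[where 'a=int, symmetric])
  then have "smul (nat \<bar>K\<bar>) a = smul (nat \<bar>I\<bar>) m1 + smul (nat \<bar>J\<bar>) m2" by (simp add: prod_eq_iff)
  moreover have "nat \<bar>K\<bar> > 0" using abs(3) by simp
  ultimately show ?thesis by blast
qed

lemma rat_cone_W: "rat_cone F \<subseteq> W"
  by (rule rat_cone_minimal) (auto simp: W_add W_def D_simps F_wedge)

end

text \<open>The sign comes from \<open>face_coefficient\<close> in the basis v, w. For the point of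
  F on the ray: the cone over a convex set consists of multiples c f, so v is one of these, with c
  nonzero.\<close>

lemma wedge_of_faces:
  fixes F :: "(real \<times> real) set"
  assumes F: "convex F" "\<And>x. x \<in> F \<Longrightarrow> 0 \<le> fst x \<and> 0 \<le> snd x"
    and face: "{c *\<^sub>R v | c. 0 \<le> c} face_of (convex_cone hull F)" "{c *\<^sub>R w | c. 0 \<le> c} face_of (convex_cone hull F)"
    and ne: "F \<noteq> {}" and det: "0 < \<epsilon> * det2 w v"
  shows "x \<in> F \<Longrightarrow> 0 \<le> \<epsilon> * det2 x v" "\<exists>s>0. s *\<^sub>R v \<in> F"
proof -
  let ?K = "convex_cone hull F"
  have "convex_cone {x :: real \<times> real. 0 \<le> fst x \<and> 0 \<le> snd x}" by (simp add: convex_cone_iff)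
  moreover have "F \<subseteq> {x. 0 \<le> fst x \<and> 0 \<le> snd x}" using F(2) by blast
  ultimately have "?K \<subseteq> {x. 0 \<le> fst x \<and> 0 \<le> snd x}" by (rule hull_minimal[rotated])
  then have pos: "\<And>y. y \<in> ?K \<Longrightarrow> 0 \<le> fst y \<and> 0 \<le> snd y" by blast
  have mem: "u \<in> {c *\<^sub>R u | c. 0 \<le> c}" for u :: "real \<times> real" by (intro CollectI exI[of _ 1]) simp
  have vK: "v \<in> ?K" by (rule subsetD[OF face_of_imp_subset[OF face(1)] mem])
  have wK: "w \<in> ?K" by (rule subsetD[OF face_of_imp_subset[OF face(2)] mem])
  have d0: "det2 w v \<noteq> 0" using det by auto
  show "0 \<le> \<epsilon> * det2 x v" if "x \<in> F"
  proof -
    have xK: "x \<in> ?K" using that by (rule hull_inc)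
    define a b where "a = det2 w x / det2 w v" and "b = det2 x v / det2 w v"
    have "det2 w v *\<^sub>R x = det2 w x *\<^sub>R v + det2 x v *\<^sub>R w" by (simp add: det2_def prod_eq_iff algebra_simps)
    then have "(1 / det2 w v) *\<^sub>R (det2 w v *\<^sub>R x) = (1 / det2 w v) *\<^sub>R (det2 w x *\<^sub>R v + det2 x v *\<^sub>R w)" by simp
    then have x: "x = a *\<^sub>R v + b *\<^sub>R w" using d0 by (simp add: a_def b_def scaleR_right_distrib)
    have "0 \<le> b" by (rule face_coefficient[OF face(1) wK xK x pos d0])
    then have "0 \<le> b * (\<epsilon> * det2 w v)" by (rule mult_nonneg_nonneg[OF _ less_imp_le[OF det]])
    moreover have "b * (\<epsilon> * det2 w v) = \<epsilon> * det2 x v" using d0 by (simp add: b_def)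
    ultimately show ?thesis by metis
  qed
  have "convex_cone {c *\<^sub>R f | c f. 0 \<le> c \<and> f \<in> F}" unfolding convex_cone_iff
  proof (intro conjI ballI allI impI)
    obtain f where "f \<in> F" using ne by blast
    then show "0 \<in> {c *\<^sub>R f | c f. 0 \<le> c \<and> f \<in> F}" by (intro CollectI exI[of _ 0] exI[of _ f]) simp
  next
    fix x y assume "x \<in> {c *\<^sub>R f | c f. 0 \<le> c \<and> f \<in> F}" "y \<in> {c *\<^sub>R f | c f. 0 \<le> c \<and> f \<in> F}"
    then obtain c f d g where c: "x = c *\<^sub>R f" "0 \<le> c" "f \<in> F" and d: "y = d *\<^sub>R g" "0 \<le> d" "g \<in> F" by blast
    have "x + y \<in> (\<lambda>y. (c + d) *\<^sub>R y) ` F"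
      unfolding c(1) d(1) by (intro dilate_add[OF F(1)] imageI c d)
    then obtain h where "x + y = (c + d) *\<^sub>R h" "h \<in> F" by blast
    then show "x + y \<in> {c *\<^sub>R f | c f. 0 \<le> c \<and> f \<in> F}" using c d by (intro CollectI exI[of _ "c + d"] exI[of _ h]) simp
  next
    fix x and r :: real assume "x \<in> {c *\<^sub>R f | c f. 0 \<le> c \<and> f \<in> F}" "0 \<le> r"
    then obtain c f where c: "x = c *\<^sub>R f" "0 \<le> c" "f \<in> F" by blast
    then show "r *\<^sub>R x \<in> {c *\<^sub>R f | c f. 0 \<le> c \<and> f \<in> F}" using \<open>0 \<le> r\<close> by (intro CollectI exI[of _ "r * c"] exI[of _ f]) simp
  qed
  moreover have "F \<subseteq> {c *\<^sub>R f | c f. 0 \<le> c \<and> f \<in> F}"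
  proof
    fix f assume "f \<in> F"
    then show "f \<in> {c *\<^sub>R f | c f. 0 \<le> c \<and> f \<in> F}" by (intro CollectI exI[of _ 1] exI[of _ f]) simp
  qed
  ultimately have "?K \<subseteq> {c *\<^sub>R f | c f. 0 \<le> c \<and> f \<in> F}" by (rule hull_minimal[rotated])
  then have "v \<in> {c *\<^sub>R f | c f. 0 \<le> c \<and> f \<in> F}" using vK by (rule subsetD)
  then obtain c f where c: "v = c *\<^sub>R f" "0 \<le> c" "f \<in> F" by blast
  have "c \<noteq> 0" using d0 c(1) by (auto simp: det2_def)
  then have "(1 / c) *\<^sub>R v = f" "0 < 1 / c" using c by simp_all
  then show "\<exists>s>0. s *\<^sub>R v \<in> F" using c(3) by (intro exI[of _ "1 / c"]) simp
qed

section \<open>The semigroup of a polygon\<close>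

locale polygon_rays =
  fixes F :: "(real \<times> real) set" and v1 v2 :: "real \<times> real"
  assumes polygon: "polytope F" "F \<noteq> {}" "\<not> (\<exists>a b. F = closed_segment a b)"
    and nonneg: "\<And>x. x \<in> F \<Longrightarrow> 0 \<le> fst x \<and> 0 \<le> snd x"
    and face: "{c *\<^sub>R v1 | c. 0 \<le> c} face_of (convex_cone hull F)" "{c *\<^sub>R v2 | c. 0 \<le> c} face_of (convex_cone hull F)"
    and det: "0 < det2 v2 v1"
begin

text \<open>The factors 1 and - 1 are kept so that the terms match the \<open>defines\<close> clause
  of \<open>wedge\<close> literally.\<close>

abbreviation "D1 \<equiv> \<lambda>x y :: real \<times> real. 1 * (fst x * snd y - snd x * fst y)"
abbreviation "D2 \<equiv> \<lambda>x y :: real \<times> real. - 1 * (fst x * snd y - snd x * fst y)"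

lemma D12: "D1 x y = det2 x y" "D2 x y = - det2 x y" "D2 x y = det2 y x"
  by (simp_all add: det2_def)

lemma convF: "convex F" using polygon(1) by (rule polytope_imp_convex)

lemma F_side: "x \<in> F \<Longrightarrow> 0 \<le> det2 x v1" "x \<in> F \<Longrightarrow> 0 \<le> det2 v2 x" "\<exists>s>0. s *\<^sub>R v1 \<in> F" "\<exists>s>0. s *\<^sub>R v2 \<in> F"
proof -
  have a: "0 < 1 * det2 v2 v1" and b: "0 < - 1 * det2 v1 v2" using det by (simp_all add: det2_def algebra_simps)
  show "\<exists>s>0. s *\<^sub>R v1 \<in> F" by (rule wedge_of_faces(2)[OF convF nonneg face polygon(2) a])
  show "\<exists>s>0. s *\<^sub>R v2 \<in> F" by (rule wedge_of_faces(2)[OF convF nonneg face(2,1) polygon(2) b])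
  show "0 \<le> det2 x v1" if "x \<in> F" using wedge_of_faces(1)[OF convF nonneg face polygon(2) a that] by simp
  show "0 \<le> det2 v2 x" if "x \<in> F" using wedge_of_faces(1)[OF convF nonneg face(2,1) polygon(2) b that]
    by (simp add: det2_def algebra_simps)
qed

sublocale w1: wedge F 1 v1 v2 D1
proof unfold_locales
  show "0 < 1 * (fst v2 * snd v1 - snd v2 * fst v1)" using det by (simp add: det2_def)
  fix x assume x: "x \<in> F"
  show "0 \<le> fst x \<and> 0 \<le> snd x" by (rule nonneg[OF x])
  show "0 \<le> 1 * (fst x * snd v1 - snd x * fst v1) \<and> 0 \<le> 1 * (fst v2 * snd x - snd v2 * fst x)"
    using F_side(1,2)[OF x] by (simp add: det2_def)
qed (use convF F_side in auto)

sublocale w2: wedge F "- 1" v2 v1 D2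
proof unfold_locales
  show "0 < - 1 * (fst v1 * snd v2 - snd v1 * fst v2)" using det by (simp add: det2_def algebra_simps)
  fix x assume x: "x \<in> F"
  show "0 \<le> fst x \<and> 0 \<le> snd x" by (rule nonneg[OF x])
  show "0 \<le> - 1 * (fst x * snd v2 - snd x * fst v2) \<and> 0 \<le> - 1 * (fst v1 * snd x - snd v1 * fst x)"
    using F_side(1,2)[OF x] by (simp add: det2_def algebra_simps)
qed (use convF F_side in auto)

definition l1 :: "nat \<times> nat \<Rightarrow> real" where "l1 a = det2 (pt a) v1"
definition l2 :: "nat \<times> nat \<Rightarrow> real" where "l2 a = det2 v2 (pt a)"

lemma D_l: "D1 (pt a) v1 = l1 a" "D1 v2 (pt a) = l2 a" "D2 (pt a) v2 = l2 a" "D2 v1 (pt a) = l1 a"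
  by (simp_all add: l1_def l2_def det2_def algebra_simps)

lemma W_iff: "pt a \<in> w1.W \<longleftrightarrow> 0 \<le> l1 a \<and> 0 \<le> l2 a" "pt a \<in> w2.W \<longleftrightarrow> 0 \<le> l1 a \<and> 0 \<le> l2 a"
  unfolding w1.W_def w2.W_def mem_Collect_eq D_l by blast+

lemma ray_iff:
  assumes "0 \<le> l1 a" "0 \<le> l2 a"
  shows "pt a \<in> {c *\<^sub>R v1 | c. 0 \<le> c} \<longleftrightarrow> l1 a = 0" "pt a \<in> {c *\<^sub>R v2 | c. 0 \<le> c} \<longleftrightarrow> l2 a = 0"
  using w1.on_ray_iff[of "pt a"] w2.on_ray_iff[of "pt a"] assms unfolding W_iff D_l by blast+

lemma int: "interior F \<noteq> {}" by (rule w1.interior_nonempty[OF polygon(3)])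

lemma planar:
  assumes mg: "minimal_generating_set N P" and P: "P = polygonal_semigroup F" and affine: "affine_semigroup P"
  shows "planar P N (semigroup_bar N P) l1 l2"
proof -
  obtain A where A: "finite A" "P = is_submonoid hull A" using affine unfolding affine_semigroup_def by blast
  have fin: "finite N" by (rule finite_minimal_generating_set[OF mg A])
  have hull: "P = is_submonoid hull N" using mg by (simp add: minimal_generating_set_def)
  have hull': "polygonal_semigroup F = is_submonoid hull N" using hull P by simp
  show ?thesis
  proof unfold_locales
    show "finite N" "P = is_submonoid hull N" by (rule fin, rule hull)
    show "0 \<notin> N" using minimal_generator_irreducible(2)[OF mg] by blast
    show "semigroup_bar N P = {a. \<forall>n\<in>N. a + n \<in> P}" by (simp add: semigroup_bar_def)
    show "l1 (a + b) = l1 a + l1 b" "l2 (a + b) = l2 a + l2 b" for a b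
      by (simp_all add: l1_def l2_def det2_def algebra_simps)
    show "0 \<le> l1 a" "0 \<le> l2 a" if "a \<in> P" for a
      using w1.P_W[of a] that unfolding P W_iff by blast+
    show "\<exists>z. a = b + z" if "l1 b \<le> l1 a" "l2 b \<le> l2 a" for a b
      by (rule w1.lattice_diff) (simp_all only: D_l that)
    show "\<exists>k>0. \<exists>i j. smul k a = smul i m1 + smul j m2"
      if "0 \<le> l1 a" "0 \<le> l2 a" "l1 m1 = 0" "0 < l2 m1" "l2 m2 = 0" "0 < l1 m2" for a m1 m2
      by (rule w1.lattice_cramer) (simp_all only: D_l that)
    show "\<exists>u\<in>P. u \<noteq> 0 \<and> l1 u = 0" using w1.ray_point[OF int fin hull'] unfolding P D_l .
    show "\<exists>u\<in>P. u \<noteq> 0 \<and> l2 u = 0" using w2.ray_point[OF int fin hull'] unfolding P D_l .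
  qed
qed

lemma side1:
  assumes "nu_upsilon_1 F {c *\<^sub>R v1 | c. 0 \<le> c} {c *\<^sub>R v2 | c. 0 \<le> c} \<nu> \<Upsilon>" shows "\<exists>c. w1.side \<nu> \<Upsilon> c"
  using assms unfolding nu_upsilon_1_def
proof (elim disjE exE conjE)
  fix vs assume ccw: "ccw_vertices F vs" and single: "F \<inter> {c *\<^sub>R v1 | c. 0 \<le> c} = {vs ! 0}"
    and strip: "strip (vs ! 0) (last vs) (vs ! 1) {c *\<^sub>R v2 | c. 0 \<le> c} \<nu> \<Upsilon>"
  note c = ccw_corner[OF polygon ccw]
  show ?thesis
    by (rule w1.single_side[OF single strip c(3,2)]) (use c(4,5,6) in \<open>simp_all only: D12\<close>)
next
  assume "segment_case F {c *\<^sub>R v1 | c. 0 \<le> c} \<nu> \<Upsilon>"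
  then show ?thesis using w1.segment_side by blast
qed

text \<open>The reversed orientation at the second ray exchanges the two neighbours of the
  vertex.\<close>

lemma side2:
  assumes "nu_upsilon_2 F {c *\<^sub>R v1 | c. 0 \<le> c} {c *\<^sub>R v2 | c. 0 \<le> c} \<nu> \<Upsilon>" shows "\<exists>c. w2.side \<nu> \<Upsilon> c"
  using assms unfolding nu_upsilon_2_def
proof (elim disjE exE conjE)
  fix vs assume ccw: "ccw_vertices F vs" and single: "F \<inter> {c *\<^sub>R v2 | c. 0 \<le> c} = {vs ! 0}"
    and strip: "strip (vs ! 0) (vs ! 1) (last vs) {c *\<^sub>R v1 | c. 0 \<le> c} \<nu> \<Upsilon>"
  note c = ccw_corner[OF polygon ccw]
  show ?thesis
    by (rule w2.single_side[OF single strip c(2,3)]) (use c(4,5,6) in \<open>simp_all only: D12(3)\<close>)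
next
  assume "segment_case F {c *\<^sub>R v2 | c. 0 \<le> c} \<nu> \<Upsilon>"
  then show ?thesis using w2.segment_side by blast
qed

end

text \<open>a + 2 M n = (a + n) + (M - 1) n + M n, and the last summand, a nonzero element of P,
  moves the sum from \<open>Pb\<close> into P. The clauses of \<open>side\<close> speak about P, not
  \<open>Pb\<close>.\<close>

lemma (in bar_monoid) add_double_multiple:
  assumes n: "n \<in> Pb" "n \<noteq> 0" and M: "0 < M" "smul M n \<in> P" and a: "a + n \<in> Pb"
  shows "smul (2 * M) n \<in> P" "a + smul (2 * M) n \<in> P"
proof -
  have e: "smul (2 * M) n = smul M n + smul M n" unfolding mult_2 by (rule smul_add)
  show "smul (2 * M) n \<in> P" unfolding e by (rule submonoid_add[OF P M(2,2)])
  obtain M' where M': "M = Suc M'" using M(1) by (metis gr0_implies_Suc)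
  have nz: "smul M n \<noteq> 0" using n(2) M(1) by (auto simp: prod_eq_iff)
  have "(a + n) + smul M' n \<in> Pb" by (rule submonoid_add[OF Pb a submonoid_smul[OF Pb n(1)]])
  then have "((a + n) + smul M' n) + smul M n \<in> P" by (rule Pb_add_P[OF _ M(2) nz])
  moreover have "((a + n) + smul M' n) + smul M n = a + smul (2 * M) n"
  proof -
    have "((a + n) + smul M' n) + smul M n = a + (smul M n + smul M n)"
      by (subst (2) M') (simp add: smul_Suc add.assoc)
    then show ?thesis by (simp only: e)
  qed
  ultimately show "a + smul (2 * M) n \<in> P" by simp
qed

lemma rat_cone_of_multiple:
  assumes k: "0 < k" "smul k a = smul i m1 + smul j m2" and m: "pt m1 \<in> rat_cone G" "pt m2 \<in> rat_cone G"
  shows "pt a \<in> rat_cone G"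
proof -
  have "real k *\<^sub>R pt a = real i *\<^sub>R pt m1 + real j *\<^sub>R pt m2" using arg_cong[OF k(2), of pt] by simp
  then have "(1 / real k) *\<^sub>R (real k *\<^sub>R pt a) = (1 / real k) *\<^sub>R (real i *\<^sub>R pt m1 + real j *\<^sub>R pt m2)" by simp
  then have e: "pt a = (real i / real k) *\<^sub>R pt m1 + (real j / real k) *\<^sub>R pt m2"
    using k(1) by (simp add: scaleR_right_distrib)
  show ?thesis unfolding e by (intro rat_cone_add rat_cone_rat_scale m) (simp_all add: Rats_divide)
qed

locale polygon_semigroup = polygon_rays +
  fixes P N Pb :: "(nat \<times> nat) set"
  assumes P_def: "P = polygonal_semigroup F" and Pb_bar: "Pb = semigroup_bar N P"
    and affine: "affine_semigroup P" and mg: "minimal_generating_set N P"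
begin

sublocale p: planar P N Pb l1 l2
  unfolding Pb_bar by (rule planar[OF mg P_def affine])

abbreviation "\<tau>1 \<equiv> {c *\<^sub>R v1 | c. 0 \<le> c}"
abbreviation "\<tau>2 \<equiv> {c *\<^sub>R v2 | c. 0 \<le> c}"

text \<open>The ray is a face: both functionals are nonnegative on P, so a generator split off an
  element on the ray stays on the ray.\<close>

lemma generator_on_ray1: "\<exists>s\<in>N. s \<noteq> 0 \<and> l1 s = 0" and generator_on_ray2: "\<exists>s\<in>N. s \<noteq> 0 \<and> l2 s = 0"
proof -
  obtain u1 u2 where u: "u1 \<in> P" "u1 \<noteq> 0" "l1 u1 = 0" "u2 \<in> P" "u2 \<noteq> 0" "l2 u2 = 0" using p.rays by blast
  obtain g q where g: "g \<in> N" "q \<in> P" "u1 = g + q" by (rule p.P_split[OF u(1,2)])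
  have "0 \<le> l1 g" "0 \<le> l1 q" using p.P_nonneg(1) p.N_P g by blast+
  then have "l1 g = 0" using u(3) g(3) by (simp add: p.l_add)
  then show "\<exists>s\<in>N. s \<noteq> 0 \<and> l1 s = 0" using g(1) p.N_zero by metis
  obtain h r where h: "h \<in> N" "r \<in> P" "u2 = h + r" by (rule p.P_split[OF u(4,5)])
  have "0 \<le> l2 h" "0 \<le> l2 r" using p.P_nonneg(2) p.N_P h by blast+
  then have "l2 h = 0" using u(6) h(3) by (simp add: p.l_add)
  then show "\<exists>s\<in>N. s \<noteq> 0 \<and> l2 s = 0" using h(1) p.N_zero by metis
qed

lemma ray_generators:
  obtains s1 s2 where "s1 \<in> N" "s1 \<in> P" "l1 s1 = 0" "0 < l2 s1" "s2 \<in> N" "s2 \<in> P" "l2 s2 = 0" "0 < l1 s2"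
proof -
  obtain s1 s2 where s: "s1 \<in> N" "s1 \<noteq> 0" "l1 s1 = 0" "s2 \<in> N" "s2 \<noteq> 0" "l2 s2 = 0"
    using generator_on_ray1 generator_on_ray2 by blast
  have sP: "s1 \<in> P" "s2 \<in> P" using s p.N_P by auto
  have "0 < l2 s1" "0 < l1 s2" using p.l_pos s sP p.P_nonneg by blast+
  then show thesis using that s sP by blast
qed

lemma cone_combination:
  assumes a: "0 \<le> l1 a" "0 \<le> l2 a" and s: "l1 s1 = 0" "0 < l2 s1" "l2 s2 = 0" "0 < l1 s2"
    and G: "pt s1 \<in> rat_cone G" "pt s2 \<in> rat_cone G"
  shows "pt a \<in> rat_cone G"
proof -
  obtain k i j where "0 < k" "smul k a = smul i s1 + smul j s2" using p.cramer[OF a s] by blast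
  then show ?thesis using G by (rule rat_cone_of_multiple)
qed

lemma P_rat_cone: assumes "a \<in> P" shows "pt a \<in> rat_cone F"
proof -
  obtain h f where f: "f \<in> F" "pt a = real h *\<^sub>R f" using assms unfolding P_def polygonal_semigroup_def by blast
  show ?thesis unfolding f(2) by (rule rat_cone_scaled[OF _ _ f(1)]) simp_all
qed

text \<open>Elements of P on the two rays yield every lattice point of the real cone with rational
  coefficients, by \<open>cramer\<close>.\<close>

lemma lattice_cone_iff: "a \<in> lattice_cone F \<longleftrightarrow> 0 \<le> l1 a \<and> 0 \<le> l2 a"
proof
  assume "a \<in> lattice_cone F"
  then have "pt a \<in> w1.W" using w1.rat_cone_W unfolding lattice_cone_def by blast
  then show "0 \<le> l1 a \<and> 0 \<le> l2 a" unfolding W_iff .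
next
  assume a: "0 \<le> l1 a \<and> 0 \<le> l2 a"
  obtain s1 s2 where s: "s1 \<in> N" "s1 \<in> P" "l1 s1 = 0" "0 < l2 s1" "s2 \<in> N" "s2 \<in> P" "l2 s2 = 0" "0 < l1 s2"
    by (rule ray_generators)
  have "pt a \<in> rat_cone F"
    using a by (intro cone_combination[OF _ _ s(3,4,7,8) P_rat_cone[OF s(2)] P_rat_cone[OF s(6)]]) simp_all
  then show "a \<in> lattice_cone F" by (simp add: lattice_cone_def)
qed

lemma simplicial: "simplicial_semigroup P"
proof -
  obtain s1 s2 where s: "s1 \<in> N" "s1 \<in> P" "l1 s1 = 0" "0 < l2 s1" "s2 \<in> N" "s2 \<in> P" "l2 s2 = 0" "0 < l1 s2"
    by (rule ray_generators)
  have ne: "s1 \<noteq> s2" using s by auto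
  have nz: "pt s2 \<noteq> 0" using s(8) by (auto simp: l1_def det2_def)
  have nin: "pt s1 \<notin> span {pt s2}"
  proof
    assume "pt s1 \<in> span {pt s2}"
    then obtain k where k: "pt s1 = k *\<^sub>R pt s2" unfolding span_singleton by blast
    have "l1 s1 = k * l1 s2" unfolding l1_def k by (simp add: det2_def algebra_simps)
    then have "k = 0" using s by simp
    then have "l2 s1 = 0" unfolding l2_def k by (simp add: det2_def)
    then show False using s by simp
  qed
  have ind: "independent {pt s1, pt s2}"
    unfolding independent_insert using nin nz by (simp add: dependent_single independent_empty)
  have "rat_cone (pt ` P) \<subseteq> rat_cone {pt s1, pt s2}"
  proof (rule rat_cone_minimal)
    fix q :: real and g assume q: "q \<in> \<rat>" "0 \<le> q" and "g \<in> pt ` P"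
    then obtain a where a: "a \<in> P" "g = pt a" by blast
    have mem: "pt s1 \<in> rat_cone {pt s1, pt s2}" "pt s2 \<in> rat_cone {pt s1, pt s2}"
      using rat_cone_scaled[of 1 "pt s1" "{pt s1, pt s2}"] rat_cone_scaled[of 1 "pt s2" "{pt s1, pt s2}"] by simp_all
    have "pt a \<in> rat_cone {pt s1, pt s2}"
      by (rule cone_combination[OF p.P_nonneg(1)[OF a(1)] p.P_nonneg(2)[OF a(1)] s(3,4,7,8) mem])
    then show "q *\<^sub>R g \<in> rat_cone {pt s1, pt s2}" unfolding a(2) using q by (rule rat_cone_rat_scale)
  qed (simp_all add: rat_cone_zero rat_cone_add)
  moreover have "rat_cone {pt s1, pt s2} \<subseteq> rat_cone (pt ` P)"
  proof (rule rat_cone_minimal)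
    fix q :: real and g assume q: "q \<in> \<rat>" "0 \<le> q" and g: "g \<in> {pt s1, pt s2}"
    have "g \<in> pt ` P" using g s(2,6) by blast
    then show "q *\<^sub>R g \<in> rat_cone (pt ` P)" by (rule rat_cone_scaled[OF q])
  qed (simp_all add: rat_cone_zero rat_cone_add)
  ultimately have "rat_cone (pt ` P) = rat_cone {pt s1, pt s2}" by (rule subset_antisym)
  then show ?thesis unfolding simplicial_semigroup_def using p.N_fin mg s(1,5) ne ind by blast
qed

lemma on_rays: "on_ray Pb \<tau>1 = {a \<in> Pb. l1 a = 0}" "on_ray Pb \<tau>2 = {a \<in> Pb. l2 a = 0}"
  unfolding on_ray_def using ray_iff p.Pb_nonneg by blast+

lemma interior_in_bar:
  assumes eq: "int_part \<tau>1 \<tau>2 (lattice_cone F) = int_part \<tau>1 \<tau>2 Pb" and a: "0 < l1 a" "0 < l2 a"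
  shows "a \<in> Pb"
proof -
  have ge: "0 \<le> l1 a" "0 \<le> l2 a" using a by simp_all
  have "a \<in> lattice_cone F" unfolding lattice_cone_iff using ge by simp
  moreover have "pt a \<notin> \<tau>1" "pt a \<notin> \<tau>2" unfolding ray_iff[OF ge] using a by simp_all
  ultimately have "a \<in> int_part \<tau>1 \<tau>2 (lattice_cone F)" unfolding int_part_def by blast
  then have "a \<in> int_part \<tau>1 \<tau>2 Pb" by (simp only: eq)
  then show ?thesis unfolding int_part_def by blast
qed

section \<open>The criterion in the two cases of the theorem\<close>

context
  fixes n1 n2 :: "nat \<times> nat"
  assumes n1: "minimal_generator n1 (on_ray Pb \<tau>1)" and n2: "minimal_generator n2 (on_ray Pb \<tau>2)"
begin

lemma n1_facts: "n1 \<in> Pb" "n1 \<noteq> 0" "l1 n1 = 0"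
    "a \<in> {a \<in> Pb. l1 a = 0} \<Longrightarrow> b \<in> {a \<in> Pb. l1 a = 0} \<Longrightarrow> n1 = a + b \<Longrightarrow> a = 0 \<or> b = 0"
  and n2_facts: "n2 \<in> Pb" "n2 \<noteq> 0" "l2 n2 = 0"
    "a \<in> {a \<in> Pb. l2 a = 0} \<Longrightarrow> b \<in> {a \<in> Pb. l2 a = 0} \<Longrightarrow> n2 = a + b \<Longrightarrow> a = 0 \<or> b = 0"
proof -
  obtain A where A: "minimal_generating_set A {a \<in> Pb. l1 a = 0}" "n1 \<in> A"
    using n1 unfolding minimal_generator_def on_rays by blast
  note i = minimal_generator_irreducible[OF A]
  show "n1 \<in> Pb" "n1 \<noteq> 0" "l1 n1 = 0" using i(1,2) by simp_all
  show "a \<in> {a \<in> Pb. l1 a = 0} \<Longrightarrow> b \<in> {a \<in> Pb. l1 a = 0} \<Longrightarrow> n1 = a + b \<Longrightarrow> a = 0 \<or> b = 0" by (rule i(3))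
  obtain B where B: "minimal_generating_set B {a \<in> Pb. l2 a = 0}" "n2 \<in> B"
    using n2 unfolding minimal_generator_def on_rays by blast
  note j = minimal_generator_irreducible[OF B]
  show "n2 \<in> Pb" "n2 \<noteq> 0" "l2 n2 = 0" using j(1,2) by simp_all
  show "a \<in> {a \<in> Pb. l2 a = 0} \<Longrightarrow> b \<in> {a \<in> Pb. l2 a = 0} \<Longrightarrow> n2 = a + b \<Longrightarrow> a = 0 \<or> b = 0" by (rule j(3))
qed

lemma buchsbaum_cm: "buchsbaum_semigroup TYPE('k::field) P \<longleftrightarrow> p.cm n1 n2"
  by (rule p.buchsbaum_iff_cm[OF n1_facts(1-3) n2_facts(1-3)])

lemma cm_full_interior:
  assumes eq: "int_part \<tau>1 \<tau>2 (lattice_cone F) = int_part \<tau>1 \<tau>2 Pb"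
  shows "p.cm n1 n2 \<longleftrightarrow> singly_generated (on_ray Pb \<tau>1) \<and> singly_generated (on_ray Pb \<tau>2)"
proof -
  interpret sw: planar P N Pb l2 l1 by (rule p.swap)
  have int: "a \<in> Pb" if "0 < l1 a" "0 < l2 a" for a by (rule interior_in_bar[OF eq that])
  show ?thesis unfolding on_rays
  proof (intro iffI conjI; (elim conjE)?)
    assume cm: "p.cm n1 n2"
    show "singly_generated {a \<in> Pb. l1 a = 0}"
      by (rule p.ray_generated_if_cm[OF cm n1_facts(1-3) n2_facts(1-3) int n1_facts(4)])
    have cm': "sw.cm n2 n1" using cm unfolding p.cm_def sw.cm_def by blast
    show "singly_generated {a \<in> Pb. l2 a = 0}"
      by (rule sw.ray_generated_if_cm[OF cm' n2_facts(1-3) n1_facts(1-3) int n2_facts(4)])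
  next
    assume sg: "singly_generated {a \<in> Pb. l1 a = 0}" "singly_generated {a \<in> Pb. l2 a = 0}"
    show "p.cm n1 n2"
      by (rule p.cm_if_rays_generated[OF n1_facts(1-3) n2_facts(1-3) int sg n1_facts(4) n2_facts(4)])
  qed
qed

text \<open>A point of \<Upsilon> enters P along both rays by the far-point clauses, and
  \<open>cm_grid\<close> puts it in \<open>Pb\<close>. Conversely, a counterexample a to
  \<open>cm\<close> avoids both sets \<Upsilon>1 and \<Upsilon>2, so the gap clauses place it on or
  beyond both lines.\<close>

lemma cm_strips:
  assumes s1: "w1.side \<nu>1 \<Upsilon>1 c1" and s2: "w2.side \<nu>2 \<Upsilon>2 c2" and Q: "Q \<in> \<nu>1" "Q \<in> \<nu>2"
  shows "p.cm n1 n2 \<longleftrightarrow> Upsilon' \<Upsilon>1 \<Upsilon>2 Pb n1 n2 = {} \<and> Upsilon F Q \<subseteq> Pb"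
proof -
  interpret sw: planar P N Pb l2 l1 by (rule p.swap)
  note S1 = s1[unfolded w1.side_def W_iff D_l P_def[symmetric]]
  note S2 = s2[unfolded w2.side_def W_iff D_l P_def[symmetric]]
  have c: "0 \<le> c1" "0 \<le> c2" using S1 S2 by simp_all
  have Qc: "det2 Q v1 = c1" "det2 v2 Q = c2" using S1 S2 Q by (simp_all add: det2_def algebra_simps)
  have gap1: "a \<in> \<Upsilon>1 \<or> a \<in> P \<or> c1 < l1 a \<or> l1 a = c1 \<and> \<tau>1 \<subseteq> rat_cone F"
    if "0 \<le> l1 a \<and> 0 \<le> l2 a" "u \<in> P" "l1 u = 0" "a + u \<in> P" for a u
    using S1[THEN conjunct2, THEN conjunct2, THEN conjunct1, rule_format, OF that] .
  have gap2: "a \<in> \<Upsilon>2 \<or> a \<in> P \<or> c2 < l2 a \<or> l2 a = c2 \<and> \<tau>2 \<subseteq> rat_cone F"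
    if "0 \<le> l1 a \<and> 0 \<le> l2 a" "u \<in> P" "l2 u = 0" "a + u \<in> P" for a u
    using S2[THEN conjunct2, THEN conjunct2, THEN conjunct1, rule_format, OF that] .
  have far1: "\<exists>K. a + smul K u \<in> P" if "0 \<le> l1 a \<and> 0 \<le> l2 a" "c1 \<le> l1 a" "u \<in> P" "u \<noteq> 0" "l1 u = 0" for a u
    using S1[THEN conjunct2, THEN conjunct2, THEN conjunct2, rule_format, OF that] .
  have far2: "\<exists>K. a + smul K u \<in> P" if "0 \<le> l1 a \<and> 0 \<le> l2 a" "c2 \<le> l2 a" "u \<in> P" "u \<noteq> 0" "l2 u = 0" for a u
    using S2[THEN conjunct2, THEN conjunct2, THEN conjunct2, rule_format, OF that] .
  obtain M1 where M1: "0 < M1" "smul M1 n1 \<in> P" using p.multiple_in_P[OF n1_facts(1-3)] by blast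
  obtain M2 where M2: "0 < M2" "smul M2 n2 \<in> P" using sw.multiple_in_P[OF n2_facts(1-3)] by blast
  have Mnz: "smul M1 n1 \<noteq> 0" "smul M2 n2 \<noteq> 0"
    using n1_facts(2) n2_facts(2) M1(1) M2(1) by (auto simp: prod_eq_iff)
  have Ml: "l1 (smul k n1) = 0" "l2 (smul k n2) = 0" for k using n1_facts(3) n2_facts(3) by (simp_all add: p.l_smul)
  show ?thesis
  proof
    assume cm: "p.cm n1 n2"
    have "Upsilon' \<Upsilon>1 \<Upsilon>2 Pb n1 n2 = {}" using cm unfolding Upsilon'_def p.cm_def by blast
    moreover have "Upsilon F Q \<subseteq> Pb"
    proof
      fix a assume "a \<in> Upsilon F Q"
      then obtain x where x: "x \<in> rat_cone F" "pt a = Q + x" unfolding Upsilon_def by blast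
      have "x \<in> w1.W" using x(1) w1.rat_cone_W by blast
      then have "0 \<le> det2 x v1" "0 \<le> det2 v2 x" unfolding w1.W_def by (simp_all add: det2_def)
      moreover have "l1 a = c1 + det2 x v1" "l2 a = c2 + det2 v2 x"
        unfolding l1_def l2_def x(2) Qc[symmetric] by (simp_all add: det2_def algebra_simps)
      ultimately have ge: "c1 \<le> l1 a" "c2 \<le> l2 a" by simp_all
      then have W: "0 \<le> l1 a \<and> 0 \<le> l2 a" using c by linarith
      obtain K1 where "a + smul K1 (smul M1 n1) \<in> P" using far1[OF W ge(1) M1(2) Mnz(1) Ml(1)] by blast
      then have A: "a + smul (K1 * M1) n1 \<in> Pb" unfolding smul_smul by (rule p.P_Pb)
      obtain K2 where "a + smul K2 (smul M2 n2) \<in> P" using far2[OF W ge(2) M2(2) Mnz(2) Ml(2)] by blast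
      then have B: "a + smul (K2 * M2) n2 \<in> Pb" unfolding smul_smul by (rule p.P_Pb)
      show "a \<in> Pb" by (rule p.cm_grid[OF cm n1_facts(1) n2_facts(1) A B])
    qed
    ultimately show "Upsilon' \<Upsilon>1 \<Upsilon>2 Pb n1 n2 = {} \<and> Upsilon F Q \<subseteq> Pb" by (rule conjI)
  next
    assume R: "Upsilon' \<Upsilon>1 \<Upsilon>2 Pb n1 n2 = {} \<and> Upsilon F Q \<subseteq> Pb"
    show "p.cm n1 n2" unfolding p.cm_def
    proof (intro allI impI, rule ccontr)
      fix a assume a: "a + n1 \<in> Pb" "a + n2 \<in> Pb" and no: "a \<notin> Pb"
      have W: "0 \<le> l1 a \<and> 0 \<le> l2 a"
        using p.Pb_nonneg(1)[OF a(1)] p.Pb_nonneg(2)[OF a(2)] n1_facts(3) n2_facts(3) by (simp add: p.l_add)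
      have noP: "a \<notin> P" using no p.P_Pb by blast
      have noY: "a \<notin> \<Upsilon>1" "a \<notin> \<Upsilon>2" using R no a unfolding Upsilon'_def by blast+
      note d1 = p.add_double_multiple[OF n1_facts(1,2) M1 a(1)]
      note d2 = p.add_double_multiple[OF n2_facts(1,2) M2 a(2)]
      have g1: "c1 < l1 a \<or> l1 a = c1 \<and> \<tau>1 \<subseteq> rat_cone F"
        using gap1[OF W d1(1) Ml(1) d1(2)] noP noY(1) by blast
      have g2: "c2 < l2 a \<or> l2 a = c2 \<and> \<tau>2 \<subseteq> rat_cone F"
        using gap2[OF W d2(1) Ml(2) d2(2)] noP noY(2) by blast
      define x where "x = pt a - Q"
      have e1: "D1 x v1 = l1 a - c1" "D1 v2 x = l2 a - c2"
        unfolding x_def l1_def l2_def Qc[symmetric] by (simp_all add: det2_def algebra_simps)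
      have e2: "D2 x v2 = l2 a - c2" "D2 v1 x = l1 a - c1"
        unfolding x_def l1_def l2_def Qc[symmetric] by (simp_all add: det2_def algebra_simps)
      have ge: "c1 \<le> l1 a" "c2 \<le> l2 a" using g1 g2 by auto
      have "x \<in> rat_cone F"
      proof (cases "c1 < l1 a \<and> c2 < l2 a")
        case True
        have "0 < D1 x v1" "0 < D1 v2 x" unfolding e1 using True by simp_all
        then show ?thesis by (rule w1.interior_rat_cone[OF int])
      next
        case False
        \<comment> \<open>On one of the lines, \<open>pt a - Q\<close> lies on a boundary ray, where
          rational coefficients are not automatic; the last alternative of the gap clause supplies
          them.\<close>
        then consider "l1 a = c1" "\<tau>1 \<subseteq> rat_cone F" | "l2 a = c2" "\<tau>2 \<subseteq> rat_cone F" using g1 g2 by blast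
        then show ?thesis
        proof cases
          case 1
          have "x \<in> w1.W" unfolding w1.W_def mem_Collect_eq e1 using ge by simp
          moreover have "D1 x v1 = 0" unfolding e1 using 1 by simp
          ultimately have "x \<in> \<tau>1" using w1.on_ray_iff by blast
          then show ?thesis using 1(2) by blast
        next
          case 2
          have "x \<in> w2.W" unfolding w2.W_def mem_Collect_eq e2 using ge by simp
          moreover have "D2 x v2 = 0" unfolding e2 using 2 by simp
          ultimately have "x \<in> \<tau>2" using w2.on_ray_iff by blast
          then show ?thesis using 2(2) by blast
        qed
      qed
      moreover have "pt a = Q + x" by (simp add: x_def)
      ultimately have "a \<in> Upsilon F Q" unfolding Upsilon_def by blast
      then show False using R no by blast
    qed
  qed
qed

end

end

theorem theorem6:
  fixes F \<tau>1 \<tau>2 \<nu>1 \<nu>2 :: "(real \<times> real) set"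
    and P Pbar C N \<Upsilon>1 \<Upsilon>2 :: "(nat \<times> nat) set"
    and n1' n2' :: "nat \<times> nat"
    and Q :: "real \<times> real"
  assumes polygon: "polytope F" "F \<noteq> {}" "\<not> (\<exists>a b. F = closed_segment a b)"
    and nonneg: "\<forall>x\<in>F. 0 \<le> fst x \<and> 0 \<le> snd x"
    and P: "P = polygonal_semigroup F"
    and affine: "affine_semigroup P"
    and C: "C = lattice_cone F"
    and rays: "extremal_rays F \<tau>1 \<tau>2"
    and N: "minimal_generating_set N P"
    and Pbar: "Pbar = semigroup_bar N P"
    and n1': "minimal_generator n1' (on_ray Pbar \<tau>1)"
    and n2': "minimal_generator n2' (on_ray Pbar \<tau>2)"
    and \<Upsilon>1: "nu_upsilon_1 F \<tau>1 \<tau>2 \<nu>1 \<Upsilon>1"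
    and \<Upsilon>2: "nu_upsilon_2 F \<tau>1 \<tau>2 \<nu>2 \<Upsilon>2"
    and Q: "\<nu>1 \<inter> \<nu>2 = {Q}"
  shows "simplicial_semigroup P \<and>
    (int_part \<tau>1 \<tau>2 C = int_part \<tau>1 \<tau>2 Pbar \<longrightarrow>
       (buchsbaum_semigroup TYPE('k::field) P \<longleftrightarrow>
          singly_generated (on_ray Pbar \<tau>1) \<and> singly_generated (on_ray Pbar \<tau>2))) \<and>
    (int_part \<tau>1 \<tau>2 C \<noteq> int_part \<tau>1 \<tau>2 Pbar \<longrightarrow>
       (buchsbaum_semigroup TYPE('k::field) P \<longleftrightarrow>
          Upsilon' \<Upsilon>1 \<Upsilon>2 Pbar n1' n2' = {} \<and> Upsilon F Q \<subseteq> Pbar))"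
proof -
  obtain v1 v2 where \<tau>: "\<tau>1 = {c *\<^sub>R v1 | c. 0 \<le> c}" "\<tau>2 = {c *\<^sub>R v2 | c. 0 \<le> c}"
    and faces: "{c *\<^sub>R v1 | c. 0 \<le> c} face_of (convex_cone hull F)" "{c *\<^sub>R v2 | c. 0 \<le> c} face_of (convex_cone hull F)"
    and slope: "snd v2 * fst v1 < snd v1 * fst v2"
    using rays unfolding extremal_rays_def by blast
  interpret S: polygon_semigroup F v1 v2 P N Pbar
    by (unfold_locales; (rule polygon nonneg[rule_format] faces P Pbar affine N; assumption?)?)
      (use slope in \<open>simp add: det2_def mult.commute\<close>)
  note n1'' = n1'[unfolded \<tau>] and n2'' = n2'[unfolded \<tau>]
  obtain c1 c2 where c: "S.w1.side \<nu>1 \<Upsilon>1 c1" "S.w2.side \<nu>2 \<Upsilon>2 c2"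
    using S.side1[OF \<Upsilon>1[unfolded \<tau>]] S.side2[OF \<Upsilon>2[unfolded \<tau>]] by blast
  have Q': "Q \<in> \<nu>1" "Q \<in> \<nu>2" using Q by blast+
  note buchsbaum = S.buchsbaum_cm[OF n1'' n2'', where 'k = 'k]
  show ?thesis unfolding C \<tau> buchsbaum
    using S.simplicial S.cm_full_interior[OF n1'' n2''] S.cm_strips[OF n1'' n2'' c Q'] by simp
qed

end
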